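(* Let $m\in\mathbb{N}$, $m\ge1$, and let $f:\Omega\to\mathbb{R}$ be a local function of degree $m$. There is a constant $C>0$, not depending on $t,n,\ell,h,\theta$, such that for every integer $\ell\ge2$ with $\ell>m$ and such that the support of $f$ is contained in $\{0,1,\dots,\ell-1\}$, every $t\in(0,T]$, every $n$, every $\theta(n)>0$ and any measurable function $h:[0,T]\times\mathbb{R}\to\mathbb{R}$, $(s,u)\mapsto h_s(u)$, $$\mathbb{E}_\rho\Big[\Big(\int_0^t\frac1{\theta(n)}\sum_{x\in\mathbb{Z}}h_s\Big(\frac xn\Big)\Big\{f(\tau_x\eta_s)-E_\rho\big[f(\tau_x\eta_s)\,\big|\,\eta_s^\ell(x)\big]\Big\}ds\Big)^2\Big]\le Ct\,\frac{c_m(\ell)}{n\,\theta(n)^2}\,\|h\|_{2,n}^2,$$ where $\|h\|_{2,n}^2=\sup_{s\in[0,T]}\frac1n\sum_{x\in\mathbb{Z}}h_s(x/n)^2$ and $c_1(\ell)=\ell^2$, $c_2(\ell)=\ell$, $c_3(\ell)=(\log\ell)^2$, $c_m(\ell)=1$ for $m\ge4$.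
   Context: Fix $a>0$, $\rho\in(0,1)$, $T>0$. Let $\Omega=\{0,1\}^{\mathbb{Z}}$, and for $n\in\mathbb{N}$ with $n\ge a^2$ let $p_n=\frac12+\frac{a}{2\sqrt n}$, $q_n=1-p_n$. The process $\{\eta_t : t\ge0\}$ (depending on $n$) is the Markov process on $\Omega$ with generator $n^2\mathcal{L}_n$, where on local functions $g:\Omega\to\mathbb{R}$ $$\mathcal{L}_ng(\eta)=\sum_{x\in\mathbb{Z}}\{p_n\eta(x)(1-\eta(x+1))+q_n\eta(x+1)(1-\eta(x))\}\,(g(\eta^{x,x+1})-g(\eta)),$$ and $\eta^{x,x+1}$ is $\eta$ with the values at $x$ and $x+1$ exchanged. For $\sigma\in[0,1]$ let $\nu_\sigma$ be the Bernoulli product measure on $\Omega$ with $\nu_\sigma\{\eta(x)=1\}=\sigma$ for all $x$, and $E_\sigma$ its expectation; $\mathbb{E}_\rho$ is expectation for the process $\eta_t$ started from $\nu_\rho$. Notation: a local function is one depending on finitely many coordinates. $\tau_x$ is the shift $(\tau_x\eta)(y)=\eta(x+y)$, so $\eta\mapsto f(\tau_x\eta)$ has support in $\{x,\dots,x+\ell-1\}$ when $f$ has support in $\{0,\dots,\ell-1\}$. For a local function $f$ put $\tilde f(\sigma)=E_\sigma[f]$; $f$ has degree $m$ (with respect to $\rho$) if $\tilde f^{(j)}(\rho)=0$ for $j=0,\dots,m-1$ and $\tilde f^{(m)}(\rho)\ne0$, where $\tilde f^{(j)}$ is the $j$-th derivative. For an integer $\ell\ge1$, $\eta^\ell(x)=\frac1\ell\sum_{y=x}^{x+\ell-1}\eta(y)$,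 and $\eta_s^\ell(x)$ is this quantity for $\eta=\eta_s$. The expression $E_\rho[g(\eta_s)\mid\eta_s^\ell(x)]$ is the $\nu_\rho$-conditional expectation of $g$ given $\eta^\ell(x)$, evaluated at $\eta_s$. Sums over $x\in\mathbb{Z}$ are $L^2$ limits; if the right-hand side is $+\infty$ nothing is asserted. *)

theory Defs
  imports "HOL-Probability.Probability"
begin

text \<open>A configuration \<open>\<eta> \<in> {0,1}\<^sup>\<int>\<close> is a function \<open>int \<Rightarrow> bool\<close>, \<open>True\<close> meaning an occupied site. Its topology
  is the product of the discrete topologies, for which the space is compact.\<close>

type_synonym config = "int \<Rightarrow> bool"

definition config_algebra :: "config measure" where
  "config_algebra = (\<Pi>\<^sub>M x\<in>UNIV. count_space UNIV)"

definition bernoulli_measure :: "real \<Rightarrow> config measure" where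
  "bernoulli_measure \<sigma> = (\<Pi>\<^sub>M x\<in>UNIV. measure_pmf (bernoulli_pmf \<sigma>))"

definition supported_in :: "int set \<Rightarrow> (config \<Rightarrow> real) \<Rightarrow> bool" where
  "supported_in A g \<longleftrightarrow> (\<forall>\<eta> \<xi>. (\<forall>x\<in>A. \<eta> x = \<xi> x) \<longrightarrow> g \<eta> = g \<xi>)"

definition local_function :: "(config \<Rightarrow> real) \<Rightarrow> bool" where
  "local_function g \<longleftrightarrow> (\<exists>A. finite A \<and> supported_in A g)"

definition shift :: "int \<Rightarrow> config \<Rightarrow> config" where
  "shift x \<eta> = (\<lambda>y. \<eta> (x + y))"

definition exchange :: "int \<Rightarrow> int \<Rightarrow> config \<Rightarrow> config" where
  "exchange x y \<eta> = \<eta>(x := \<eta> y, y := \<eta> x)"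

text \<open>For \<open>\<sigma> \<notin> [0,1]\<close> the library truncates the parameter of \<open>bernoulli_pmf\<close> to \<open>[0,1]\<close>; this does not
  affect derivatives at points of the open interval.\<close>

definition mean_at :: "(config \<Rightarrow> real) \<Rightarrow> real \<Rightarrow> real" where
  "mean_at f \<sigma> = (\<integral>\<eta>. f \<eta> \<partial>bernoulli_measure \<sigma>)"

definition has_degree :: "real \<Rightarrow> (config \<Rightarrow> real) \<Rightarrow> nat \<Rightarrow> bool" where
  "has_degree \<rho> f m \<longleftrightarrow>
     (\<forall>j<m. (deriv ^^ j) (mean_at f) \<rho> = 0) \<and> (deriv ^^ m) (mean_at f) \<rho> \<noteq> 0"

definition block_average :: "nat \<Rightarrow> int \<Rightarrow> config \<Rightarrow> real" where
  "block_average l x \<eta> = (1 / real l) * (\<Sum>y = x..x + int l - 1. of_bool (\<eta> y))"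

text \<open>For \<open>0 < \<rho> < 1\<close> the block average takes finitely many values, each with positive probability, so
  this version of the conditional expectation is determined at every configuration.\<close>

definition cond_exp_block ::
  "real \<Rightarrow> nat \<Rightarrow> int \<Rightarrow> (config \<Rightarrow> real) \<Rightarrow> config \<Rightarrow> real" where
  "cond_exp_block \<rho> l x g =
     real_cond_exp (bernoulli_measure \<rho>) (vimage_algebra UNIV (block_average l x) borel) g"

definition p_rate :: "real \<Rightarrow> nat \<Rightarrow> real" where
  "p_rate a n = 1 / 2 + a / (2 * sqrt (real n))"

definition q_rate :: "real \<Rightarrow> nat \<Rightarrow> real" where
  "q_rate a n = 1 - p_rate a n"

text \<open>For local \<open>g\<close> only finitely many terms of the sum are nonzero.\<close>

definition exclusion_operator :: "real \<Rightarrow> nat \<Rightarrow> (config \<Rightarrow> real) \<Rightarrow> config \<Rightarrow> real" where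
  "exclusion_operator a n g \<eta> =
     (\<Sum>\<^sub>\<infinity>x. (p_rate a n * of_bool (\<eta> x) * (1 - of_bool (\<eta> (x + 1)))
           + q_rate a n * of_bool (\<eta> (x + 1)) * (1 - of_bool (\<eta> x)))
          * (g (exchange x (x + 1) \<eta>) - g \<eta>))"

definition markov_semigroup :: "(real \<Rightarrow> (config \<Rightarrow>\<^sub>C real) \<Rightarrow> (config \<Rightarrow>\<^sub>C real)) \<Rightarrow> bool" where
  "markov_semigroup S \<longleftrightarrow>
     (\<forall>t\<ge>0. linear (S t)) \<and>
     (\<forall>g. S 0 g = g) \<and>
     (\<forall>s\<ge>0. \<forall>t\<ge>0. \<forall>g. S (s + t) g = S s (S t g)) \<and>
     (\<forall>t\<ge>0. S t (const_bcontfun 1) = const_bcontfun 1) \<and>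
     (\<forall>t\<ge>0. \<forall>g. (\<forall>\<eta>. 0 \<le> apply_bcontfun g \<eta>) \<longrightarrow> (\<forall>\<eta>. 0 \<le> apply_bcontfun (S t g) \<eta>)) \<and>
     (\<forall>t\<ge>0. \<forall>g. ((\<lambda>s. S s g) \<longlongrightarrow> S t g) (at_right t))"

definition generator_graph ::
  "(real \<Rightarrow> (config \<Rightarrow>\<^sub>C real) \<Rightarrow> (config \<Rightarrow>\<^sub>C real)) \<Rightarrow> ((config \<Rightarrow>\<^sub>C real) \<times> (config \<Rightarrow>\<^sub>C real)) set" where
  "generator_graph S = {(g, k). ((\<lambda>t. (S t g - g) /\<^sub>R t) \<longlongrightarrow> k) (at_right 0)}"

text \<open>The semigroup generated by \<open>n\<^sup>2 L\<^sub>n\<close>: its generator is the closure, in the supremum norm, of \<open>n\<^sup>2 L\<^sub>n\<close> on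
  local functions.\<close>

definition exclusion_semigroup ::
  "real \<Rightarrow> nat \<Rightarrow> (real \<Rightarrow> (config \<Rightarrow>\<^sub>C real) \<Rightarrow> (config \<Rightarrow>\<^sub>C real)) \<Rightarrow> bool" where
  "exclusion_semigroup a n S \<longleftrightarrow>
     markov_semigroup S \<and>
     generator_graph S =
       closure {(g, k). local_function (apply_bcontfun g) \<and>
         (\<forall>\<eta>. apply_bcontfun k \<eta> = (real n)\<^sup>2 * exclusion_operator a n (apply_bcontfun g) \<eta>)}"

definition natural_filtration :: "'w measure \<Rightarrow> (real \<Rightarrow> 'w \<Rightarrow> config) \<Rightarrow> real \<Rightarrow> 'w measure" where
  "natural_filtration M X s =
     sigma (space M) (\<Union>r\<in>{0..s}. {X r -` A \<inter> space M |A. A \<in> sets config_algebra})"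

text \<open>Only times \<open>t \<ge> 0\<close> matter; values at negative times are unconstrained.\<close>

definition markov_process ::
  "(real \<Rightarrow> (config \<Rightarrow>\<^sub>C real) \<Rightarrow> (config \<Rightarrow>\<^sub>C real)) \<Rightarrow> 'w measure \<Rightarrow> (real \<Rightarrow> 'w \<Rightarrow> config) \<Rightarrow> bool" where
  "markov_process S M X \<longleftrightarrow>
     prob_space M \<and>
     (\<forall>t\<ge>0. X t \<in> measurable M config_algebra) \<and>
     (\<forall>\<omega>\<in>space M. (\<forall>t\<ge>0. ((\<lambda>s. X s \<omega>) \<longlongrightarrow> X t \<omega>) (at_right t)) \<and>
                   (\<forall>t>0. \<exists>\<xi>. ((\<lambda>s. X s \<omega>) \<longlongrightarrow> \<xi>) (at_left t))) \<and>
     (\<forall>s\<ge>0. \<forall>t\<ge>0. \<forall>g. AE \<omega> in M.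
        real_cond_exp M (natural_filtration M X s) (\<lambda>\<omega>. apply_bcontfun g (X (s + t) \<omega>)) \<omega>
          = apply_bcontfun (S t g) (X s \<omega>))"

definition exclusion_process ::
  "real \<Rightarrow> real \<Rightarrow> nat \<Rightarrow> 'w measure \<Rightarrow> (real \<Rightarrow> 'w \<Rightarrow> config) \<Rightarrow> bool" where
  "exclusion_process a \<rho> n M X \<longleftrightarrow>
     (\<exists>S. exclusion_semigroup a n S \<and> markov_process S M X) \<and>
     distr M config_algebra (X 0) = bernoulli_measure \<rho>"

text \<open>Convergence in \<open>L\<^sup>2(M)\<close> of the net of finite partial sums.\<close>

definition has_L2_sum :: "'w measure \<Rightarrow> (int \<Rightarrow> 'w \<Rightarrow> real) \<Rightarrow> ('w \<Rightarrow> real) \<Rightarrow> bool" where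
  "has_L2_sum M Y Z \<longleftrightarrow>
     Z \<in> borel_measurable M \<and>
     ((\<lambda>A. \<integral>\<^sup>+\<omega>. ennreal (((\<Sum>x\<in>A. Y x \<omega>) - Z \<omega>)\<^sup>2) \<partial>M) \<longlongrightarrow> 0) (finite_subsets_at_top UNIV)"

text \<open>\<open>G s\<close> is, for each \<open>s \<in> [0,t]\<close>, the sum over \<open>x \<in> \<int>\<close> under the time integral. An \<open>L\<^sup>2\<close> limit is only
  defined up to null sets, so \<open>G\<close> has to be a jointly measurable version for its time integral to make
  sense; by Fubini, any two such versions have almost surely the same time integral.\<close>

definition fluctuation_sum ::
  "real \<Rightarrow> real \<Rightarrow> nat \<Rightarrow> nat \<Rightarrow> (config \<Rightarrow> real) \<Rightarrow> (real \<Rightarrow> real \<Rightarrow> real) \<Rightarrow>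
    'w measure \<Rightarrow> (real \<Rightarrow> 'w \<Rightarrow> config) \<Rightarrow> (real \<Rightarrow> 'w \<Rightarrow> real) \<Rightarrow> bool" where
  "fluctuation_sum \<rho> t n l f h M X G \<longleftrightarrow>
     (\<lambda>(s, \<omega>). G s \<omega>) \<in> borel_measurable (restrict_space borel {0..t} \<Otimes>\<^sub>M M) \<and>
     (\<forall>s\<in>{0..t}. has_L2_sum M
        (\<lambda>x \<omega>. h s (of_int x / real n) *
          (f (shift x (X s \<omega>)) - cond_exp_block \<rho> l x (\<lambda>\<eta>. f (shift x \<eta>)) (X s \<omega>)))
        (G s))"

definition norm2_sq :: "real \<Rightarrow> nat \<Rightarrow> (real \<Rightarrow> real \<Rightarrow> real) \<Rightarrow> ennreal" where
  "norm2_sq T n h =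
     (SUP s\<in>{0..T}. ennreal (1 / real n) * (\<Sum>\<^sub>\<infinity>x::int. ennreal ((h s (of_int x / real n))\<^sup>2)))"

definition c_const :: "nat \<Rightarrow> nat \<Rightarrow> real" where
  "c_const m l =
     (if m = 1 then (real l)\<^sup>2 else if m = 2 then real l else if m = 3 then (ln (real l))\<^sup>2 else 1)"

end

theory Submission
  imports Defs
begin

text \<open>The bound is an estimate in a dual Sobolev norm. Let \<open>F\<^sub>s\<close> be the sum of \<open>h\<^sub>s (x/n) V\<^sub>x\<close>, where \<open>V\<^sub>x\<close> is
  \<open>f \<circ> \<tau>\<^sub>x\<close> minus its conditional expectation, and let \<open>L\<close> be the accelerated generator. If \<open>U\<close> solves the backward
  equation \<open>\<partial>\<^sub>s U = - L U - F\<^sub>s\<close> with \<open>U\<^sub>t = 0\<close>, then the second moment of the time integral of \<open>F\<^sub>s (\<eta>\<^sub>s)\<close> in the stationary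
  process is twice the time integral of \<open>\<langle>F\<^sub>s, U\<^sub>s\<rangle>\<close>, and differentiating the squared norm of \<open>U\<^sub>s\<close> shows that this is at
  least twice the time integral of \<open>\<langle>U\<^sub>s, - L U\<^sub>s\<rangle>\<close>. So if \<open>2 \<langle>F\<^sub>s, g\<rangle> \<le> \<kappa> + \<langle>g, - L g\<rangle>\<close> for every local \<open>g\<close>, the second moment is
  at most \<open>2 \<kappa> t\<close>. The energy \<open>\<langle>g, - L g\<rangle>\<close> is \<open>n\<^sup>2 / 4\<close> times the sum over the bonds of the squared norms of
  \<open>g - g \<circ> exchange\<close> (\<open>energy_identity\<close>): the drift contributes a telescoping sum whose boundary term vanishes.

  What remains is static: \<open>\<langle>\<Sum>\<^sub>x c\<^sub>x V\<^sub>x, g\<rangle>\<close> has to be bounded by a multiple of the square root of \<open>c\<^sub>m (l)\<close> times the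
  norm of \<open>c\<close> times the square root of that sum over the bonds (\<open>block_fluctuation_dual_estimate\<close>). In the expansion of
  \<open>f\<close> in products of centred variables \<open>\<eta>(i) - \<rho>\<close>, the conditional expectation given the particle number of a block replaces
  each product of degree \<open>k\<close> by the mean of all products of degree \<open>k\<close> in the block, and the degree condition says that the
  coefficients of each degree \<open>k < m\<close> add up to zero. The block is enlarged by one site at a time, from a fixed block that carries \<open>f\<close>
  to the block of length \<open>l\<close>. Passing from \<open>j\<close> to \<open>j + 1\<close> sites changes the mean of degree \<open>k\<close> by an average of terms that are
  antisymmetric under the exchange of the new site with an old one, and each of these terms has norm of order
  \<open>j\<close> to the power \<open>- (k + 1) / 2\<close> (\<open>l2_sym_mean_remove\<close>). Pairing such a term with \<open>g\<close> costs the square root of \<open>j\<close>, the length of a path of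
  nearest-neighbour exchanges, and the overlap of the translated blocks costs the same again. Scale \<open>j\<close> therefore contributes
  \<open>j\<close> to the power \<open>(1 - m) / 2\<close>, and the sum of these over \<open>j < l\<close> has the order of the square root of \<open>c\<^sub>m (l)\<close>.

  As \<open>h\<close> is only measurable in time, the backward equation is solved in a discrete form: on a grid of mesh \<open>\<delta>\<close> the
  function \<open>F\<close> is replaced by impulses, and one step of the semigroup costs an error of order \<open>\<delta>\<^sup>2\<close>
  (\<open>kipnis_varadhan_discrete\<close>). Since the paths are right-continuous, Riemann sums that evaluate the path at right
  endpoints converge, and Fatou's lemma carries the bound over to the time integral
  (\<open>time_integral_second_moment\<close>).

  The sum over all of \<open>\<int>\<close> is treated by truncation. A truncation level that depends measurably on the time gives a jointly
  measurable version of the sum, and for any such version the truncation error tends to zero in the mean square over time and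
  probability, which carries the bound over from finite sums (\<open>L2_limit_is_L2_sum\<close>, \<open>L2_sum_integral_bound\<close>).\<close>

section \<open>Configurations and the Bernoulli measure\<close>

lemma space_bernoulli [simp]: "space (bernoulli_measure \<sigma>) = UNIV"
  by (simp add: bernoulli_measure_def space_PiM)

lemma space_config_algebra [simp]: "space config_algebra = UNIV"
  by (simp add: config_algebra_def space_PiM)

lemma sets_bernoulli [simp, measurable_cong]: "sets (bernoulli_measure \<sigma>) = sets config_algebra"
  unfolding bernoulli_measure_def config_algebra_def by (intro sets_PiM_cong) auto

lemma prob_space_bernoulli: "prob_space (bernoulli_measure \<sigma>)"
  unfolding bernoulli_measure_def by (intro prob_space_PiM) (simp add: measure_pmf.prob_space_axioms)

lemma coord_measurable [measurable]: "(\<lambda>\<eta>. \<eta> x) \<in> measurable config_algebra (count_space UNIV)"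
  unfolding config_algebra_def by measurable

lemma config_map_measurable:
  assumes "\<And>x. (\<lambda>\<omega>. F \<omega> x) \<in> measurable M (count_space (UNIV::bool set))"
  shows "F \<in> measurable M config_algebra"
  unfolding config_algebra_def
  by (rule measurable_PiM_single') (use assms in \<open>auto simp: space_PiM\<close>)

lemma distr_bernoulli_reindex:
  assumes "inj \<pi>"
  shows "distr (bernoulli_measure \<sigma>) config_algebra (\<lambda>\<eta> x. \<eta> (\<pi> x)) = bernoulli_measure \<sigma>"
proof -
  have "distr (bernoulli_measure \<sigma>) (bernoulli_measure \<sigma>) (\<lambda>\<eta>. \<lambda>x\<in>UNIV. \<eta> (\<pi> x)) = bernoulli_measure \<sigma>"
    unfolding bernoulli_measure_def
    by (rule distr_PiM_reindex[where f=\<pi>]) (use assms in \<open>auto simp: measure_pmf.prob_space_axioms\<close>)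
  moreover have "distr (bernoulli_measure \<sigma>) (bernoulli_measure \<sigma>) F = distr (bernoulli_measure \<sigma>) config_algebra F" for F
    by (rule distr_cong) auto
  ultimately show ?thesis by (simp add: restrict_def)
qed

lemma reindex_measurable: "(\<lambda>\<eta> x. \<eta> (\<pi> x)) \<in> measurable config_algebra config_algebra"
  by (rule config_map_measurable) simp

lemma integral_bernoulli_reindex:
  assumes "inj \<pi>" "g \<in> borel_measurable config_algebra"
  shows "(\<integral>\<eta>. g (\<lambda>x. \<eta> (\<pi> x)) \<partial>bernoulli_measure \<sigma>) = (\<integral>\<eta>. (g \<eta>::real) \<partial>bernoulli_measure \<sigma>)"
proof -
  have "(\<integral>\<eta>. g \<eta> \<partial>distr (bernoulli_measure \<sigma>) config_algebra (\<lambda>\<eta> x. \<eta> (\<pi> x)))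
      = (\<integral>\<eta>. g (\<lambda>x. \<eta> (\<pi> x)) \<partial>bernoulli_measure \<sigma>)"
    by (rule integral_distr[OF _ assms(2)]) (simp add: reindex_measurable cong: measurable_cong_sets)
  then show ?thesis by (simp only: distr_bernoulli_reindex[OF assms(1)])
qed

lemma exchange_eq: "exchange x y \<eta> = (\<lambda>z. \<eta> (Transposition.transpose x y z))"
  by (auto simp: exchange_def Transposition.transpose_def fun_eq_iff)

lemma exchange_measurable [measurable]: "exchange x y \<in> measurable config_algebra config_algebra"
  unfolding exchange_eq by (rule reindex_measurable)

lemma exchange_exchange [simp]: "exchange x y (exchange x y \<eta>) = \<eta>"
  by (auto simp: exchange_eq)

lemma integral_exchange:
  assumes "g \<in> borel_measurable config_algebra"
  shows "(\<integral>\<eta>. g (exchange x y \<eta>) \<partial>bernoulli_measure \<sigma>) = (\<integral>\<eta>. (g \<eta>::real) \<partial>bernoulli_measure \<sigma>)"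
  unfolding exchange_eq by (rule integral_bernoulli_reindex[OF _ assms]) (rule inj_transpose)

lemma integral_bernoulli_prod:
  fixes \<phi> :: "int \<Rightarrow> bool \<Rightarrow> real"
  assumes "finite J"
  shows "(\<integral>\<eta>. (\<Prod>i\<in>J. \<phi> i (\<eta> i)) \<partial>bernoulli_measure \<sigma>)
    = (\<Prod>i\<in>J. \<integral>b. \<phi> i b \<partial>measure_pmf (bernoulli_pmf \<sigma>))"
proof -
  let ?N = "\<lambda>_::int. measure_pmf (bernoulli_pmf \<sigma>)"
  interpret product_prob_space ?N UNIV by unfold_locales
  have fs: "product_sigma_finite ?N" by unfold_locales
  have "(\<integral>\<eta>. (\<Prod>i\<in>J. \<phi> i (\<eta> i)) \<partial>bernoulli_measure \<sigma>)
      = (\<integral>\<eta>. (\<Prod>i\<in>J. \<phi> i (restrict \<eta> J i)) \<partial>PiM UNIV ?N)"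
    unfolding bernoulli_measure_def by (intro Bochner_Integration.integral_cong refl prod.cong) auto
  also have "\<dots> = (\<integral>\<eta>. (\<Prod>i\<in>J. \<phi> i (\<eta> i)) \<partial>distr (PiM UNIV ?N) (PiM J ?N) (\<lambda>x. restrict x J))"
    by (subst integral_distr)
       (auto intro!: measurable_restrict_subset borel_measurable_prod
          measurable_compose[OF measurable_component_singleton])
  also have "\<dots> = (\<integral>\<eta>. (\<Prod>i\<in>J. \<phi> i (\<eta> i)) \<partial>PiM J ?N)"
    by (subst distr_PiM_restrict_finite) (use assms in auto)
  also have "\<dots> = (\<Prod>i\<in>J. \<integral>b. \<phi> i b \<partial>?N i)"
    by (rule product_sigma_finite.product_integral_prod[OF fs assms])
       (auto intro!: integrable_measure_pmf_finite)
  finally show ?thesis .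
qed

text \<open>A class that contains the local and the continuous functions, is closed under the algebraic operations and
  consists of integrable functions; it keeps integrability out of the computations below.\<close>

definition bounded_meas :: "(config \<Rightarrow> real) \<Rightarrow> bool" where
  "bounded_meas g \<longleftrightarrow> g \<in> borel_measurable config_algebra \<and> (\<exists>B. \<forall>\<eta>. \<bar>g \<eta>\<bar> \<le> B)"

lemma bounded_measI: "g \<in> borel_measurable config_algebra \<Longrightarrow> (\<And>\<eta>. \<bar>g \<eta>\<bar> \<le> B) \<Longrightarrow> bounded_meas g"
  by (auto simp: bounded_meas_def)

lemma bounded_meas_measurable [measurable_dest]:
  "bounded_meas g \<Longrightarrow> g \<in> borel_measurable config_algebra"
  by (simp add: bounded_meas_def)

lemma bounded_meas_const [simp]: "bounded_meas (\<lambda>_. c)"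
  by (auto simp: bounded_meas_def)

lemma bounded_meas_add:
  assumes "bounded_meas g" "bounded_meas k" shows "bounded_meas (\<lambda>\<eta>. g \<eta> + k \<eta>)"
proof -
  from assms obtain B C where "\<forall>\<eta>. \<bar>g \<eta>\<bar> \<le> B" "\<forall>\<eta>. \<bar>k \<eta>\<bar> \<le> C" by (auto simp: bounded_meas_def)
  moreover have "\<bar>g \<eta> + k \<eta>\<bar> \<le> \<bar>g \<eta>\<bar> + \<bar>k \<eta>\<bar>" for \<eta> by simp
  ultimately have "\<bar>g \<eta> + k \<eta>\<bar> \<le> B + C" for \<eta> by (meson add_mono order_trans)
  then show ?thesis using assms by (intro bounded_measI[where B="B+C"]) (auto dest: bounded_meas_measurable)
qed

lemma bounded_meas_mult:
  assumes "bounded_meas g" "bounded_meas k" shows "bounded_meas (\<lambda>\<eta>. g \<eta> * k \<eta>)"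
proof -
  from assms obtain B C where "\<forall>\<eta>. \<bar>g \<eta>\<bar> \<le> B" "\<forall>\<eta>. \<bar>k \<eta>\<bar> \<le> C" by (auto simp: bounded_meas_def)
  then have "\<bar>g \<eta> * k \<eta>\<bar> \<le> B * C" for \<eta> unfolding abs_mult by (intro mult_mono) (auto intro: order_trans[OF abs_ge_zero])
  then show ?thesis using assms by (intro bounded_measI[where B="B*C"]) (auto dest: bounded_meas_measurable)
qed

lemma bounded_meas_uminus: "bounded_meas g \<Longrightarrow> bounded_meas (\<lambda>\<eta>. - g \<eta>)"
  by (auto simp: bounded_meas_def)

lemma bounded_meas_diff:
  assumes "bounded_meas g" "bounded_meas k" shows "bounded_meas (\<lambda>\<eta>. g \<eta> - k \<eta>)"
  using bounded_meas_add[OF assms(1) bounded_meas_uminus[OF assms(2)]] by simp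

lemma bounded_meas_divide: "bounded_meas g \<Longrightarrow> bounded_meas (\<lambda>\<eta>. g \<eta> / c)"
  using bounded_meas_mult[of g "\<lambda>_. inverse c"] by (simp add: divide_inverse)

lemma bounded_meas_sum:
  "(\<And>i. i \<in> I \<Longrightarrow> bounded_meas (g i)) \<Longrightarrow> bounded_meas (\<lambda>\<eta>. \<Sum>i\<in>I. g i \<eta>)"
  by (induction I rule: infinite_finite_induct) (auto intro: bounded_meas_add)

lemma bounded_meas_prod:
  "(\<And>i. i \<in> I \<Longrightarrow> bounded_meas (g i)) \<Longrightarrow> bounded_meas (\<lambda>\<eta>. \<Prod>i\<in>I. g i \<eta>)"
  by (induction I rule: infinite_finite_induct) (auto intro: bounded_meas_mult)

lemma bounded_meas_exchange: "bounded_meas g \<Longrightarrow> bounded_meas (\<lambda>\<eta>. g (exchange x y \<eta>))"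
  by (auto simp: bounded_meas_def)

lemma bounded_meas_coord: "bounded_meas (\<lambda>\<eta>. of_bool (\<eta> x))"
  by (rule bounded_measI[where B=1]) auto

lemma bounded_meas_integrable [intro, simp]:
  assumes "bounded_meas g" shows "integrable (bernoulli_measure \<sigma>) g"
proof -
  interpret prob_space "bernoulli_measure \<sigma>" by (rule prob_space_bernoulli)
  from assms obtain B where "\<forall>\<eta>. \<bar>g \<eta>\<bar> \<le> B" by (auto simp: bounded_meas_def)
  then show ?thesis
    by (intro integrable_const_bound[where B=B]) (use assms in \<open>auto dest: bounded_meas_measurable\<close>)
qed

definition centred_monomial :: "real \<Rightarrow> int set \<Rightarrow> config \<Rightarrow> real" where
  "centred_monomial \<rho> S \<eta> = (\<Prod>i\<in>S. of_bool (\<eta> i) - \<rho>)"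

lemma bounded_meas_centred_monomial [simp]: "bounded_meas (centred_monomial \<rho> S)"
  unfolding centred_monomial_def
  by (intro bounded_meas_prod bounded_meas_diff bounded_meas_coord bounded_meas_const)

lemmas bounded_meas_intros =
  bounded_meas_const bounded_meas_add bounded_meas_mult bounded_meas_uminus bounded_meas_diff
  bounded_meas_divide bounded_meas_sum bounded_meas_prod
  bounded_meas_coord bounded_meas_centred_monomial

lemma abs_centred_monomial_le:
  assumes "0 \<le> \<rho>" "\<rho> \<le> 1" shows "\<bar>centred_monomial \<rho> S \<eta>\<bar> \<le> 1"
  unfolding centred_monomial_def abs_prod
  by (rule prod_le_1) (use assms in \<open>auto simp: of_bool_def\<close>)

lemma centred_monomial_shift:
  "centred_monomial \<rho> S (shift x \<eta>) = centred_monomial \<rho> ((+) x ` S) \<eta>"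
  unfolding centred_monomial_def shift_def by (subst prod.reindex) auto

lemma centred_monomial_exchange:
  "centred_monomial \<rho> S (exchange x y \<eta>) = centred_monomial \<rho> (Transposition.transpose x y ` S) \<eta>"
  unfolding centred_monomial_def exchange_eq by (subst prod.reindex) auto

lemma integral_centred_monomial:
  assumes "finite S" "0 \<le> \<sigma>" "\<sigma> \<le> 1"
  shows "(\<integral>\<eta>. centred_monomial \<rho> S \<eta> \<partial>bernoulli_measure \<sigma>) = (\<sigma> - \<rho>) ^ card S"
proof -
  have "(\<integral>b. (of_bool b - \<rho>) \<partial>measure_pmf (bernoulli_pmf \<sigma>)) = \<sigma> - \<rho>"
    using assms by (subst integral_bernoulli_pmf) (auto simp: algebra_simps)
  with integral_bernoulli_prod[OF assms(1), of \<sigma> "\<lambda>_ b. of_bool b - \<rho>"] show ?thesis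
    by (simp add: centred_monomial_def)
qed

lemma integral_centred_monomial_mult:
  assumes "finite S" "finite S'" "0 \<le> \<rho>" "\<rho> \<le> 1"
  shows "(\<integral>\<eta>. centred_monomial \<rho> S \<eta> * centred_monomial \<rho> S' \<eta> \<partial>bernoulli_measure \<rho>)
    = (if S = S' then (\<rho> * (1 - \<rho>)) ^ card S else 0)"
proof -
  define \<phi> where "\<phi> = (\<lambda>i b. (if i \<in> S then of_bool b - \<rho> else 1) * (if i \<in> S' then of_bool b - \<rho> else (1::real)))"
  have "(\<Prod>i\<in>S \<union> S'. if i \<in> S then of_bool (\<eta> i) - \<rho> else 1) = centred_monomial \<rho> S \<eta>" for \<eta>
    unfolding centred_monomial_def using assms by (subst prod.inter_restrict[symmetric]) (auto intro: prod.cong)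
  moreover have "(\<Prod>i\<in>S \<union> S'. if i \<in> S' then of_bool (\<eta> i) - \<rho> else 1) = centred_monomial \<rho> S' \<eta>" for \<eta>
    unfolding centred_monomial_def using assms by (subst prod.inter_restrict[symmetric]) (auto intro: prod.cong)
  ultimately have eq: "centred_monomial \<rho> S \<eta> * centred_monomial \<rho> S' \<eta> = (\<Prod>i\<in>S \<union> S'. \<phi> i (\<eta> i))" for \<eta>
    by (simp add: \<phi>_def prod.distrib)
  have I: "(\<integral>b. \<phi> i b \<partial>measure_pmf (bernoulli_pmf \<rho>)) = (if i \<in> S \<and> i \<in> S' then \<rho> * (1 - \<rho>) else 0)"
    if "i \<in> S \<union> S'" for i
    using assms that
    by (subst integral_bernoulli_pmf) (auto simp: \<phi>_def algebra_simps power2_eq_square)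
  have "(\<integral>\<eta>. centred_monomial \<rho> S \<eta> * centred_monomial \<rho> S' \<eta> \<partial>bernoulli_measure \<rho>)
    = (\<Prod>i\<in>S \<union> S'. if i \<in> S \<and> i \<in> S' then \<rho> * (1 - \<rho>) else 0)"
    unfolding eq by (subst integral_bernoulli_prod) (use assms in \<open>auto simp del: integral_bernoulli_pmf intro!: prod.cong[OF refl I]\<close>)
  also have "\<dots> = (if S = S' then (\<rho> * (1 - \<rho>)) ^ card S else 0)"
    using assms by (auto intro!: prod_zero)
  finally show ?thesis .
qed

text \<open>As a function of the occupation of a single site \<open>a\<close>, every \<open>f\<close> is affine in \<open>\<eta>(a) - \<rho>\<close>, and both of its coefficients
  are supported in the remaining sites.\<close>

lemma supported_in_fourier:
  assumes "finite A" "supported_in A f"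
  shows "\<exists>\<gamma>. \<forall>\<eta>. f \<eta> = (\<Sum>S\<in>Pow A. \<gamma> S * centred_monomial \<rho> S \<eta>)"
  using assms
proof (induction A arbitrary: f rule: finite_induct)
  case empty
  then have "f \<eta> = f (\<lambda>_. False)" for \<eta> by (auto simp: supported_in_def)
  then show ?case by (intro exI[of _ "\<lambda>_. f (\<lambda>_. False)"]) (auto simp: centred_monomial_def)
next
  case (insert a A)
  define u where "u \<eta> = (1 - \<rho>) * f (\<eta>(a := False)) + \<rho> * f (\<eta>(a := True))" for \<eta>
  define v where "v \<eta> = f (\<eta>(a := True)) - f (\<eta>(a := False))" for \<eta>
  have sup: "f (\<eta>(a := b)) = f (\<xi>(a := b))" if "\<forall>x\<in>A. \<eta> x = \<xi> x" for \<eta> \<xi> b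
    using insert.prems that unfolding supported_in_def by simp
  have uv: "u \<eta> = u \<xi> \<and> v \<eta> = v \<xi>" if "\<forall>x\<in>A. \<eta> x = \<xi> x" for \<eta> \<xi>
    using sup[OF that, of True] sup[OF that, of False] by (simp add: u_def v_def)
  have "supported_in A u" "supported_in A v" using uv by (simp_all add: supported_in_def)
  with insert.IH obtain \<alpha> \<beta> where
    \<alpha>: "\<And>\<eta>. u \<eta> = (\<Sum>S\<in>Pow A. \<alpha> S * centred_monomial \<rho> S \<eta>)" and
    \<beta>: "\<And>\<eta>. v \<eta> = (\<Sum>S\<in>Pow A. \<beta> S * centred_monomial \<rho> S \<eta>)" by metis
  define \<gamma> where "\<gamma> S = (if a \<in> S then \<beta> (S - {a}) else \<alpha> S)" for S
  have f: "f \<eta> = u \<eta> + (of_bool (\<eta> a) - \<rho>) * v \<eta>" for \<eta>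
    by (cases "\<eta> a") (auto simp: u_def v_def algebra_simps fun_upd_idem)
  have "(\<Sum>S\<in>Pow (insert a A). \<gamma> S * centred_monomial \<rho> S \<eta>) = f \<eta>" for \<eta>
  proof -
    have inj: "inj_on (insert a) (Pow A)" using insert.hyps by (auto simp: inj_on_def)
    have "(\<Sum>S\<in>Pow (insert a A). \<gamma> S * centred_monomial \<rho> S \<eta>) =
      (\<Sum>S\<in>Pow A. \<gamma> S * centred_monomial \<rho> S \<eta>) + (\<Sum>S\<in>insert a ` Pow A. \<gamma> S * centred_monomial \<rho> S \<eta>)"
      unfolding Pow_insert using insert.hyps by (subst sum.union_disjoint) auto
    also have "(\<Sum>S\<in>Pow A. \<gamma> S * centred_monomial \<rho> S \<eta>) = u \<eta>"
      unfolding \<alpha> using insert.hyps by (intro sum.cong) (auto simp: \<gamma>_def)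
    also have "(\<Sum>S\<in>insert a ` Pow A. \<gamma> S * centred_monomial \<rho> S \<eta>) = (of_bool (\<eta> a) - \<rho>) * v \<eta>"
      unfolding \<beta> sum_distrib_left sum.reindex[OF inj] o_def
    proof (intro sum.cong refl)
      fix S assume "S \<in> Pow A"
      then have "finite S" "a \<notin> S" using insert.hyps finite_subset by auto
      then show "\<gamma> (insert a S) * centred_monomial \<rho> (insert a S) \<eta>
        = (of_bool (\<eta> a) - \<rho>) * (\<beta> S * centred_monomial \<rho> S \<eta>)"
        by (simp add: \<gamma>_def centred_monomial_def)
    qed
    finally show ?thesis using f by simp
  qed
  then show ?case by metis
qed

lemma local_function_bounded_meas:
  assumes "local_function f" shows "bounded_meas f"
proof -
  from assms obtain A where "finite A" "supported_in A f" by (auto simp: local_function_def)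
  from supported_in_fourier[OF this, of 0] obtain \<gamma> where
    "f = (\<lambda>\<eta>. \<Sum>S\<in>Pow A. \<gamma> S * centred_monomial 0 S \<eta>)" by (auto simp: fun_eq_iff)
  then show ?thesis by (auto intro!: bounded_meas_intros)
qed

lemma continuous_coord: "continuous_on UNIV (\<lambda>\<eta>::config. of_bool (\<eta> x) :: real)"
proof -
  have "continuous_on UNIV (\<lambda>\<eta>::config. \<eta> x)" by simp
  moreover have "continuous_on UNIV (of_bool :: bool \<Rightarrow> real)"
    by (simp add: continuous_on_open_vimage open_discrete)
  ultimately have "continuous_on UNIV ((of_bool :: bool \<Rightarrow> real) \<circ> (\<lambda>\<eta>::config. \<eta> x))"
    by (metis continuous_on_compose continuous_on_subset subset_UNIV)
  then show ?thesis by (simp add: o_def)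
qed

lemma local_function_continuous:
  assumes "local_function f" shows "continuous_on UNIV f"
proof -
  from assms obtain A where "finite A" "supported_in A f" by (auto simp: local_function_def)
  from supported_in_fourier[OF this, of 0] obtain \<gamma> where
    "f = (\<lambda>\<eta>. \<Sum>S\<in>Pow A. \<gamma> S * centred_monomial 0 S \<eta>)" by (auto simp: fun_eq_iff)
  then show ?thesis unfolding centred_monomial_def by (auto intro!: continuous_intros continuous_coord)
qed

lemma local_function_bcontfun:
  assumes "local_function f" shows "f \<in> bcontfun"
proof -
  obtain B where "\<forall>\<eta>. \<bar>f \<eta>\<bar> \<le> B" using local_function_bounded_meas[OF assms] by (auto simp: bounded_meas_def)
  then show ?thesis using local_function_continuous[OF assms] by (intro bcontfun_normI) auto
qed

lemma tendsto_configI: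
  fixes F :: "'b \<Rightarrow> config"
  assumes "\<And>x. ((\<lambda>k. F k x) \<longlongrightarrow> L x) G"
  shows "(F \<longlongrightarrow> L) G"
proof -
  have "limitin (product_topology (\<lambda>_::int. euclidean :: bool topology) UNIV) F L G"
    using assms by (subst limitin_componentwise) (auto simp: limitin_canonical_iff)
  then show ?thesis by (simp add: euclidean_product_topology limitin_canonical_iff)
qed

text \<open>Continuity refers to the product topology and measurability to the product algebra. The two meet in local functions:
  emptying a configuration outside a growing window turns a continuous function into local functions that converge to it
  pointwise.\<close>

lemma bcontfun_bounded_meas [simp]: "bounded_meas (apply_bcontfun (g :: config \<Rightarrow>\<^sub>C real))"
proof -
  define r where "r N \<eta> = (\<lambda>x::int. \<bar>x\<bar> \<le> int N \<and> \<eta> x)" for N :: nat and \<eta>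
  have loc: "local_function (\<lambda>\<eta>. apply_bcontfun g (r N \<eta>))" for N
    unfolding local_function_def supported_in_def
  proof (intro exI[of _ "{- int N..int N}"] conjI allI impI)
    fix \<eta> \<xi> :: config assume "\<forall>x\<in>{- int N..int N}. \<eta> x = \<xi> x"
    then have "r N \<eta> = r N \<xi>" by (auto simp: r_def fun_eq_iff abs_le_iff)
    then show "apply_bcontfun g (r N \<eta>) = apply_bcontfun g (r N \<xi>)" by simp
  qed auto
  have lim: "(\<lambda>N. apply_bcontfun g (r N \<eta>)) \<longlonglongrightarrow> apply_bcontfun g \<eta>" for \<eta>
  proof -
    have "(\<lambda>N. r N \<eta>) \<longlonglongrightarrow> \<eta>"
    proof (rule tendsto_configI)
      fix x
      have "\<forall>\<^sub>F N in sequentially. r N \<eta> x = \<eta> x"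
        using eventually_ge_at_top[of "nat \<bar>x\<bar>"] by eventually_elim (auto simp: r_def)
      then show "(\<lambda>N. r N \<eta> x) \<longlonglongrightarrow> \<eta> x" by (rule tendsto_eventually)
    qed
    then show ?thesis
      using continuous_on_tendsto_compose[OF continuous_on_apply_bcontfun[of UNIV g]] by auto
  qed
  have "apply_bcontfun g \<in> borel_measurable config_algebra"
    by (rule borel_measurable_LIMSEQ_real[OF lim]) (use local_function_bounded_meas[OF loc] in \<open>auto dest: bounded_meas_measurable\<close>)
  moreover have "\<bar>apply_bcontfun g \<eta>\<bar> \<le> norm g" for \<eta> using norm_bounded[of g \<eta>] by simp
  ultimately show ?thesis by (rule bounded_measI)
qed

section \<open>Exchanges and the bond energy\<close>

locale bernoulli_density =
  fixes \<rho> :: real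
  assumes rho_pos: "0 < \<rho>" and rho_less_1: "\<rho> < 1"
begin

abbreviation "\<nu> \<equiv> bernoulli_measure \<rho>"

abbreviation "\<Psi> \<equiv> centred_monomial \<rho>"

sublocale prob_space "bernoulli_measure \<rho>" by (rule prob_space_bernoulli)

definition dot :: "(config \<Rightarrow> real) \<Rightarrow> (config \<Rightarrow> real) \<Rightarrow> real" where
  "dot g k = (\<integral>\<eta>. g \<eta> * k \<eta> \<partial>\<nu>)"

definition l2 :: "(config \<Rightarrow> real) \<Rightarrow> real" where
  "l2 g = sqrt (dot g g)"

lemma dot_integrable: "bounded_meas g \<Longrightarrow> bounded_meas k \<Longrightarrow> integrable \<nu> (\<lambda>\<eta>. g \<eta> * k \<eta>)"
  by (intro bounded_meas_integrable bounded_meas_mult)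

lemma dot_commute: "dot g k = dot k g"
  by (simp add: dot_def mult.commute)

lemma dot_add_left: "bounded_meas g \<Longrightarrow> bounded_meas g' \<Longrightarrow> bounded_meas k \<Longrightarrow>
    dot (\<lambda>\<eta>. g \<eta> + g' \<eta>) k = dot g k + dot g' k"
  by (simp add: dot_def distrib_right dot_integrable)

lemma dot_diff_left: "bounded_meas g \<Longrightarrow> bounded_meas g' \<Longrightarrow> bounded_meas k \<Longrightarrow>
    dot (\<lambda>\<eta>. g \<eta> - g' \<eta>) k = dot g k - dot g' k"
  by (simp add: dot_def left_diff_distrib dot_integrable)

lemma dot_scale_left: "dot (\<lambda>\<eta>. c * g \<eta>) k = c * dot g k"
  by (simp add: dot_def mult.assoc)

lemma dot_divide_left: "dot (\<lambda>\<eta>. g \<eta> / c) k = dot g k / c"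
  by (simp add: dot_def)

lemma dot_uminus_left: "dot (\<lambda>\<eta>. - g \<eta>) k = - dot g k"
  by (simp add: dot_def)

lemma dot_sum_left:
  assumes "\<And>i. i \<in> I \<Longrightarrow> bounded_meas (g i)" "bounded_meas k"
  shows "dot (\<lambda>\<eta>. \<Sum>i\<in>I. g i \<eta>) k = (\<Sum>i\<in>I. dot (g i) k)"
  unfolding dot_def sum_distrib_right
  by (rule Bochner_Integration.integral_sum) (use assms dot_integrable in auto)

lemma dot_add_right: "bounded_meas g \<Longrightarrow> bounded_meas k \<Longrightarrow> bounded_meas k' \<Longrightarrow>
    dot g (\<lambda>\<eta>. k \<eta> + k' \<eta>) = dot g k + dot g k'"
  by (simp add: dot_commute[of g] dot_add_left)

lemma dot_diff_right: "bounded_meas g \<Longrightarrow> bounded_meas k \<Longrightarrow> bounded_meas k' \<Longrightarrow>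
    dot g (\<lambda>\<eta>. k \<eta> - k' \<eta>) = dot g k - dot g k'"
  by (simp add: dot_commute[of g] dot_diff_left)

lemma dot_exchange:
  assumes "bounded_meas g" "bounded_meas k"
  shows "dot (\<lambda>\<eta>. g (exchange x y \<eta>)) (\<lambda>\<eta>. k (exchange x y \<eta>)) = dot g k"
  unfolding dot_def
  by (rule integral_exchange) (use bounded_meas_mult[OF assms] in \<open>simp add: bounded_meas_def\<close>)

lemma dot_self_nonneg [simp]: "0 \<le> dot g g"
  unfolding dot_def by (intro Bochner_Integration.integral_nonneg) simp

lemma l2_nonneg [simp]: "0 \<le> l2 g" by (simp add: l2_def)

lemma l2_power2: "(l2 g)\<^sup>2 = dot g g" by (simp add: l2_def)

text \<open>The usual discriminant argument for the form \<open>\<langle>g - s k, g - s k\<rangle> \<ge> 0\<close>.\<close>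

lemma Cauchy_Schwarz_dot:
  assumes g: "bounded_meas g" and k: "bounded_meas k"
  shows "\<bar>dot g k\<bar> \<le> l2 g * l2 k"
proof -
  have *: "0 \<le> dot g g - 2 * s * dot g k + s\<^sup>2 * dot k k" for s
  proof -
    have bs: "bounded_meas (\<lambda>\<eta>. s * k \<eta>)" using k by (intro bounded_meas_intros)
    have "0 \<le> dot (\<lambda>\<eta>. g \<eta> - s * k \<eta>) (\<lambda>\<eta>. g \<eta> - s * k \<eta>)" by simp
    also have "\<dots> = dot g g - 2 * s * dot g k + s\<^sup>2 * dot k k"
      using g k bs bounded_meas_diff[OF g bs]
      by (simp add: dot_diff_left dot_diff_right dot_scale_left dot_commute[of _ "\<lambda>\<eta>. s * k \<eta>"]
          dot_commute[of k g] power2_eq_square algebra_simps)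
    finally show ?thesis .
  qed
  have "(dot g k)\<^sup>2 \<le> dot g g * dot k k"
  proof (cases "dot k k = 0")
    case True
    have "dot g k = 0"
    proof (rule ccontr)
      assume n: "dot g k \<noteq> 0"
      have "0 \<le> dot g g - 2 * ((dot g g + 1) / (2 * dot g k)) * dot g k"
        using *[of "(dot g g + 1) / (2 * dot g k)"] True by simp
      with n show False by simp
    qed
    then show ?thesis using True by simp
  next
    case False
    then have p: "0 < dot k k" using dot_self_nonneg[of k] by linarith
    have "0 \<le> (dot g g - 2 * (dot g k / dot k k) * dot g k + (dot g k / dot k k)\<^sup>2 * dot k k) * dot k k"
      using *[of "dot g k / dot k k"] p by simp
    also have "\<dots> = dot g g * dot k k - (dot g k)\<^sup>2" using p by (simp add: field_simps power2_eq_square)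
    finally show ?thesis by simp
  qed
  then have "\<bar>dot g k\<bar> \<le> sqrt (dot g g * dot k k)" by (simp add: real_le_rsqrt)
  then show ?thesis by (simp add: l2_def real_sqrt_mult)
qed

lemma l2_triangle:
  assumes g: "bounded_meas g" and k: "bounded_meas k"
  shows "l2 (\<lambda>\<eta>. g \<eta> + k \<eta>) \<le> l2 g + l2 k"
proof -
  have "(l2 (\<lambda>\<eta>. g \<eta> + k \<eta>))\<^sup>2 = (l2 g)\<^sup>2 + 2 * dot g k + (l2 k)\<^sup>2"
    unfolding l2_power2 using g k bounded_meas_add[OF g k]
    by (simp add: dot_add_left dot_add_right dot_commute[of k g])
  also have "\<dots> \<le> (l2 g + l2 k)\<^sup>2"
    using Cauchy_Schwarz_dot[OF g k] by (simp add: power2_sum)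
  finally show ?thesis by (rule power2_le_imp_le) simp
qed

definition grad :: "int \<Rightarrow> int \<Rightarrow> (config \<Rightarrow> real) \<Rightarrow> real" where
  "grad i j g = l2 (\<lambda>\<eta>. g \<eta> - g (exchange i j \<eta>))"

text \<open>For a local \<open>g\<close> and all the bonds that touch its support, this is \<open>-4\<close> times the inner product of \<open>g\<close> with the
  exclusion operator applied to \<open>g\<close>.\<close>

definition bond_energy :: "int set \<Rightarrow> (config \<Rightarrow> real) \<Rightarrow> real" where
  "bond_energy Z g = (\<Sum>z\<in>Z. (grad z (z + 1) g)\<^sup>2)"

lemma grad_nonneg [simp]: "0 \<le> grad i j g" by (simp add: grad_def)

lemma bond_energy_nonneg [simp]: "0 \<le> bond_energy Z g" by (simp add: bond_energy_def sum_nonneg)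

lemma bond_energy_mono: "finite Z' \<Longrightarrow> Z \<subseteq> Z' \<Longrightarrow> bond_energy Z g \<le> bond_energy Z' g"
  unfolding bond_energy_def by (rule sum_mono2) auto

lemma grad_sym: "grad i j g = grad j i g"
proof -
  have "exchange i j = exchange j i" by (auto simp: exchange_eq fun_eq_iff transpose_commute)
  then show ?thesis by (simp add: grad_def)
qed

lemma l2_exchange:
  "bounded_meas g \<Longrightarrow> l2 (\<lambda>\<eta>. g (exchange x y \<eta>)) = l2 g"
  unfolding l2_def by (simp add: dot_exchange)

text \<open>The exchange of \<open>i\<close> and \<open>j + 1\<close> is the exchange of \<open>i\<close> and \<open>j\<close> conjugated by the exchange of \<open>j\<close> and \<open>j + 1\<close>, so
  one more site costs two more nearest-neighbour exchanges.\<close>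

lemma grad_path_step:
  assumes g: "bounded_meas g" and "i < j"
  shows "grad i (j + 1) g \<le> grad i j g + 2 * grad j (j + 1) g"
proof -
  let ?s = "exchange j (j + 1)" and ?t = "exchange i j"
  have eq: "exchange i (j + 1) \<eta> = ?s (?t (?s \<eta>))" for \<eta>
    using \<open>i < j\<close> by (auto simp: exchange_def fun_eq_iff)
  have gs: "bounded_meas (\<lambda>\<eta>. g (?s \<eta>))" and gt: "bounded_meas (\<lambda>\<eta>. g (?t \<eta>))"
    and gts: "bounded_meas (\<lambda>\<eta>. g (?t (?s \<eta>)))" and gsts: "bounded_meas (\<lambda>\<eta>. g (?s (?t (?s \<eta>))))"
    and gst: "bounded_meas (\<lambda>\<eta>. g (?s (?t \<eta>)))"
    using bounded_meas_exchange[OF g] bounded_meas_exchange[OF bounded_meas_exchange[OF g]]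
      bounded_meas_exchange[OF bounded_meas_exchange[OF bounded_meas_exchange[OF g]]] by auto
  have "grad i (j + 1) g = l2 (\<lambda>\<eta>. (g \<eta> - g (?s \<eta>)) + ((g (?s \<eta>) - g (?t (?s \<eta>))) + (g (?t (?s \<eta>)) - g (?s (?t (?s \<eta>))))))"
    unfolding grad_def eq by simp
  also have "\<dots> \<le> l2 (\<lambda>\<eta>. g \<eta> - g (?s \<eta>)) + l2 (\<lambda>\<eta>. (g (?s \<eta>) - g (?t (?s \<eta>))) + (g (?t (?s \<eta>)) - g (?s (?t (?s \<eta>)))))"
    by (intro l2_triangle bounded_meas_add bounded_meas_diff g gs gts gsts)
  also have "l2 (\<lambda>\<eta>. (g (?s \<eta>) - g (?t (?s \<eta>))) + (g (?t (?s \<eta>)) - g (?s (?t (?s \<eta>)))))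
    \<le> l2 (\<lambda>\<eta>. g (?s \<eta>) - g (?t (?s \<eta>))) + l2 (\<lambda>\<eta>. g (?t (?s \<eta>)) - g (?s (?t (?s \<eta>))))"
    by (intro l2_triangle bounded_meas_add bounded_meas_diff g gs gts gsts)
  also have "l2 (\<lambda>\<eta>. g (?s \<eta>) - g (?t (?s \<eta>))) = grad i j g"
    unfolding grad_def using l2_exchange[OF bounded_meas_diff[OF g gt], of j "j + 1"] by simp
  also have "l2 (\<lambda>\<eta>. g (?t (?s \<eta>)) - g (?s (?t (?s \<eta>)))) = l2 (\<lambda>\<eta>. g (?t \<eta>) - g (?s (?t \<eta>)))"
    using l2_exchange[OF bounded_meas_diff[OF gt gst], of j "j + 1"] by simp
  also have "\<dots> = grad j (j + 1) g"
    unfolding grad_def using l2_exchange[OF bounded_meas_diff[OF g gs], of i j] by simp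
  finally show ?thesis unfolding grad_def by simp
qed

lemma grad_path_sum:
  assumes g: "bounded_meas g" and "i < j"
  shows "grad i j g \<le> 2 * (\<Sum>z\<in>{i..<j}. grad z (z + 1) g)"
proof -
  have "i + 1 \<le> j" using \<open>i < j\<close> by simp
  then show ?thesis
  proof (induction j rule: int_ge_induct)
    case base
    have "{i..<i + 1} = {i}" by auto
    then show ?case by simp
  next
    case (step j)
    have "{i..<j + 1} = insert j {i..<j}" using step by auto
    then show ?case using step grad_path_step[OF g, of i j] by simp
  qed
qed

lemma grad_le_bond_energy:
  assumes g: "bounded_meas g" and ij: "i < j" "{i..<j} \<subseteq> Z" "finite Z" "j - i \<le> int L"
  shows "grad i j g \<le> 2 * sqrt (real L) * sqrt (bond_energy Z g)"
proof -
  have "(\<Sum>z\<in>{i..<j}. grad z (z + 1) g)\<^sup>2 \<le> real (card {i..<j}) * bond_energy {i..<j} g"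
    unfolding bond_energy_def using Cauchy_Schwarz_ineq_sum[of "\<lambda>_. 1" "\<lambda>z. grad z (z + 1) g" "{i..<j}"] by simp
  also have "\<dots> \<le> real L * bond_energy Z g"
    using ij by (intro mult_mono bond_energy_mono) auto
  finally have "(\<Sum>z\<in>{i..<j}. grad z (z + 1) g) \<le> sqrt (real L) * sqrt (bond_energy Z g)"
    by (simp add: real_le_rsqrt real_sqrt_mult[symmetric])
  then show ?thesis using grad_path_sum[OF g \<open>i < j\<close>] by simp
qed

text \<open>An antisymmetric \<open>w\<close> only sees the antisymmetric part \<open>(g - g \<circ> exchange) / 2\<close> of \<open>g\<close>. The factor \<open>1/2\<close>
  compensates for the two passages through each bond in the path from \<open>i\<close> to \<open>j\<close>.\<close>

lemma dot_antisymmetric_le: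
  assumes w: "bounded_meas w" and g: "bounded_meas g"
    and anti: "\<And>\<eta>. w (exchange i j \<eta>) = - w \<eta>" and ij: "i \<noteq> j"
    and Z: "finite Z" "i \<in> {x..x + int L}" "j \<in> {x..x + int L}" "{x..<x + int L} \<subseteq> Z"
  shows "\<bar>dot w g\<bar> \<le> l2 w * (sqrt (real L) * sqrt (bond_energy Z g))"
proof -
  have ge: "bounded_meas (\<lambda>\<eta>. g (exchange i j \<eta>))" by (rule bounded_meas_exchange[OF g])
  have "dot w g = dot (\<lambda>\<eta>. w (exchange i j \<eta>)) (\<lambda>\<eta>. g (exchange i j \<eta>))"
    by (rule dot_exchange[OF w g, symmetric])
  also have "\<dots> = - dot w (\<lambda>\<eta>. g (exchange i j \<eta>))" by (simp add: anti dot_uminus_left)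
  finally have "2 * dot w g = dot w (\<lambda>\<eta>. g \<eta> - g (exchange i j \<eta>))"
    using w g ge by (simp add: dot_diff_right)
  then have "2 * \<bar>dot w g\<bar> \<le> l2 w * grad i j g"
    using Cauchy_Schwarz_dot[OF w bounded_meas_diff[OF g ge]] by (simp add: grad_def)
  moreover have "grad i j g \<le> 2 * sqrt (real L) * sqrt (bond_energy Z g)"
  proof (cases "i < j")
    case True
    then show ?thesis using Z by (intro grad_le_bond_energy[OF g]) auto
  next
    case False
    then have "grad j i g \<le> 2 * sqrt (real L) * sqrt (bond_energy Z g)"
      using Z ij by (intro grad_le_bond_energy[OF g]) auto
    then show ?thesis by (simp add: grad_sym)
  qed
  ultimately have "2 * \<bar>dot w g\<bar> \<le> l2 w * (2 * sqrt (real L) * sqrt (bond_energy Z g))"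
    by (meson l2_nonneg mult_left_mono order_trans)
  then show ?thesis by (simp add: algebra_simps)
qed

text \<open>The square root of \<open>L\<close> is the price of overlap: a bond lies in at most \<open>L\<close> of the translated blocks.\<close>

lemma superposition_le:
  assumes "finite A" "finite Z" "\<And>x. x \<in> A \<Longrightarrow> {x..<x + int L} \<subseteq> Z" "0 \<le> w"
    and u: "\<And>x. x \<in> A \<Longrightarrow> \<bar>u x\<bar> \<le> w * sqrt (bond_energy {x..<x + int L} g)"
  shows "\<bar>\<Sum>x\<in>A. c x * u x\<bar> \<le> w * sqrt (real L) * sqrt (\<Sum>x\<in>A. (c x)\<^sup>2) * sqrt (bond_energy Z g)"
proof -
  let ?e = "\<lambda>z. (grad z (z + 1) g)\<^sup>2"
  have "(\<Sum>x\<in>A. bond_energy {x..<x + int L} g) = (\<Sum>x\<in>A. \<Sum>z\<in>Z. of_bool (z \<in> {x..<x + int L}) * ?e z)"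
    unfolding bond_energy_def
  proof (rule sum.cong[OF refl])
    fix x assume "x \<in> A"
    then have "{x..<x + int L} = {z \<in> Z. z \<in> {x..<x + int L}}" using assms(3) by auto
    then have "sum ?e {x..<x + int L} = sum ?e {z \<in> Z. z \<in> {x..<x + int L}}" by simp
    also have "\<dots> = (\<Sum>z\<in>Z. of_bool (z \<in> {x..<x + int L}) * ?e z)"
      unfolding sum.inter_filter[OF assms(2)] by (intro sum.cong refl) auto
    finally show "sum ?e {x..<x + int L} = (\<Sum>z\<in>Z. of_bool (z \<in> {x..<x + int L}) * ?e z)" .
  qed
  also have "\<dots> = (\<Sum>z\<in>Z. real (card {x \<in> A. z \<in> {x..<x + int L}}) * ?e z)"
    using assms(1) by (subst sum.swap) (auto intro!: sum.cong simp: sum_distrib_right[symmetric] Int_def)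
  also have "\<dots> \<le> (\<Sum>z\<in>Z. real L * ?e z)"
  proof (intro sum_mono mult_right_mono)
    fix z
    have "card {x \<in> A. z \<in> {x..<x + int L}} \<le> card {z - int L<..z}" by (intro card_mono) auto
    then show "real (card {x \<in> A. z \<in> {x..<x + int L}}) \<le> real L" by simp
  qed simp
  finally have ov: "(\<Sum>x\<in>A. bond_energy {x..<x + int L} g) \<le> real L * bond_energy Z g"
    by (simp add: bond_energy_def sum_distrib_left)
  have "\<bar>\<Sum>x\<in>A. c x * u x\<bar> \<le> (\<Sum>x\<in>A. \<bar>c x\<bar> * (w * sqrt (bond_energy {x..<x + int L} g)))"
    by (rule order_trans[OF sum_abs]) (auto intro!: sum_mono mult_left_mono u simp: abs_mult)
  also have "\<dots> = w * (\<Sum>x\<in>A. \<bar>c x\<bar> * sqrt (bond_energy {x..<x + int L} g))"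
    by (simp add: sum_distrib_left ac_simps)
  also have "\<dots> \<le> w * (sqrt (\<Sum>x\<in>A. (c x)\<^sup>2) * sqrt (real L * bond_energy Z g))"
  proof (intro mult_left_mono \<open>0 \<le> w\<close>)
    have "(\<Sum>x\<in>A. \<bar>c x\<bar> * sqrt (bond_energy {x..<x + int L} g))\<^sup>2
        \<le> (\<Sum>x\<in>A. (c x)\<^sup>2) * (\<Sum>x\<in>A. bond_energy {x..<x + int L} g)"
      using Cauchy_Schwarz_ineq_sum[of "\<lambda>x. \<bar>c x\<bar>" "\<lambda>x. sqrt (bond_energy {x..<x + int L} g)" A] by simp
    also have "\<dots> \<le> (\<Sum>x\<in>A. (c x)\<^sup>2) * (real L * bond_energy Z g)"
      by (intro mult_left_mono ov sum_nonneg) simp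
    finally show "(\<Sum>x\<in>A. \<bar>c x\<bar> * sqrt (bond_energy {x..<x + int L} g)) \<le> sqrt (\<Sum>x\<in>A. (c x)\<^sup>2) * sqrt (real L * bond_energy Z g)"
      by (simp add: real_le_rsqrt real_sqrt_mult[symmetric])
  qed
  finally show ?thesis by (simp add: real_sqrt_mult ac_simps)
qed

end

section \<open>Symmetric means of centred monomials\<close>

context bernoulli_density
begin

text \<open>The normalised elementary symmetric polynomial of degree \<open>k\<close> in the centred variables of \<open>B\<close>. It is the conditional expectation
  of each monomial \<open>\<Psi> S\<close> with \<open>S \<subseteq> B\<close> and \<open>card S = k\<close> given the number of particles in \<open>B\<close>.\<close>

definition sym_mean :: "nat \<Rightarrow> int set \<Rightarrow> config \<Rightarrow> real" where
  "sym_mean k B \<eta> = (\<Sum>S | S \<subseteq> B \<and> card S = k. \<Psi> S \<eta>) / real (card B choose k)"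

lemma prob_UNIV [simp]: "prob UNIV = 1"
  using prob_space by simp

lemma bounded_meas_sym_mean [simp]: "bounded_meas (sym_mean k B)"
  unfolding sym_mean_def by (intro bounded_meas_intros)

lemma dot_self_monomials:
  assumes "finite F" "\<And>S. S \<in> F \<Longrightarrow> finite S"
  shows "dot (\<lambda>\<eta>. \<Sum>S\<in>F. b S * \<Psi> S \<eta>) (\<lambda>\<eta>. \<Sum>S\<in>F. b S * \<Psi> S \<eta>)
    = (\<Sum>S\<in>F. (b S)\<^sup>2 * (\<rho> * (1 - \<rho>)) ^ card S)"
proof -
  have bm: "bounded_meas (\<lambda>\<eta>. \<Sum>S\<in>F. b S * \<Psi> S \<eta>)" "\<And>S. bounded_meas (\<lambda>\<eta>. b S * \<Psi> S \<eta>)"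
    by (intro bounded_meas_intros)+
  have "dot (\<lambda>\<eta>. \<Sum>S\<in>F. b S * \<Psi> S \<eta>) (\<lambda>\<eta>. \<Sum>S\<in>F. b S * \<Psi> S \<eta>)
      = (\<Sum>S\<in>F. \<Sum>S'\<in>F. b S * (b S' * dot (\<Psi> S) (\<Psi> S')))"
    using bm by (simp add: dot_sum_left dot_scale_left dot_commute[of "\<Psi> _" "\<lambda>\<eta>. \<Sum>S\<in>F. _ S \<eta>"]
        sum_distrib_left dot_commute[of "\<Psi> _" "\<Psi> _"])
  also have "\<dots> = (\<Sum>S\<in>F. \<Sum>S'\<in>F. if S' = S then (b S)\<^sup>2 * (\<rho> * (1 - \<rho>)) ^ card S else 0)"
    using assms rho_pos rho_less_1
    by (intro sum.cong refl) (auto simp: dot_def integral_centred_monomial_mult power2_eq_square)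
  also have "\<dots> = (\<Sum>S\<in>F. (b S)\<^sup>2 * (\<rho> * (1 - \<rho>)) ^ card S)"
    using assms(1) by simp
  finally show ?thesis .
qed

text \<open>Double counting: a set of \<open>k\<close> sites survives the removal of a site of \<open>B\<close> for exactly \<open>card B - k\<close> choices of that site.\<close>

lemma sym_mean_remove_average:
  assumes B: "finite B" "card B = Suc j" "k \<le> j"
  shows "sym_mean k B \<eta> = (\<Sum>i\<in>B. sym_mean k (B - {i}) \<eta>) / real (Suc j)"
proof -
  let ?F = "{S. S \<subseteq> B \<and> card S = k}"
  have finF: "finite ?F" using B by (auto intro: finite_subset[of _ "Pow B"])
  have card: "card (B - {i}) = j" if "i \<in> B" for i using B that by simp
  have "(\<Sum>i\<in>B. \<Sum>S | S \<subseteq> B - {i} \<and> card S = k. \<Psi> S \<eta>) = (\<Sum>i\<in>B. \<Sum>S\<in>?F. if i \<notin> S then \<Psi> S \<eta> else 0)"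
  proof (rule sum.cong[OF refl])
    fix i assume "i \<in> B"
    have "{S. S \<subseteq> B - {i} \<and> card S = k} = {S \<in> ?F. i \<notin> S}" by auto
    then show "(\<Sum>S | S \<subseteq> B - {i} \<and> card S = k. \<Psi> S \<eta>) = (\<Sum>S\<in>?F. if i \<notin> S then \<Psi> S \<eta> else 0)"
      using finF by (simp only: sum.inter_filter)
  qed
  also have "\<dots> = (\<Sum>S\<in>?F. \<Sum>i\<in>B. if i \<notin> S then \<Psi> S \<eta> else 0)" by (rule sum.swap)
  also have "\<dots> = (\<Sum>S\<in>?F. real (Suc j - k) * \<Psi> S \<eta>)"
  proof (rule sum.cong[OF refl])
    fix S assume S: "S \<in> ?F"
    then have fS: "finite S" using B finite_subset by auto
    have "(\<Sum>i\<in>B. if i \<notin> S then \<Psi> S \<eta> else 0) = (\<Sum>i\<in>{i\<in>B. i \<notin> S}. \<Psi> S \<eta>)"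
      using B by (simp only: sum.inter_filter)
    also have "{i\<in>B. i \<notin> S} = B - S" by auto
    also have "(\<Sum>i\<in>B - S. \<Psi> S \<eta>) = real (Suc j - k) * \<Psi> S \<eta>"
      using S B fS by (simp add: card_Diff_subset)
    finally show "(\<Sum>i\<in>B. if i \<notin> S then \<Psi> S \<eta> else 0) = real (Suc j - k) * \<Psi> S \<eta>" .
  qed
  finally have eq: "(\<Sum>i\<in>B. \<Sum>S | S \<subseteq> B - {i} \<and> card S = k. \<Psi> S \<eta>)
      = real (Suc j - k) * (\<Sum>S\<in>?F. \<Psi> S \<eta>)" by (simp add: sum_distrib_left)
  have ch: "real (Suc j - k) * real (Suc j choose k) = real (Suc j) * real (j choose k)"
    using binomial_absorb_comp[of "Suc j" k] by (metis diff_Suc_1 of_nat_mult)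
  have pos: "real (j choose k) > 0" "real (Suc j choose k) > 0"
    using B(3) by (simp_all add: zero_less_binomial)
  have "(\<Sum>i\<in>B. sym_mean k (B - {i}) \<eta>) / real (Suc j)
      = (\<Sum>i\<in>B. (\<Sum>S | S \<subseteq> B - {i} \<and> card S = k. \<Psi> S \<eta>) / real (j choose k)) / real (Suc j)"
    unfolding sym_mean_def by (intro arg_cong2[where f="(/)"] sum.cong refl) (simp only: card)
  also have "\<dots> = real (Suc j - k) * (\<Sum>S\<in>?F. \<Psi> S \<eta>) / (real (Suc j) * real (j choose k))"
    by (simp add: eq sum_divide_distrib[symmetric])
  also have "\<dots> = real (Suc j - k) * (\<Sum>S\<in>?F. \<Psi> S \<eta>) / (real (Suc j - k) * real (Suc j choose k))"
    by (simp add: ch)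
  also have "\<dots> = sym_mean k B \<eta>"
    unfolding sym_mean_def using B by simp
  finally show ?thesis by simp
qed

lemma card_subsets_with_without:
  assumes "finite B" "card B = Suc j" "i \<in> B" "b \<in> B" "i \<noteq> b" "1 \<le> k"
  shows "card {S. S \<subseteq> B \<and> card S = k \<and> i \<in> S \<and> b \<notin> S} = (j - 1) choose (k - 1)"
proof -
  let ?R = "{R. R \<subseteq> B - {i, b} \<and> card R = k - 1}"
  have fin: "finite R" if "R \<subseteq> B" for R using assms(1) that by (rule finite_subset[rotated])
  have "{S. S \<subseteq> B \<and> card S = k \<and> i \<in> S \<and> b \<notin> S} = insert i ` ?R"
  proof (intro equalityI subsetI)
    fix S assume "S \<in> {S. S \<subseteq> B \<and> card S = k \<and> i \<in> S \<and> b \<notin> S}"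
    then have "S = insert i (S - {i})" "S - {i} \<in> ?R" using fin[of S] by auto
    then show "S \<in> insert i ` ?R" by blast
  next
    fix S assume "S \<in> insert i ` ?R"
    then obtain R where R: "S = insert i R" "R \<subseteq> B - {i, b}" "card R = k - 1" by auto
    moreover have "finite R" using R fin[of R] by auto
    ultimately show "S \<in> {S. S \<subseteq> B \<and> card S = k \<and> i \<in> S \<and> b \<notin> S}"
      using assms by (auto simp: card_insert_if)
  qed
  moreover have "inj_on (insert i) ?R" by (rule inj_onI) (auto dest: insert_ident[THEN iffD1, rotated 2])
  ultimately have "card {S. S \<subseteq> B \<and> card S = k \<and> i \<in> S \<and> b \<notin> S} = card ?R" by (simp add: card_image)
  also have "\<dots> = card (B - {i, b}) choose (k - 1)" using assms(1) by (intro n_subsets) simp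
  also have "card (B - {i, b}) = j - 1" using assms by (simp add: card_Diff_subset)
  finally show ?thesis .
qed

text \<open>The two means share all the monomials that contain neither \<open>i\<close> nor \<open>b\<close>. By orthogonality, what is left has squared norm at most
  \<open>2 C(j-1,k-1) / C(j,k)\<^sup>2\<close>, where \<open>C\<close> denotes binomial coefficients. Compared with the variance of a mean of degree \<open>k\<close>, which has order
  \<open>1 / C(j,k)\<close>, this gains the factor \<open>C(j-1,k-1) / C(j,k) = k / j\<close>, and this gain is what makes steps of a single site summable.\<close>

lemma l2_sym_mean_remove:
  assumes B: "finite B" "card B = Suc j" "i \<in> B" "b \<in> B" "i \<noteq> b" and k: "1 \<le> k" "k \<le> j"
  shows "l2 (\<lambda>\<eta>. sym_mean k (B - {b}) \<eta> - sym_mean k (B - {i}) \<eta>) \<le> sqrt (2 * (real k / real j) ^ Suc k)"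
proof -
  let ?F = "{S. S \<subseteq> B \<and> card S = k}" and ?C = "real (j choose k)"
  define u where "u S = (of_bool (b \<notin> S) - of_bool (i \<notin> S)) / ?C" for S
  have finF: "finite ?F" using B by (auto intro: finite_subset[of _ "Pow B"])
  have card: "card (B - {x}) = j" if "x \<in> B" for x using B that by simp
  have Cpos: "?C > 0" using k by (simp add: zero_less_binomial)
  have sm: "sym_mean k (B - {x}) \<eta> = (\<Sum>S\<in>?F. of_bool (x \<notin> S) / ?C * \<Psi> S \<eta>)" if "x \<in> B" for x \<eta>
  proof -
    have "{S. S \<subseteq> B - {x} \<and> card S = k} = {S \<in> ?F. x \<notin> S}" by auto
    then have "(\<Sum>S | S \<subseteq> B - {x} \<and> card S = k. \<Psi> S \<eta>) = (\<Sum>S\<in>?F. if x \<notin> S then \<Psi> S \<eta> else 0)"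
      using finF by (simp only: sum.inter_filter)
    then have "sym_mean k (B - {x}) \<eta> = (\<Sum>S\<in>?F. if x \<notin> S then \<Psi> S \<eta> else 0) / ?C"
      by (simp only: sym_mean_def card[OF that])
    also have "\<dots> = (\<Sum>S\<in>?F. of_bool (x \<notin> S) / ?C * \<Psi> S \<eta>)"
      unfolding sum_divide_distrib by (intro sum.cong refl) simp
    finally show ?thesis .
  qed
  have "(\<lambda>\<eta>. sym_mean k (B - {b}) \<eta> - sym_mean k (B - {i}) \<eta>) = (\<lambda>\<eta>. \<Sum>S\<in>?F. u S * \<Psi> S \<eta>)"
    using B by (auto simp: sm u_def diff_divide_distrib left_diff_distrib sum_subtractf)
  then have "(l2 (\<lambda>\<eta>. sym_mean k (B - {b}) \<eta> - sym_mean k (B - {i}) \<eta>))\<^sup>2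
      = dot (\<lambda>\<eta>. \<Sum>S\<in>?F. u S * \<Psi> S \<eta>) (\<lambda>\<eta>. \<Sum>S\<in>?F. u S * \<Psi> S \<eta>)"
    unfolding l2_power2 by simp
  also have "\<dots> = (\<Sum>S\<in>?F. (u S)\<^sup>2 * (\<rho> * (1 - \<rho>)) ^ card S)"
    by (rule dot_self_monomials[OF finF]) (use B(1) finite_subset in auto)
  also have "\<dots> \<le> (\<Sum>S\<in>?F. (u S)\<^sup>2)"
  proof (rule sum_mono)
    fix S :: "int set"
    have "\<rho> * (1 - \<rho>) \<le> 1" using rho_pos rho_less_1 by (intro mult_le_one) auto
    then have "(\<rho> * (1 - \<rho>)) ^ card S \<le> 1" using rho_pos rho_less_1 by (intro power_le_one) auto
    then show "(u S)\<^sup>2 * (\<rho> * (1 - \<rho>)) ^ card S \<le> (u S)\<^sup>2"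
      by (simp add: mult_left_le)
  qed
  also have "\<dots> = (\<Sum>S\<in>?F. of_bool (i \<in> S \<and> b \<notin> S) / ?C\<^sup>2 + of_bool (b \<in> S \<and> i \<notin> S) / ?C\<^sup>2)"
    by (intro sum.cong refl) (auto simp: u_def power_divide)
  also have "\<dots> = (real (card {S \<in> ?F. i \<in> S \<and> b \<notin> S}) + real (card {S \<in> ?F. b \<in> S \<and> i \<notin> S})) / ?C\<^sup>2"
    using finF by (simp add: sum.distrib sum_divide_distrib[symmetric] add_divide_distrib Int_def)
  also have "{S \<in> ?F. i \<in> S \<and> b \<notin> S} = {S. S \<subseteq> B \<and> card S = k \<and> i \<in> S \<and> b \<notin> S}" by auto
  also have "{S \<in> ?F. b \<in> S \<and> i \<notin> S} = {S. S \<subseteq> B \<and> card S = k \<and> b \<in> S \<and> i \<notin> S}" by auto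
  also have "(real (card {S. S \<subseteq> B \<and> card S = k \<and> i \<in> S \<and> b \<notin> S})
      + real (card {S. S \<subseteq> B \<and> card S = k \<and> b \<in> S \<and> i \<notin> S})) / ?C\<^sup>2 = 2 * real ((j - 1) choose (k - 1)) / ?C\<^sup>2"
    using card_subsets_with_without[OF B k(1)] card_subsets_with_without[OF B(1,2,4,3) _ k(1)] B(5) by simp
  also have "\<dots> = 2 * (real k / real j) / ?C"
  proof -
    have "k * (j choose k) = j * ((j - 1) choose (k - 1))"
      using k binomial_absorption[of "k - 1" j] by simp
    then have "real k * ?C = real j * real ((j - 1) choose (k - 1))" by (metis of_nat_mult)
    then show ?thesis using Cpos k by (simp add: field_simps power2_eq_square)
  qed
  also have "\<dots> \<le> 2 * (real k / real j) / (real j / real k) ^ k"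
    using binomial_ge_n_over_k_pow_k[OF k(2), where 'a=real] k
    by (intro divide_left_mono mult_pos_pos Cpos) auto
  also have "\<dots> = 2 * (real k / real j) ^ Suc k"
    using k by (simp add: power_divide field_simps)
  finally show ?thesis by (simp add: real_le_rsqrt)
qed

lemma sym_mean_exchange:
  assumes "finite B" "i \<in> B" "b \<in> B"
  shows "sym_mean k (B - {b}) (exchange i b \<eta>) = sym_mean k (B - {i}) \<eta>"
proof -
  let ?\<tau> = "Transposition.transpose i b"
  have c: "card (B - {b}) = card (B - {i})" using assms by simp
  have im: "?\<tau> ` (B - {b}) = B - {i}" "?\<tau> ` (B - {i}) = B - {b}" using assms
    by (auto simp: image_iff Transposition.transpose_def)
  have "(\<Sum>S | S \<subseteq> B - {b} \<and> card S = k. \<Psi> (?\<tau> ` S) \<eta>) = (\<Sum>S | S \<subseteq> B - {i} \<and> card S = k. \<Psi> S \<eta>)"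
  proof (rule sum.reindex_bij_witness[of _ "image ?\<tau>" "image ?\<tau>"])
    show "?\<tau> ` ?\<tau> ` S = S" for S by (simp add: image_image)
    then show "?\<tau> ` ?\<tau> ` S = S" for S .
    show "?\<tau> ` S \<in> {S. S \<subseteq> B - {i} \<and> card S = k}" if "S \<in> {S. S \<subseteq> B - {b} \<and> card S = k}" for S
      using that im image_mono[of S "B - {b}" ?\<tau>] by (auto simp: card_image)
    show "?\<tau> ` S \<in> {S. S \<subseteq> B - {b} \<and> card S = k}" if "S \<in> {S. S \<subseteq> B - {i} \<and> card S = k}" for S
      using that im image_mono[of S "B - {i}" ?\<tau>] by (auto simp: card_image)
  qed simp
  then show ?thesis by (simp add: sym_mean_def centred_monomial_exchange c)
qed

text \<open>By \<open>sym_mean_remove_average\<close> the increment is the average, over the sites \<open>i\<close> of the larger block, of the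
  differences between the means without the new site and without \<open>i\<close>. These are antisymmetric under the exchange of the two sites.\<close>

lemma enlarge_block_le:
  assumes k: "1 \<le> k" "k \<le> j" and g: "bounded_meas g"
  shows "\<bar>dot (\<lambda>\<eta>. sym_mean k {x..<x + int j} \<eta> - sym_mean k {x..<x + int (Suc j)} \<eta>) g\<bar>
    \<le> sqrt (2 * (real k / real j) ^ Suc k) * sqrt (real j) * sqrt (bond_energy {x..<x + int j} g)"
proof -
  let ?B = "{x..<x + int (Suc j)}" and ?b = "x + int j"
  let ?bd = "sqrt (2 * (real k / real j) ^ Suc k) * sqrt (real j) * sqrt (bond_energy {x..<x + int j} g)"
  let ?w = "\<lambda>i \<eta>. sym_mean k (?B - {?b}) \<eta> - sym_mean k (?B - {i}) \<eta>"
  have B: "finite ?B" "card ?B = Suc j" "?b \<in> ?B" by auto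
  have Bb: "?B - {?b} = {x..<x + int j}" by auto
  have bm: "bounded_meas (?w i)" for i by (intro bounded_meas_diff bounded_meas_sym_mean)
  have one: "\<bar>dot (?w i) g\<bar> \<le> ?bd" if i: "i \<in> ?B" for i
  proof (cases "i = ?b")
    case True
    then show ?thesis by (simp add: dot_def)
  next
    case False
    have "\<bar>dot (?w i) g\<bar> \<le> l2 (?w i) * (sqrt (real j) * sqrt (bond_energy {x..<x + int j} g))"
    proof (rule dot_antisymmetric_le[OF bm g, where i=i and j="?b" and x=x])
      fix \<eta>
      have "exchange ?b i = exchange i ?b" by (auto simp: exchange_eq fun_eq_iff transpose_commute)
      then show "?w i (exchange i ?b \<eta>) = - ?w i \<eta>"
        using sym_mean_exchange[OF B(1) i B(3), of k \<eta>] sym_mean_exchange[OF B(1) B(3) i, of k \<eta>] by simp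
    qed (use i False in auto)
    also have "\<dots> \<le> sqrt (2 * (real k / real j) ^ Suc k) * (sqrt (real j) * sqrt (bond_energy {x..<x + int j} g))"
      using l2_sym_mean_remove[OF B(1,2) i B(3) False k] by (intro mult_right_mono) auto
    finally show ?thesis by (simp add: mult.assoc)
  qed
  have "sym_mean k {x..<x + int j} \<eta> - sym_mean k ?B \<eta> = (\<Sum>i\<in>?B. ?w i \<eta>) / real (Suc j)" for \<eta>
    using sym_mean_remove_average[OF B(1,2) k(2), of \<eta>] B(2)
    by (simp add: sum_subtractf diff_divide_distrib Bb del: of_nat_Suc)
  then have "dot (\<lambda>\<eta>. sym_mean k {x..<x + int j} \<eta> - sym_mean k ?B \<eta>) g = (\<Sum>i\<in>?B. dot (?w i) g) / real (Suc j)"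
    using bm g by (simp add: dot_divide_left dot_sum_left)
  also have "\<bar>\<dots>\<bar> \<le> (\<Sum>i\<in>?B. ?bd) / real (Suc j)"
  proof -
    have "\<bar>\<Sum>i\<in>?B. dot (?w i) g\<bar> \<le> (\<Sum>i\<in>?B. ?bd)"
      by (rule order_trans[OF sum_abs]) (intro sum_mono one)
    then show ?thesis by (simp add: divide_right_mono del: sum_constant)
  qed
  also have "\<dots> = ?bd" using B(2) by simp
  finally show ?thesis .
qed

text \<open>The sites of \<open>S\<close> that are not in \<open>S'\<close> are moved into \<open>S'\<close> one at a time; each move is antisymmetric under an exchange.\<close>

lemma monomial_difference_le:
  assumes g: "bounded_meas g"
  shows "S \<subseteq> {x..x + int L} \<Longrightarrow> S' \<subseteq> {x..x + int L} \<Longrightarrow> card S = card S' \<Longrightarrow>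
    \<bar>dot (\<lambda>\<eta>. \<Psi> S \<eta> - \<Psi> S' \<eta>) g\<bar>
      \<le> real (card (S - S')) * (2 * (sqrt (real L) * sqrt (bond_energy {x..<x + int L} g)))"
proof (induction "card (S - S')" arbitrary: S)
  case 0
  have fin: "finite S" "finite S'" using 0 finite_subset by blast+
  have "S - S' = {}" using fin 0 by simp
  then have "S \<subseteq> S'" by auto
  then have "S = S'" using 0 fin by (simp add: card_subset_eq)
  then show ?case by (simp add: dot_def)
next
  case (Suc d)
  let ?bd = "2 * (sqrt (real L) * sqrt (bond_energy {x..<x + int L} g))"
  have fin: "finite S" "finite S'" using Suc.prems finite_subset by blast+
  obtain i where i: "i \<in> S" "i \<notin> S'" using Suc.hyps(2) by (metis DiffE card.empty nat.distinct(1) equals0I)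
  have "card (S' - S) = Suc d"
    using Suc.prems(3) Suc.hyps(2) fin by (metis card_le_sym_Diff card_Diff_subset_Int card_Diff_subset Int_commute finite_Int)
  then obtain b where b: "b \<in> S'" "b \<notin> S" by (metis DiffE card.empty nat.distinct(1) equals0I)
  let ?S = "insert b (S - {i})"
  have ib: "i \<noteq> b" using i b by auto
  have im: "Transposition.transpose i b ` S = ?S" "Transposition.transpose i b ` ?S = S"
    using i b by (auto simp: image_iff Transposition.transpose_def)
  have "?S - S' = (S - S') - {i}" using i b by auto
  then have d: "d = card (?S - S')" using Suc.hyps(2) i fin by simp
  have "card ?S = card S'" using i b fin Suc.prems(3) by (simp add: card_insert_if card_Suc_Diff1 card_gt_0_iff) (metis card_gt_0_iff equals0D fin(2) One_nat_def Suc_pred b(1))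
  moreover have sub: "?S \<subseteq> {x..x + int L}" using Suc.prems b by auto
  ultimately have IH: "\<bar>dot (\<lambda>\<eta>. \<Psi> ?S \<eta> - \<Psi> S' \<eta>) g\<bar> \<le> real (card (?S - S')) * ?bd"
    using Suc.hyps(1)[OF d] Suc.prems(2) by simp
  have bm: "bounded_meas (\<lambda>\<eta>. \<Psi> S \<eta> - \<Psi> ?S \<eta>)" "bounded_meas (\<lambda>\<eta>. \<Psi> ?S \<eta> - \<Psi> S' \<eta>)"
    by (intro bounded_meas_intros)+
  have "\<bar>dot (\<lambda>\<eta>. \<Psi> S \<eta> - \<Psi> ?S \<eta>) g\<bar> \<le> l2 (\<lambda>\<eta>. \<Psi> S \<eta> - \<Psi> ?S \<eta>) * (sqrt (real L) * sqrt (bond_energy {x..<x + int L} g))"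
  proof (rule dot_antisymmetric_le[OF bm(1) g, where i=i and j=b and x=x])
    show "\<Psi> S (exchange i b \<eta>) - \<Psi> ?S (exchange i b \<eta>) = - (\<Psi> S \<eta> - \<Psi> ?S \<eta>)" for \<eta>
      unfolding centred_monomial_exchange im by simp
    show "i \<in> {x..x + int L}" "b \<in> {x..x + int L}" using i b Suc.prems by fastforce+
  qed (use ib in auto)
  also have "\<dots> \<le> ?bd"
  proof -
    have "\<bar>\<Psi> S \<eta> - \<Psi> ?S \<eta>\<bar> \<le> 2" for \<eta>
      using abs_centred_monomial_le[of \<rho> S \<eta>] abs_centred_monomial_le[of \<rho> ?S \<eta>] rho_pos rho_less_1 by linarith
    then have "(\<Psi> S \<eta> - \<Psi> ?S \<eta>) * (\<Psi> S \<eta> - \<Psi> ?S \<eta>) \<le> 4" for \<eta>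
      using abs_le_square_iff[of "\<Psi> S \<eta> - \<Psi> ?S \<eta>" 2] by (simp add: power2_eq_square)
    then have "dot (\<lambda>\<eta>. \<Psi> S \<eta> - \<Psi> ?S \<eta>) (\<lambda>\<eta>. \<Psi> S \<eta> - \<Psi> ?S \<eta>) \<le> (\<integral>\<eta>. 4 \<partial>\<nu>)"
      unfolding dot_def by (intro integral_mono dot_integrable bm) auto
    then have "l2 (\<lambda>\<eta>. \<Psi> S \<eta> - \<Psi> ?S \<eta>) \<le> sqrt 4" by (simp only: l2_def real_sqrt_le_iff) simp
    then have "l2 (\<lambda>\<eta>. \<Psi> S \<eta> - \<Psi> ?S \<eta>) \<le> 2" by simp
    then show ?thesis by (intro mult_right_mono) auto
  qed
  finally have "\<bar>dot (\<lambda>\<eta>. \<Psi> S \<eta> - \<Psi> ?S \<eta>) g\<bar> \<le> ?bd" .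
  moreover have "dot (\<lambda>\<eta>. \<Psi> S \<eta> - \<Psi> S' \<eta>) g = dot (\<lambda>\<eta>. \<Psi> S \<eta> - \<Psi> ?S \<eta>) g + dot (\<lambda>\<eta>. \<Psi> ?S \<eta> - \<Psi> S' \<eta>) g"
    using dot_add_left[OF bm g] by simp
  ultimately have "\<bar>dot (\<lambda>\<eta>. \<Psi> S \<eta> - \<Psi> S' \<eta>) g\<bar> \<le> ?bd + real d * ?bd"
    using IH d by simp
  then show ?case using Suc.hyps(2) by (metis Suc_eq_plus1 add.commute distrib_right mult_1 of_nat_1 of_nat_add)
qed

text \<open>This serves twice. On the smallest block that carries \<open>f\<close> it bounds the part of \<open>V\<^sub>x\<close> that the telescoping over larger blocks
  does not reach. For a \<open>g\<close> that is invariant under the exchanges within a block of any length the right-hand side vanishes, which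
  identifies the conditional expectation given the particle number of the block.\<close>

lemma monomial_sym_mean_le:
  assumes g: "bounded_meas g" and S: "S \<subseteq> {x..x + int L}"
  shows "\<bar>dot (\<lambda>\<eta>. \<Psi> S \<eta> - sym_mean (card S) {x..x + int L} \<eta>) g\<bar>
      \<le> 2 * real (Suc L) * sqrt (real L) * sqrt (bond_energy {x..<x + int L} g)"
proof -
  let ?B = "{x..x + int L}" and ?E = "bond_energy {x..<x + int L} g" and ?bd = "2 * real (Suc L) * sqrt (real L) * sqrt (bond_energy {x..<x + int L} g)"
  let ?F = "{S'. S' \<subseteq> ?B \<and> card S' = card S}"
  have finF: "finite ?F" by (auto intro: finite_subset[of _ "Pow ?B"])
  have cF: "card ?F = card ?B choose card S" by (rule n_subsets) simp
  have "S \<in> ?F" using S by simp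
  then have pos: "card ?F > 0" using finF card_gt_0_iff by blast
  have eq: "dot (\<lambda>\<eta>. \<Psi> S \<eta> - sym_mean (card S) ?B \<eta>) g = (\<Sum>S'\<in>?F. dot (\<lambda>\<eta>. \<Psi> S \<eta> - \<Psi> S' \<eta>) g) / real (card ?F)"
  proof -
    have "\<Psi> S \<eta> - sym_mean (card S) ?B \<eta> = (\<Sum>S'\<in>?F. \<Psi> S \<eta> - \<Psi> S' \<eta>) / real (card ?F)" for \<eta>
    proof -
      have sm: "(\<Sum>S'\<in>?F. \<Psi> S \<eta> - \<Psi> S' \<eta>) = real (card ?F) * \<Psi> S \<eta> - (\<Sum>S'\<in>?F. \<Psi> S' \<eta>)"
        by (simp only: sum_subtractf sum_constant)
      have nz: "real (card ?F) \<noteq> 0" using pos by linarith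
      have alg: "p - s / N = (N * p - s) / N" if "N \<noteq> 0" for p s N :: real
        using that by (simp add: diff_divide_distrib)
      show ?thesis unfolding sym_mean_def cF[symmetric] sm by (rule alg[OF nz])
    qed
    moreover have "bounded_meas (\<lambda>\<eta>. \<Psi> S \<eta> - \<Psi> S' \<eta>)" for S' by (intro bounded_meas_intros)
    ultimately show ?thesis using g by (simp add: dot_divide_left dot_sum_left)
  qed
  have "\<bar>\<Sum>S'\<in>?F. dot (\<lambda>\<eta>. \<Psi> S \<eta> - \<Psi> S' \<eta>) g\<bar> \<le> real (card ?F) * ?bd"
  proof -
    have "\<bar>dot (\<lambda>\<eta>. \<Psi> S \<eta> - \<Psi> S' \<eta>) g\<bar> \<le> ?bd" if "S' \<in> ?F" for S'
    proof -
      have "\<bar>dot (\<lambda>\<eta>. \<Psi> S \<eta> - \<Psi> S' \<eta>) g\<bar> \<le> real (card (S - S')) * (2 * (sqrt (real L) * sqrt (?E)))"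
        using that S by (intro monomial_difference_le[OF g]) auto
      also have "\<dots> \<le> real (Suc L) * (2 * (sqrt (real L) * sqrt (?E)))"
      proof -
        have "card (S - S') \<le> card ?B" using S by (intro card_mono) auto
        then show ?thesis by (intro mult_right_mono) auto
      qed
      finally show ?thesis by (simp only: mult_ac)
    qed
    then have "\<bar>\<Sum>S'\<in>?F. dot (\<lambda>\<eta>. \<Psi> S \<eta> - \<Psi> S' \<eta>) g\<bar> \<le> (\<Sum>S'\<in>?F. ?bd)"
      by (intro order_trans[OF sum_abs sum_mono])
    then show ?thesis by (simp only: sum_constant)
  qed
  moreover have "0 < real (card ?F)" using pos by linarith
  ultimately show ?thesis unfolding eq abs_divide by (simp add: pos_divide_le_eq mult.commute)
qed

end

section \<open>Enlarging the block one site at a time\<close>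

text \<open>This is \<open>j\<close> to the power \<open>(1 - m) / 2\<close>: the norm of an increment at scale \<open>j\<close>, of order \<open>j\<close> to the power \<open>- (m + 1) / 2\<close>, times
  a square root of \<open>j\<close> for the path and another one for the overlap of the blocks.\<close>

definition scale_rate :: "nat \<Rightarrow> nat \<Rightarrow> real" where
  "scale_rate m j = real j * sqrt ((1 / real j) ^ Suc m)"

lemma scale_rate_nonneg [simp]: "0 \<le> scale_rate m j"
  by (simp add: scale_rate_def)

lemma scale_rate_mono:
  assumes "m \<le> k" shows "scale_rate k j \<le> scale_rate m j"
proof (cases "j = 0")
  case False
  then have "(1 / real j) ^ Suc k \<le> (1 / real j) ^ Suc m"
    using assms by (intro power_decreasing) auto
  then show ?thesis unfolding scale_rate_def by (intro mult_left_mono) auto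
qed (simp add: scale_rate_def)

text \<open>Terms that do not grow with \<open>l\<close> are absorbed into the scale factor; for \<open>m = 3\<close> this uses \<open>l \<ge> 2\<close>.\<close>

lemma c_const_lower:
  assumes "2 \<le> l" shows "1 \<le> 2 * sqrt (c_const m l)"
proof -
  have ln2: "1 / 2 \<le> ln (2::real)" using ln2_ge_two_thirds by simp
  have "ln 2 \<le> ln (real l)" using assms by simp
  then have "1 / 2 \<le> ln (real l)" using ln2 by linarith
  moreover have "1 \<le> 2 * sqrt (real l)"
  proof -
    have "sqrt 1 \<le> sqrt (real l)" using assms by (subst real_sqrt_le_iff) simp
    then show ?thesis using real_sqrt_one by linarith
  qed
  ultimately show ?thesis using assms by (auto simp: c_const_def)
qed

text \<open>For \<open>m = 2\<close>, \<open>m = 3\<close> and \<open>m = 4\<close> the summand is dominated by the increments of \<open>2 \<surd>j\<close>, of \<open>ln j\<close> and of \<open>- 2 / \<surd>j\<close>, respectively.\<close>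

lemma sum_scale_rate_le:
  assumes m: "1 \<le> m" and l: "2 \<le> l"
  shows "(\<Sum>j\<in>{1..<l}. scale_rate m j) \<le> 3 * sqrt (c_const m l)"
proof -
  obtain n where n: "l = Suc n" "1 \<le> n" using l by (cases l) auto
  consider "m = 1" | "m = 2" | "m = 3" | "m \<ge> 4" using m by linarith
  then show ?thesis
  proof cases
    case 1
    have "scale_rate m j \<le> 1" for j
      using 1 by (cases "j = 0") (simp_all add: scale_rate_def real_sqrt_power power2_eq_square[symmetric])
    then have "(\<Sum>j\<in>{1..<l}. scale_rate m j) \<le> (\<Sum>j\<in>{1..<l}. 1)" by (intro sum_mono) simp
    also have "\<dots> \<le> 3 * real l" by simp
    finally show ?thesis using 1 by (simp add: c_const_def)
  next
    case 2
    have "(\<Sum>j\<in>{1..<Suc n}. scale_rate m j) \<le> 2 * sqrt (real n)" for n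
    proof (induction n)
      case (Suc n)
      have "scale_rate m (Suc n) = 1 / sqrt (real (Suc n))"
      proof -
        have "(1 / real (Suc n)) ^ Suc m = (1 / real (Suc n))\<^sup>2 * (1 / real (Suc n))"
          using 2 by (simp add: power2_eq_square numeral_2_eq_2)
        then have "sqrt ((1 / real (Suc n)) ^ Suc m) = (1 / real (Suc n)) * (1 / sqrt (real (Suc n)))"
          by (simp only: real_sqrt_mult real_sqrt_abs) (simp add: real_sqrt_divide)
        then show ?thesis by (simp add: scale_rate_def del: of_nat_Suc)
      qed
      also have "\<dots> \<le> 2 * (sqrt (real (Suc n)) - sqrt (real n))"
      proof -
        define u v where "u = sqrt (real n)" and "v = sqrt (real (Suc n))"
        have uv: "0 \<le> u" "u \<le> v" "0 < v" "v\<^sup>2 = u\<^sup>2 + 1" by (auto simp: u_def v_def)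
        have "1 \<le> 2 * (v - u) * v"
        proof -
          have "0 \<le> (v - u)\<^sup>2" by simp
          then show ?thesis using uv(4) by (simp add: power2_eq_square algebra_simps)
        qed
        then have "1 / v \<le> 2 * (v - u)" using uv by (simp add: pos_divide_le_eq)
        then show ?thesis by (simp add: u_def v_def)
      qed
      finally show ?case using Suc by simp
    qed simp
    from this[of n] have "(\<Sum>j\<in>{1..<l}. scale_rate m j) \<le> 2 * sqrt (real n)" using n by simp
    also have "\<dots> \<le> 3 * sqrt (real l)" using n by (intro mult_mono) auto
    finally show ?thesis using 2 by (simp add: c_const_def)
  next
    case 3
    have sr: "scale_rate m j = 1 / real j" for j
    proof -
      have "(1 / real j) ^ Suc m = ((1 / real j)\<^sup>2)\<^sup>2" using 3 by (simp add: power_mult[symmetric])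
      then have "sqrt ((1 / real j) ^ Suc m) = (1 / real j)\<^sup>2" by (simp only: real_sqrt_abs) simp
      then show ?thesis by (simp add: scale_rate_def power2_eq_square)
    qed
    have "(\<Sum>j\<in>{1..<Suc n}. scale_rate m j) \<le> 1 + ln (real n)" if "1 \<le> n" for n
      using that
    proof (induction n rule: dec_induct)
      case base
      then show ?case by (simp add: sr)
    next
      case (step n)
      have "ln (real n / real (Suc n)) \<le> real n / real (Suc n) - 1"
        using step by (intro ln_le_minus_one) auto
      moreover have "ln (real n / real (Suc n)) = ln (real n) - ln (real (Suc n))"
        using step by (subst ln_divide_pos) auto
      moreover have "real n / real (Suc n) - 1 = - (1 / real (Suc n))" by (simp add: field_simps)
      ultimately have "1 / real (Suc n) \<le> ln (real (Suc n)) - ln (real n)" by linarith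
      moreover have "(\<Sum>j\<in>{1..<Suc (Suc n)}. scale_rate m j) = (\<Sum>j\<in>{1..<Suc n}. scale_rate m j) + 1 / real (Suc n)"
        using sr[of "Suc n"] by simp
      ultimately show ?case using step.IH by linarith
    qed
    then have a: "(\<Sum>j\<in>{1..<l}. scale_rate m j) \<le> 1 + ln (real n)" using n by simp
    have b: "ln (real n) \<le> ln (real l)" using n by simp
    have "ln 2 \<le> ln (real l)" using l by simp
    then have c: "1 / 2 \<le> ln (real l)" using ln2_ge_two_thirds by simp
    have "sqrt (c_const m l) = ln (real l)" using 3 c by (simp add: c_const_def)
    then show ?thesis using a b c by linarith
  next
    case 4
    have sr: "scale_rate 4 j = 1 / (real j * sqrt (real j))" for j
    proof -
      have "(1 / real j) ^ Suc 4 = ((1 / real j)\<^sup>2)\<^sup>2 * (1 / real j)"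
        by (simp add: eval_nat_numeral)
      then have "sqrt ((1 / real j) ^ Suc 4) = (1 / real j)\<^sup>2 * (1 / sqrt (real j))"
        by (simp only: real_sqrt_mult real_sqrt_abs) (simp add: real_sqrt_divide)
      then show ?thesis by (simp add: scale_rate_def power2_eq_square)
    qed
    have "(\<Sum>j\<in>{1..<Suc n}. scale_rate 4 j) \<le> 3 - 2 / sqrt (real n)" if "1 \<le> n" for n
      using that
    proof (induction n rule: dec_induct)
      case base
      then show ?case by (simp add: sr)
    next
      case (step n)
      define u v where "u = sqrt (real n)" and "v = sqrt (real (Suc n))"
      have uv: "0 < u" "u \<le> v" "0 < v" "v\<^sup>2 = u\<^sup>2 + 1" using step by (auto simp: u_def v_def)
      have vv: "v * v = real (Suc n)" by (simp add: v_def)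
      have "1 / (v * v * v) \<le> 2 / u - 2 / v"
      proof -
        have "u * (u + v) \<le> v * (v + v)" using uv by (intro mult_mono) auto
        then have "v * (u * (u + v)) \<le> v * (v * (v + v))" using uv by (intro mult_left_mono) auto
        then have "2 / (v * (v * (v + v))) \<le> 2 / (v * (u * (u + v)))"
          using uv by (intro frac_le) auto
        also have "2 / (v * (v * (v + v))) = 1 / (v * v * v)" using uv by (simp add: field_simps)
        finally have "1 / (v * v * v) \<le> 2 / (v * (u * (u + v)))" .
        moreover have "2 / (v * (u * (u + v))) = 2 / u - 2 / v"
        proof -
          have "2 * (v - u) * (v + u) = 2" using uv(4) by (simp add: algebra_simps power2_eq_square)
          then have "2 / (v * (u * (u + v))) = 2 * (v - u) * (v + u) / (v * (u * (u + v)))" by simp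
          also have "\<dots> = (2 * (v - u)) * (u + v) / ((v * u) * (u + v))" by (simp only: mult.assoc add.commute)
          also have "\<dots> = 2 * (v - u) / (v * u)" using uv by (intro nonzero_mult_divide_mult_cancel_right) linarith
          also have "\<dots> = 2 / u - 2 / v" using uv by (simp add: field_simps)
          finally show ?thesis .
        qed
        ultimately show ?thesis by simp
      qed
      then have "scale_rate 4 (Suc n) \<le> 2 / sqrt (real n) - 2 / sqrt (real (Suc n))"
        using vv by (simp add: sr u_def v_def)
      then show ?case using step.IH by simp
    qed
    then have "(\<Sum>j\<in>{1..<Suc n}. scale_rate 4 j) \<le> 3 - 2 / sqrt (real n)" using n by blast
    also have "\<dots> \<le> 3" by simp
    finally have "(\<Sum>j\<in>{1..<l}. scale_rate 4 j) \<le> 3" using n by simp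
    moreover have "(\<Sum>j\<in>{1..<l}. scale_rate m j) \<le> (\<Sum>j\<in>{1..<l}. scale_rate 4 j)"
      by (intro sum_mono scale_rate_mono 4)
    moreover have "c_const m l = 1" using 4 by (simp add: c_const_def)
    ultimately show ?thesis by simp
  qed
qed

context bernoulli_density
begin

text \<open>If \<open>f\<close> is the sum of \<open>\<gamma> S \<cdot> \<Psi> S\<close> over the subsets \<open>S\<close> of \<open>{0..<L}\<close>, then this is \<open>f \<circ> \<tau>\<^sub>x\<close> minus its conditional
  expectation given the particle number of \<open>{x..<x + l}\<close>.\<close>

definition block_fluctuation :: "(int set \<Rightarrow> real) \<Rightarrow> nat \<Rightarrow> nat \<Rightarrow> int \<Rightarrow> config \<Rightarrow> real" where
  "block_fluctuation \<gamma> L l x \<eta> = (\<Sum>S\<in>Pow {0..<int L}. \<gamma> S *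
     (\<Psi> ((+) x ` S) \<eta> - sym_mean (card S) {x..<x + int l} \<eta>))"

lemma block_fluctuation_telescope:
  assumes "L \<le> l"
  shows "block_fluctuation \<gamma> L l x \<eta> =
    (\<Sum>S\<in>Pow {0..<int L}. \<gamma> S * (\<Psi> ((+) x ` S) \<eta> - sym_mean (card S) {x..<x + int L} \<eta>)) +
    (\<Sum>k\<le>L. (\<Sum>S | S \<subseteq> {0..<int L} \<and> card S = k. \<gamma> S) *
      (\<Sum>j\<in>{L..<l}. sym_mean k {x..<x + int j} \<eta> - sym_mean k {x..<x + int (Suc j)} \<eta>))"
proof -
  let ?P = "Pow {0..<int L}" and ?m = "\<lambda>k j. sym_mean k {x..<x + int j} \<eta>"
  have tel: "(\<Sum>j\<in>{L..<l}. ?m k j - ?m k (Suc j)) = ?m k L - ?m k l" for k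
    using assms sum_Suc_diff'[of L l "\<lambda>j. - ?m k j"] by (simp add: algebra_simps)
  have img: "card ` ?P \<subseteq> {..L}"
  proof
    fix k assume "k \<in> card ` ?P"
    then obtain S where "S \<subseteq> {0..<int L}" "k = card S" by auto
    then show "k \<in> {..L}" using card_mono[of "{0..<int L}" S] by simp
  qed
  have "(\<Sum>S\<in>?P. \<gamma> S * (?m (card S) L - ?m (card S) l))
      = (\<Sum>k\<le>L. \<Sum>S\<in>{S \<in> ?P. card S = k}. \<gamma> S * (?m (card S) L - ?m (card S) l))"
    by (rule sum.group[symmetric]) (use img in auto)
  also have "\<dots> = (\<Sum>k\<le>L. (\<Sum>S | S \<subseteq> {0..<int L} \<and> card S = k. \<gamma> S) * (?m k L - ?m k l))"
    by (simp add: sum_distrib_right)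
  finally have "(\<Sum>S\<in>?P. \<gamma> S * (?m (card S) L - ?m (card S) l))
      = (\<Sum>k\<le>L. (\<Sum>S | S \<subseteq> {0..<int L} \<and> card S = k. \<gamma> S) * (\<Sum>j\<in>{L..<l}. ?m k j - ?m k (Suc j)))"
    by (simp only: tel)
  moreover have "block_fluctuation \<gamma> L l x \<eta> =
    (\<Sum>S\<in>?P. \<gamma> S * (\<Psi> ((+) x ` S) \<eta> - ?m (card S) L)) + (\<Sum>S\<in>?P. \<gamma> S * (?m (card S) L - ?m (card S) l))"
    unfolding block_fluctuation_def sum.distrib[symmetric] by (intro sum.cong refl) (simp add: algebra_simps)
  ultimately show ?thesis by simp
qed

lemma enlarge_superposition_le:
  assumes k: "1 \<le> k" "m \<le> k" "k \<le> j" and g: "bounded_meas g"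
    and A: "finite A" "finite Z" "\<And>x. x \<in> A \<Longrightarrow> {x..<x + int j} \<subseteq> Z"
  shows "\<bar>\<Sum>x\<in>A. c x * dot (\<lambda>\<eta>. sym_mean k {x..<x + int j} \<eta> - sym_mean k {x..<x + int (Suc j)} \<eta>) g\<bar>
    \<le> sqrt (2 * real k ^ Suc k) * scale_rate m j * sqrt (\<Sum>x\<in>A. (c x)\<^sup>2) * sqrt (bond_energy Z g)"
proof -
  have "\<bar>\<Sum>x\<in>A. c x * dot (\<lambda>\<eta>. sym_mean k {x..<x + int j} \<eta> - sym_mean k {x..<x + int (Suc j)} \<eta>) g\<bar>
    \<le> (sqrt (2 * (real k / real j) ^ Suc k) * sqrt (real j)) * sqrt (real j)
        * sqrt (\<Sum>x\<in>A. (c x)\<^sup>2) * sqrt (bond_energy Z g)"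
    using A enlarge_block_le[OF k(1,3) g] by (intro superposition_le) auto
  also have "(sqrt (2 * (real k / real j) ^ Suc k) * sqrt (real j)) * sqrt (real j)
      = sqrt (2 * real k ^ Suc k) * scale_rate k j"
  proof -
    have "(2 * (real k / real j) ^ Suc k) = (2 * real k ^ Suc k) * (1 / real j) ^ Suc k"
      by (simp add: power_divide del: power_Suc)
    then have "sqrt (2 * (real k / real j) ^ Suc k) = sqrt (2 * real k ^ Suc k) * sqrt ((1 / real j) ^ Suc k)"
      by (simp only: real_sqrt_mult)
    then show ?thesis by (simp add: scale_rate_def mult.assoc mult.commute mult.left_commute)
  qed
  also have "sqrt (2 * real k ^ Suc k) * scale_rate k j * sqrt (\<Sum>x\<in>A. (c x)\<^sup>2) * sqrt (bond_energy Z g)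
    \<le> sqrt (2 * real k ^ Suc k) * scale_rate m j * sqrt (\<Sum>x\<in>A. (c x)\<^sup>2) * sqrt (bond_energy Z g)"
    by (intro mult_right_mono mult_left_mono scale_rate_mono k) (auto intro: sum_nonneg)
  finally show ?thesis .
qed

text \<open>The fixed block of length \<open>L\<close> contributes a constant, and the enlargement from \<open>L\<close> to \<open>l\<close> contributes the sum of the rates. The
  degree condition enters only through the total coefficient of each degree \<open>k\<close>, because the means over blocks of
  length at least \<open>L\<close> do not distinguish between sets \<open>S\<close> of the same size.\<close>

proposition block_fluctuation_dual_estimate:
  assumes m: "1 \<le> m" and L: "1 \<le> L"
    and degree: "\<And>k. k < m \<Longrightarrow> (\<Sum>S | S \<subseteq> {0..<int L} \<and> card S = k. \<gamma> S) = 0"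
  shows "\<exists>C\<ge>0. \<forall>l A Z c g. 2 \<le> l \<longrightarrow> L \<le> l \<longrightarrow> finite A \<longrightarrow> finite Z \<longrightarrow>
    (\<forall>x\<in>A. {x..<x + int l} \<subseteq> Z) \<longrightarrow> bounded_meas g \<longrightarrow>
    \<bar>\<Sum>x\<in>A. c x * dot (block_fluctuation \<gamma> L l x) g\<bar>
      \<le> C * sqrt (c_const m l) * sqrt (\<Sum>x\<in>A. (c x)\<^sup>2) * sqrt (bond_energy Z g)"
proof -
  let ?P = "Pow {0..<int L}"
  define \<Gamma> where "\<Gamma> k = (\<Sum>S | S \<subseteq> {0..<int L} \<and> card S = k. \<gamma> S)" for k
  define C1 where "C1 = (\<Sum>S\<in>?P. \<bar>\<gamma> S\<bar>) * (2 * real L * real L)"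
  define C2 where "C2 = (\<Sum>k\<le>L. \<bar>\<Gamma> k\<bar> * sqrt (2 * real k ^ Suc k))"
  have nn: "0 \<le> C1" "0 \<le> C2" by (auto simp: C1_def C2_def intro!: sum_nonneg mult_nonneg_nonneg)
  show ?thesis
  proof (intro exI[of _ "2 * C1 + 3 * C2"] conjI allI impI)
    show "0 \<le> 2 * C1 + 3 * C2" using nn by simp
    fix l A Z c g
    assume l: "2 \<le> l" "L \<le> l" and fin: "finite A" "finite Z"
      and Z: "\<forall>x\<in>A. {x..<x + int l} \<subseteq> Z" and g: "bounded_meas g"
    let ?N = "sqrt (\<Sum>x\<in>A. (c x)\<^sup>2) * sqrt (bond_energy Z g)"
    have Npos: "0 \<le> ?N" by (intro mult_nonneg_nonneg) (auto intro: sum_nonneg)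
    define u where "u S x = dot (\<lambda>\<eta>. \<Psi> ((+) x ` S) \<eta> - sym_mean (card S) {x..<x + int L} \<eta>) g" for S x
    define v where "v k j x = dot (\<lambda>\<eta>. sym_mean k {x..<x + int j} \<eta> - sym_mean k {x..<x + int (Suc j)} \<eta>) g" for k j x
    have bm: "bounded_meas (\<lambda>\<eta>. \<Psi> ((+) x ` S) \<eta> - sym_mean (card S) {x..<x + int L} \<eta>)" for x S
      by (intro bounded_meas_intros bounded_meas_sym_mean)
    have bm2: "bounded_meas (\<lambda>\<eta>. sym_mean k {x..<x + int j} \<eta> - sym_mean k {x..<x + int (Suc j)} \<eta>)" for k j x
      by (intro bounded_meas_intros bounded_meas_sym_mean)
    have exp: "dot (block_fluctuation \<gamma> L l x) g = (\<Sum>S\<in>?P. \<gamma> S * u S x) + (\<Sum>k\<le>L. \<Gamma> k * (\<Sum>j\<in>{L..<l}. v k j x))" for x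
    proof -
      have "dot (block_fluctuation \<gamma> L l x) g = dot (\<lambda>\<eta>.
        (\<Sum>S\<in>?P. \<gamma> S * (\<Psi> ((+) x ` S) \<eta> - sym_mean (card S) {x..<x + int L} \<eta>)) +
        (\<Sum>k\<le>L. \<Gamma> k * (\<Sum>j\<in>{L..<l}. sym_mean k {x..<x + int j} \<eta> - sym_mean k {x..<x + int (Suc j)} \<eta>))) g"
        unfolding \<Gamma>_def by (intro arg_cong2[where f=dot] ext refl) (rule block_fluctuation_telescope[OF l(2)])
      also have "\<dots> = dot (\<lambda>\<eta>. \<Sum>S\<in>?P. \<gamma> S * (\<Psi> ((+) x ` S) \<eta> - sym_mean (card S) {x..<x + int L} \<eta>)) g +
        dot (\<lambda>\<eta>. \<Sum>k\<le>L. \<Gamma> k * (\<Sum>j\<in>{L..<l}. sym_mean k {x..<x + int j} \<eta> - sym_mean k {x..<x + int (Suc j)} \<eta>)) g"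
        by (intro dot_add_left g bounded_meas_sum bounded_meas_mult bounded_meas_const bm bm2)
      also have "dot (\<lambda>\<eta>. \<Sum>S\<in>?P. \<gamma> S * (\<Psi> ((+) x ` S) \<eta> - sym_mean (card S) {x..<x + int L} \<eta>)) g
        = (\<Sum>S\<in>?P. \<gamma> S * u S x)"
        unfolding u_def
        by (subst dot_sum_left[OF bounded_meas_mult[OF bounded_meas_const bm] g]) (simp add: dot_scale_left)
      also have "dot (\<lambda>\<eta>. \<Sum>k\<le>L. \<Gamma> k * (\<Sum>j\<in>{L..<l}. sym_mean k {x..<x + int j} \<eta> - sym_mean k {x..<x + int (Suc j)} \<eta>)) g
        = (\<Sum>k\<le>L. \<Gamma> k * (\<Sum>j\<in>{L..<l}. v k j x))"
        unfolding v_def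
        by (subst dot_sum_left[OF bounded_meas_mult[OF bounded_meas_const bounded_meas_sum[OF bm2]] g])
           (simp only: dot_scale_left dot_sum_left[OF bm2 g])
      finally show ?thesis .
    qed
    have t1: "\<bar>\<Sum>x\<in>A. c x * u S x\<bar> \<le> (2 * real L * real L) * ?N" if S: "S \<in> ?P" for S
    proof -
      obtain K where K: "L = Suc K" using L by (cases L) auto
      have "\<bar>u S x\<bar> \<le> (2 * real L * sqrt (real K)) * sqrt (bond_energy {x..<x + int K} g)" for x
      proof -
        have "(+) x ` S \<subseteq> {x..x + int K}" using S K by (auto simp: image_def)
        moreover have "{x..<x + int L} = {x..x + int K}" using K by auto
        moreover have "card ((+) x ` S) = card S" by (simp add: card_image)
        ultimately show ?thesis
          unfolding u_def using monomial_sym_mean_le[OF g, of "(+) x ` S" x K] K by simp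
      qed
      then have "\<bar>\<Sum>x\<in>A. c x * u S x\<bar> \<le> (2 * real L * sqrt (real K)) * sqrt (real K) * sqrt (\<Sum>x\<in>A. (c x)\<^sup>2) * sqrt (bond_energy Z g)"
        using fin Z l K by (intro superposition_le) force+
      also have "(2 * real L * sqrt (real K)) * sqrt (real K) = 2 * real L * real K" by simp
      also have "2 * real L * real K * sqrt (\<Sum>x\<in>A. (c x)\<^sup>2) * sqrt (bond_energy Z g) \<le> (2 * real L * real L) * ?N"
        unfolding mult.assoc[of _ "sqrt (\<Sum>x\<in>A. (c x)\<^sup>2)"] using K by (intro mult_right_mono mult_left_mono Npos) auto
      finally show ?thesis .
    qed
    have t2: "\<bar>\<Gamma> k * (\<Sum>x\<in>A. c x * v k j x)\<bar> \<le> \<bar>\<Gamma> k\<bar> * sqrt (2 * real k ^ Suc k) * scale_rate m j * ?N"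
      if kj: "k \<le> L" "j \<in> {L..<l}" for k j
    proof (cases "k < m")
      case True
      then show ?thesis using degree by (simp add: \<Gamma>_def)
    next
      case False
      have "\<bar>\<Sum>x\<in>A. c x * v k j x\<bar> \<le> sqrt (2 * real k ^ Suc k) * scale_rate m j * sqrt (\<Sum>x\<in>A. (c x)\<^sup>2) * sqrt (bond_energy Z g)"
        unfolding v_def using False m kj g fin Z by (intro enlarge_superposition_le) force+
      then show ?thesis unfolding abs_mult mult.assoc by (intro mult_left_mono) (auto simp: mult.assoc)
    qed
    have split: "(\<Sum>x\<in>A. c x * dot (block_fluctuation \<gamma> L l x) g) =
      (\<Sum>S\<in>?P. \<gamma> S * (\<Sum>x\<in>A. c x * u S x)) + (\<Sum>k\<le>L. \<Sum>j\<in>{L..<l}. \<Gamma> k * (\<Sum>x\<in>A. c x * v k j x))"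
    proof -
      have "(\<Sum>x\<in>A. c x * dot (block_fluctuation \<gamma> L l x) g) =
        (\<Sum>x\<in>A. \<Sum>S\<in>?P. \<gamma> S * (c x * u S x)) + (\<Sum>x\<in>A. \<Sum>k\<le>L. \<Sum>j\<in>{L..<l}. \<Gamma> k * (c x * v k j x))"
        by (simp add: exp distrib_left sum.distrib sum_distrib_left mult.left_commute)
      also have "(\<Sum>x\<in>A. \<Sum>S\<in>?P. \<gamma> S * (c x * u S x)) = (\<Sum>S\<in>?P. \<gamma> S * (\<Sum>x\<in>A. c x * u S x))"
        by (subst sum.swap) (simp add: sum_distrib_left)
      also have "(\<Sum>x\<in>A. \<Sum>k\<le>L. \<Sum>j\<in>{L..<l}. \<Gamma> k * (c x * v k j x)) = (\<Sum>k\<le>L. \<Sum>x\<in>A. \<Sum>j\<in>{L..<l}. \<Gamma> k * (c x * v k j x))"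
        by (rule sum.swap)
      also have "\<dots> = (\<Sum>k\<le>L. \<Sum>j\<in>{L..<l}. \<Gamma> k * (\<Sum>x\<in>A. c x * v k j x))"
        by (intro sum.cong refl) (subst sum.swap, simp add: sum_distrib_left)
      finally show ?thesis .
    qed
    have "\<bar>\<Sum>x\<in>A. c x * dot (block_fluctuation \<gamma> L l x) g\<bar> \<le> (\<Sum>S\<in>?P. \<bar>\<gamma> S\<bar> * ((2 * real L * real L) * ?N)) + (\<Sum>k\<le>L. \<Sum>j\<in>{L..<l}. \<bar>\<Gamma> k\<bar> * sqrt (2 * real k ^ Suc k) * scale_rate m j * ?N)"
    proof -
      have "\<bar>\<Sum>S\<in>?P. \<gamma> S * (\<Sum>x\<in>A. c x * u S x)\<bar> \<le> (\<Sum>S\<in>?P. \<bar>\<gamma> S\<bar> * ((2 * real L * real L) * ?N))"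
        by (rule order_trans[OF sum_abs sum_mono]) (simp only: abs_mult, intro mult_left_mono t1 abs_ge_zero)
      moreover have "\<bar>\<Sum>k\<le>L. \<Sum>j\<in>{L..<l}. \<Gamma> k * (\<Sum>x\<in>A. c x * v k j x)\<bar> \<le> (\<Sum>k\<le>L. \<Sum>j\<in>{L..<l}. \<bar>\<Gamma> k\<bar> * sqrt (2 * real k ^ Suc k) * scale_rate m j * ?N)"
        by (rule order_trans[OF sum_abs sum_mono], rule order_trans[OF sum_abs sum_mono]) (rule t2, auto)
      ultimately show ?thesis unfolding split by linarith
    qed
    also have "\<dots> = C1 * ?N + C2 * (\<Sum>j\<in>{L..<l}. scale_rate m j) * ?N"
      unfolding C1_def C2_def by (simp add: sum_distrib_right sum_distrib_left mult.assoc) (rule sum.swap)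
    also have "\<dots> \<le> C1 * (2 * sqrt (c_const m l)) * ?N + C2 * (3 * sqrt (c_const m l)) * ?N"
    proof (intro add_mono mult_right_mono Npos mult_left_mono nn)
      show "C1 \<le> C1 * (2 * sqrt (c_const m l))" using mult_left_mono[OF c_const_lower[OF l(1), of m] nn(1)] by simp
      have "(\<Sum>j\<in>{L..<l}. scale_rate m j) \<le> (\<Sum>j\<in>{1..<l}. scale_rate m j)"
        using L by (intro sum_mono2) auto
      then show "(\<Sum>j\<in>{L..<l}. scale_rate m j) \<le> 3 * sqrt (c_const m l)"
        using sum_scale_rate_le[OF m l(1)] by linarith
    qed
    also have "\<dots> = (2 * C1 + 3 * C2) * sqrt (c_const m l) * sqrt (\<Sum>x\<in>A. (c x)\<^sup>2) * sqrt (bond_energy Z g)"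
      by (simp add: algebra_simps)
    finally show "\<bar>\<Sum>x\<in>A. c x * dot (block_fluctuation \<gamma> L l x) g\<bar>
      \<le> (2 * C1 + 3 * C2) * sqrt (c_const m l) * sqrt (\<Sum>x\<in>A. (c x)\<^sup>2) * sqrt (bond_energy Z g)" .
  qed
qed

end

section \<open>Degree and conditional expectation\<close>

lemma has_field_derivative_shifted_poly:
  fixes b :: "nat \<Rightarrow> real"
  shows "((\<lambda>s. \<Sum>k<Suc N. b k * (s - r) ^ k) has_field_derivative
    (\<Sum>k<N. real (Suc k) * b (Suc k) * (s - r) ^ k)) (at s)"
proof -
  have "((\<lambda>s. \<Sum>k<Suc N. b k * (s - r) ^ k) has_field_derivative
    (\<Sum>k<Suc N. b k * (real k * (s - r) ^ (k - 1)))) (at s)"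
    by (auto intro!: derivative_eq_intros sum.cong simp: mult_ac)
  also have "(\<Sum>k<Suc N. b k * (real k * (s - r) ^ (k - 1))) = (\<Sum>k<N. real (Suc k) * b (Suc k) * (s - r) ^ k)"
    by (subst sum.lessThan_Suc_shift) (simp add: mult_ac)
  finally show ?thesis .
qed

lemma higher_deriv_shifted_poly:
  fixes b :: "nat \<Rightarrow> real"
  assumes "j < N"
  shows "(deriv ^^ j) (\<lambda>s. \<Sum>k<N. b k * (s - r) ^ k) r = fact j * b j"
  using assms
proof (induction j arbitrary: N b)
  case 0
  then obtain N' where "N = Suc N'" by (cases N) auto
  then show ?case by (simp add: sum.lessThan_Suc_shift del: sum.lessThan_Suc)
next
  case (Suc j)
  then obtain N' where N: "N = Suc N'" by (cases N) auto
  have "deriv (\<lambda>s. \<Sum>k<N. b k * (s - r) ^ k) = (\<lambda>s. \<Sum>k<N'. (real (Suc k) * b (Suc k)) * (s - r) ^ k)"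
    unfolding N by (intro ext DERIV_imp_deriv has_field_derivative_shifted_poly)
  then show ?case using Suc N by (simp only: funpow_Suc_right o_apply) (simp add: algebra_simps)
qed

lemma higher_deriv_eventually_cong:
  fixes g k :: "real \<Rightarrow> real"
  assumes "\<forall>\<^sub>F s in nhds r. g s = k s"
  shows "\<forall>\<^sub>F s in nhds r. (deriv ^^ j) g s = (deriv ^^ j) k s"
proof (induction j)
  case (Suc j)
  have "\<forall>\<^sub>F s in nhds r. \<forall>\<^sub>F u in nhds s. (deriv ^^ j) g u = (deriv ^^ j) k u"
    using Suc by (simp add: eventually_eventually)
  then show ?case by eventually_elim (auto intro: deriv_cong_ev)
qed (use assms in simp)

context bernoulli_density
begin

text \<open>The mean of \<open>\<Psi> S\<close> under density \<open>\<sigma>\<close> is \<open>(\<sigma> - \<rho>)\<close> to the power \<open>card S\<close>. So the total coefficients of the degrees are,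
  up to factorials, the derivatives of the mean of \<open>f\<close> at \<open>\<rho>\<close>.\<close>

lemma has_degree_fourier:
  assumes f: "\<And>\<eta>. f \<eta> = (\<Sum>S\<in>Pow {0..<int L}. \<gamma> S * \<Psi> S \<eta>)" and deg: "has_degree \<rho> f m" and k: "k < m"
  shows "(\<Sum>S | S \<subseteq> {0..<int L} \<and> card S = k. \<gamma> S) = 0"
proof -
  define \<Gamma> where "\<Gamma> k = (\<Sum>S | S \<subseteq> {0..<int L} \<and> card S = k. \<gamma> S)" for k
  let ?P = "Pow {0..<int L}"
  have img: "card ` ?P \<subseteq> {..<Suc L}"
  proof
    fix k assume "k \<in> card ` ?P"
    then obtain S where "S \<subseteq> {0..<int L}" "k = card S" by auto
    then show "k \<in> {..<Suc L}" using card_mono[of "{0..<int L}" S] by simp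
  qed
  have mean: "mean_at f s = (\<Sum>k<Suc L. \<Gamma> k * (s - \<rho>) ^ k)" if s: "0 \<le> s" "s \<le> 1" for s
  proof -
    have fin: "finite S" if "S \<in> ?P" for S using that finite_subset by auto
    have "mean_at f s = (\<Sum>S\<in>?P. \<gamma> S * (\<integral>\<eta>. \<Psi> S \<eta> \<partial>bernoulli_measure s))"
      unfolding mean_at_def f by (subst Bochner_Integration.integral_sum) auto
    also have "\<dots> = (\<Sum>S\<in>?P. \<gamma> S * (s - \<rho>) ^ card S)"
      using s fin by (intro sum.cong refl) (simp add: integral_centred_monomial)
    also have "\<dots> = (\<Sum>k<Suc L. \<Sum>S\<in>{S \<in> ?P. card S = k}. \<gamma> S * (s - \<rho>) ^ card S)"
      by (rule sum.group[symmetric]) (use img in auto)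
    also have "\<dots> = (\<Sum>k<Suc L. \<Gamma> k * (s - \<rho>) ^ k)"
      by (simp add: \<Gamma>_def sum_distrib_right del: sum.lessThan_Suc)
    finally show ?thesis .
  qed
  have "\<forall>\<^sub>F s in nhds \<rho>. s \<in> {0<..<1}"
    using rho_pos rho_less_1 by (intro eventually_nhds_in_open) auto
  then have "\<forall>\<^sub>F s in nhds \<rho>. mean_at f s = (\<Sum>k<Suc L. \<Gamma> k * (s - \<rho>) ^ k)"
    by eventually_elim (rule mean; simp)
  then have ev: "(deriv ^^ k) (mean_at f) \<rho> = (deriv ^^ k) (\<lambda>s. \<Sum>k<Suc L. \<Gamma> k * (s - \<rho>) ^ k) \<rho>"
    by (intro eventually_nhds_x_imp_x[OF higher_deriv_eventually_cong])
  show ?thesis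
  proof (cases "k < Suc L")
    case True
    have "(deriv ^^ k) (mean_at f) \<rho> = 0" using deg k unfolding has_degree_def by blast
    then have "fact k * \<Gamma> k = 0" unfolding ev higher_deriv_shifted_poly[OF True] .
    then show ?thesis by (simp add: \<Gamma>_def)
  next
    case False
    have "{S. S \<subseteq> {0..<int L} \<and> card S = k} = {}"
    proof (rule equals0I)
      fix S assume "S \<in> {S. S \<subseteq> {0..<int L} \<and> card S = k}"
      then have "S \<subseteq> {0..<int L}" "card S = k" by auto
      then show False using card_mono[of "{0..<int L}" S] False by simp
    qed
    then show ?thesis by (simp only: sum.empty)
  qed
qed

text \<open>A permutation of \<open>B\<close> that carries the particles of \<open>\<eta>\<close> to the particles of \<open>\<xi>\<close> also permutes the subsets of size \<open>k\<close>.\<close>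

lemma sym_mean_cong_count:
  assumes B: "finite B" and eq: "card {i\<in>B. \<eta> i} = card {i\<in>B. \<xi> i}"
  shows "sym_mean k B \<eta> = sym_mean k B \<xi>"
proof -
  have "card {i\<in>B. \<not> \<eta> i} = card {i\<in>B. \<not> \<xi> i}"
  proof -
    have "card {i\<in>B. \<not> \<zeta> i} = card B - card {i\<in>B. \<zeta> i}" for \<zeta>
    proof -
      have "{i\<in>B. \<not> \<zeta> i} = B - {i\<in>B. \<zeta> i}" by auto
      then show ?thesis using B by (simp add: card_Diff_subset)
    qed
    then show ?thesis using eq by simp
  qed
  then obtain \<alpha> \<beta> where \<alpha>: "bij_betw \<alpha> {i\<in>B. \<eta> i} {i\<in>B. \<xi> i}" and \<beta>: "bij_betw \<beta> {i\<in>B. \<not> \<eta> i} {i\<in>B. \<not> \<xi> i}"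
    using B eq finite_same_card_bij[of "{i\<in>B. \<eta> i}" "{i\<in>B. \<xi> i}"] finite_same_card_bij[of "{i\<in>B. \<not> \<eta> i}" "{i\<in>B. \<not> \<xi> i}"]
    by auto
  define \<pi> where "\<pi> i = (if \<eta> i then \<alpha> i else \<beta> i)" for i
  have 1: "bij_betw \<pi> {i\<in>B. \<eta> i} {i\<in>B. \<xi> i}" using \<alpha> by (rule bij_betw_cong[THEN iffD1, rotated]) (auto simp: \<pi>_def)
  have 2: "bij_betw \<pi> {i\<in>B. \<not> \<eta> i} {i\<in>B. \<not> \<xi> i}" using \<beta> by (rule bij_betw_cong[THEN iffD1, rotated]) (auto simp: \<pi>_def)
  have "bij_betw \<pi> ({i\<in>B. \<eta> i} \<union> {i\<in>B. \<not> \<eta> i}) ({i\<in>B. \<xi> i} \<union> {i\<in>B. \<not> \<xi> i})"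
    by (rule bij_betw_combine[OF 1 2]) auto
  moreover have "{i\<in>B. \<zeta> i} \<union> {i\<in>B. \<not> \<zeta> i} = B" for \<zeta> by auto
  ultimately have \<pi>: "bij_betw \<pi> B B" by simp
  have occ: "\<xi> (\<pi> i) = \<eta> i" if "i \<in> B" for i
    using that bij_betw_apply[OF 1, of i] bij_betw_apply[OF 2, of i] by auto
  have mon: "\<Psi> (\<pi> ` S) \<xi> = \<Psi> S \<eta>" if "S \<subseteq> B" for S
  proof -
    have "inj_on \<pi> S" using \<pi> that by (meson bij_betw_def inj_on_subset)
    then have "\<Psi> (\<pi> ` S) \<xi> = (\<Prod>i\<in>S. of_bool (\<xi> (\<pi> i)) - \<rho>)" unfolding centred_monomial_def by (subst prod.reindex) auto
    also have "\<dots> = \<Psi> S \<eta>" unfolding centred_monomial_def using that occ by (intro prod.cong) auto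
    finally show ?thesis .
  qed
  have bijP: "bij_betw (image \<pi>) {S. S \<subseteq> B \<and> card S = k} {S. S \<subseteq> B \<and> card S = k}"
  proof -
    have inj: "inj_on (image \<pi>) (Pow B)" using \<pi> by (simp add: bij_betw_def inj_on_image_Pow)
    have "card (\<pi> ` S) = card S" if "S \<subseteq> B" for S
      using \<pi> that by (meson bij_betw_def card_image inj_on_subset)
    then have sub: "image \<pi> ` {S. S \<subseteq> B \<and> card S = k} \<subseteq> {S. S \<subseteq> B \<and> card S = k}"
      using \<pi> by (auto simp: bij_betw_def)
    have "finite {S. S \<subseteq> B \<and> card S = k}" using B by (auto intro: finite_subset[of _ "Pow B"])
    then have "image \<pi> ` {S. S \<subseteq> B \<and> card S = k} = {S. S \<subseteq> B \<and> card S = k}"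
      by (intro endo_inj_surj sub) (auto intro: inj_on_subset[OF inj])
    moreover have "inj_on (image \<pi>) {S. S \<subseteq> B \<and> card S = k}" by (rule inj_on_subset[OF inj]) auto
    ultimately show ?thesis by (simp add: bij_betw_def)
  qed
  have "(\<Sum>S | S \<subseteq> B \<and> card S = k. \<Psi> S \<xi>) = (\<Sum>S | S \<subseteq> B \<and> card S = k. \<Psi> (\<pi> ` S) \<xi>)"
    by (rule sum.reindex_bij_betw[OF bijP, symmetric])
  also have "\<dots> = (\<Sum>S | S \<subseteq> B \<and> card S = k. \<Psi> S \<eta>)" by (intro sum.cong refl mon) auto
  finally show ?thesis by (simp add: sym_mean_def)
qed

lemma block_average_eq_card:
  "block_average l x \<eta> = real (card {i \<in> {x..<x + int l}. \<eta> i}) / real l"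
proof -
  have "{x..x + int l - 1} = {x..<x + int l}" by auto
  then have "(\<Sum>y = x..x + int l - 1. of_bool (\<eta> y)) = real (card {i \<in> {x..<x + int l}. \<eta> i})"
    by (simp add: of_bool_def sum.inter_filter[symmetric])
  then show ?thesis by (simp add: block_average_def)
qed

lemma block_average_measurable: "block_average l x \<in> borel_measurable config_algebra"
  unfolding block_average_def by measurable

lemma block_average_exchange:
  assumes "i \<in> {x..<x + int l}" "j \<in> {x..<x + int l}"
  shows "block_average l x (exchange i j \<eta>) = block_average l x \<eta>"
proof -
  let ?\<tau> = "Transposition.transpose i j"
  have "bij_betw ?\<tau> {k \<in> {x..<x + int l}. exchange i j \<eta> k} {k \<in> {x..<x + int l}. \<eta> k}"
    by (rule bij_betw_byWitness[where f'="?\<tau>"])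
       (use assms in \<open>auto simp: exchange_eq Transposition.transpose_def split: if_splits\<close>)
  then show ?thesis by (simp add: block_average_eq_card bij_betw_same_card)
qed

text \<open>A function of the block average that is written out as a finite sum over the values of the average.\<close>

lemma sym_mean_measurable_block_average:
  assumes "1 \<le> l"
  shows "sym_mean k {x..<x + int l} \<in> borel_measurable (vimage_algebra UNIV (block_average l x) borel)"
proof -
  let ?b = "block_average l x" and ?s = "sym_mean k {x..<x + int l}"
  have "range ?b \<subseteq> (\<lambda>c. real c / real l) ` {..l}"
  proof
    fix v assume "v \<in> range ?b"
    then obtain \<eta> where "v = real (card {i \<in> {x..<x + int l}. \<eta> i}) / real l" by (auto simp: block_average_eq_card)
    moreover have "card {i \<in> {x..<x + int l}. \<eta> i} \<le> card {x..<x + int l}" by (intro card_mono) auto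
    ultimately show "v \<in> (\<lambda>c. real c / real l) ` {..l}" by auto
  qed
  then have fin: "finite (range ?b)" by (rule finite_subset) simp
  define w where "w v = ?s (SOME \<eta>. ?b \<eta> = v)" for v
  have "?s \<eta> = (\<Sum>v\<in>range ?b. w v * indicator {v} (?b \<eta>))" for \<eta>
  proof -
    have "?b (SOME \<xi>. ?b \<xi> = ?b \<eta>) = ?b \<eta>" by (rule someI[of "\<lambda>\<xi>. ?b \<xi> = ?b \<eta>"]) simp
    then have "w (?b \<eta>) = ?s \<eta>"
      unfolding w_def using assms by (intro sym_mean_cong_count) (auto simp: block_average_eq_card)
    then show ?thesis using fin by (simp add: indicator_def sum.delta' if_distrib cong: if_cong)
  qed
  then have eq: "?s = (\<lambda>\<eta>. \<Sum>v\<in>range ?b. w v * indicator {v} (?b \<eta>))" by auto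
  have [measurable]: "?b \<in> borel_measurable (vimage_algebra UNIV ?b borel)" by (rule measurable_vimage_algebra1) simp
  show ?thesis unfolding eq by measurable
qed

text \<open>An event of the block average is invariant under the exchanges within the block, so its indicator has no bond energy there and
  \<open>monomial_sym_mean_le\<close> shows that a monomial and its symmetric mean have the same integral over it.\<close>

lemma cond_exp_block_eq:
  assumes f: "\<And>\<eta>. f \<eta> = (\<Sum>S\<in>Pow {0..<int L}. \<gamma> S * \<Psi> S \<eta>)" and l: "L \<le> l" "1 \<le> l"
  shows "AE \<eta> in \<nu>. cond_exp_block \<rho> l x (\<lambda>\<eta>. f (shift x \<eta>)) \<eta>
    = (\<Sum>S\<in>Pow {0..<int L}. \<gamma> S * sym_mean (card S) {x..<x + int l} \<eta>)"
proof -
  let ?F = "vimage_algebra UNIV (block_average l x) borel"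
  let ?P = "Pow {0..<int L}"
  let ?g = "\<lambda>\<eta>. \<Sum>S\<in>?P. \<gamma> S * sym_mean (card S) {x..<x + int l} \<eta>"
  have fs: "f (shift x \<eta>) = (\<Sum>S\<in>?P. \<gamma> S * \<Psi> ((+) x ` S) \<eta>)" for \<eta>
    by (simp add: f centred_monomial_shift)
  have subalg: "subalgebra \<nu> ?F"
    unfolding subalgebra_def
  proof (intro conjI)
    show "sets ?F \<subseteq> sets \<nu>"
      using measurable_sets[OF block_average_measurable[of l x]] by (auto simp: sets_vimage_algebra2)
  qed simp
  interpret finite_measure_subalgebra \<nu> ?F
    by (unfold_locales) (rule subalg)
  have bg: "bounded_meas ?g" by (intro bounded_meas_intros bounded_meas_sym_mean)
  have bf: "bounded_meas (\<lambda>\<eta>. f (shift x \<eta>))" unfolding fs by (intro bounded_meas_intros)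
  have gF: "?g \<in> borel_measurable ?F"
    by (intro borel_measurable_sum borel_measurable_times borel_measurable_const sym_mean_measurable_block_average l(2))
  have "set_lebesgue_integral \<nu> A (\<lambda>\<eta>. f (shift x \<eta>)) = set_lebesgue_integral \<nu> A ?g" if A: "A \<in> sets ?F" for A
  proof -
    let ?i = "indicator A :: config \<Rightarrow> real"
    obtain D where D: "A = block_average l x -` D" using A by (auto simp: sets_vimage_algebra2)
    have Am: "A \<in> sets config_algebra" using A subalg by (auto simp: subalgebra_def)
    have bi: "bounded_meas ?i" using Am by (intro bounded_measI[where B=1]) auto
    obtain K where K: "l = Suc K" using l(2) by (cases l) auto
    have "exchange z (z + 1) \<eta> \<in> A \<longleftrightarrow> \<eta> \<in> A" if "z \<in> {x..<x + int K}" for z \<eta>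
      unfolding D using block_average_exchange[of z x l "z + 1" \<eta>] that K by simp
    then have zero: "bond_energy {x..<x + int K} ?i = 0"
      unfolding bond_energy_def grad_def l2_def dot_def by (simp add: indicator_def)
    have one: "dot (\<Psi> ((+) x ` S)) ?i = dot (sym_mean (card S) {x..<x + int l}) ?i" if S: "S \<in> ?P" for S
    proof -
      have sub: "(+) x ` S \<subseteq> {x..x + int K}" using S K l(1) by fastforce
      have "card ((+) x ` S) = card S" by (simp add: card_image)
      then have "\<bar>dot (\<lambda>\<eta>. \<Psi> ((+) x ` S) \<eta> - sym_mean (card S) {x..x + int K} \<eta>) ?i\<bar> \<le> 0"
        using monomial_sym_mean_le[OF bi sub] zero by simp
      moreover have "{x..x + int K} = {x..<x + int l}" using K by auto
      ultimately show ?thesis using bi by (simp add: dot_diff_left)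
    qed
    have "set_lebesgue_integral \<nu> A (\<lambda>\<eta>. f (shift x \<eta>)) = dot (\<lambda>\<eta>. \<Sum>S\<in>?P. \<gamma> S * \<Psi> ((+) x ` S) \<eta>) ?i"
      by (simp add: set_lebesgue_integral_def dot_def fs mult.commute)
    also have "\<dots> = (\<Sum>S\<in>?P. \<gamma> S * dot (\<Psi> ((+) x ` S)) ?i)"
      using bi by (subst dot_sum_left) (auto simp: dot_scale_left intro!: bounded_meas_intros)
    also have "\<dots> = (\<Sum>S\<in>?P. \<gamma> S * dot (sym_mean (card S) {x..<x + int l}) ?i)"
      by (intro sum.cong refl) (simp only: one)
    also have "\<dots> = dot ?g ?i"
      using bi by (subst dot_sum_left) (auto simp: dot_scale_left intro!: bounded_meas_intros)
    also have "\<dots> = set_lebesgue_integral \<nu> A ?g"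
      by (simp add: set_lebesgue_integral_def dot_def mult.commute)
    finally show ?thesis .
  qed
  then show ?thesis
    unfolding cond_exp_block_def
    using bg bf gF by (intro real_cond_exp_charact) auto
qed

end

section \<open>The energy of the exclusion operator\<close>

definition bond_rate :: "real \<Rightarrow> nat \<Rightarrow> int \<Rightarrow> config \<Rightarrow> real" where
  "bond_rate a n x \<eta> = p_rate a n * of_bool (\<eta> x) * (1 - of_bool (\<eta> (x + 1)))
     + q_rate a n * of_bool (\<eta> (x + 1)) * (1 - of_bool (\<eta> x))"

lemma exchange_outside_support:
  assumes "supported_in A g" "x \<notin> A" "y \<notin> A"
  shows "g (exchange x y \<eta>) = g \<eta>"
  using assms unfolding supported_in_def by (metis exchange_def fun_upd_apply)

lemma exclusion_operator_eq_sum: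
  assumes "supported_in A g" "finite Z" "\<And>x. x \<in> A \<Longrightarrow> x \<in> Z \<and> x - 1 \<in> Z"
  shows "exclusion_operator a n g \<eta> = (\<Sum>x\<in>Z. bond_rate a n x \<eta> * (g (exchange x (x + 1) \<eta>) - g \<eta>))"
proof -
  have "g (exchange x (x + 1) \<eta>) - g \<eta> = 0" if "x \<notin> Z" for x
    using assms(3)[of x] assms(3)[of "x + 1"] that exchange_outside_support[OF assms(1), of x "x + 1" \<eta>] by auto
  then have "exclusion_operator a n g \<eta> = (\<Sum>\<^sub>\<infinity>x\<in>Z. bond_rate a n x \<eta> * (g (exchange x (x + 1) \<eta>) - g \<eta>))"
    unfolding exclusion_operator_def bond_rate_def by (intro infsum_cong_neutral) auto
  then show ?thesis using assms(2) by simp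
qed

lemma local_function_supported_interval:
  assumes "local_function g"
  obtains M :: nat where "supported_in {- int M<..<int M} g"
proof -
  from assms obtain A where A: "finite A" "supported_in A g" by (auto simp: local_function_def)
  define M where "M = Suc (nat (Max (insert 0 (abs ` A))))"
  have "A \<subseteq> {- int M<..<int M}"
  proof
    fix x assume "x \<in> A"
    then have "\<bar>x\<bar> \<le> Max (insert 0 (abs ` A))" using A by (intro Max_ge) auto
    then show "x \<in> {- int M<..<int M}" unfolding M_def by auto
  qed
  then have "supported_in {- int M<..<int M} g" using A(2) unfolding supported_in_def by blast
  then show ?thesis by (rule that)
qed

lemma local_function_exclusion_operator:
  assumes "local_function g" shows "local_function (exclusion_operator a n g)"
proof -
  from local_function_supported_interval[OF assms] obtain M where M: "supported_in {- int M<..<int M} g" .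
  let ?Z = "{- int M..<int M}" and ?W = "{- int M..int M}"
  have eq: "exclusion_operator a n g \<eta> = (\<Sum>x\<in>?Z. bond_rate a n x \<eta> * (g (exchange x (x + 1) \<eta>) - g \<eta>))" for \<eta>
    by (rule exclusion_operator_eq_sum[OF M]) auto
  have "supported_in ?W (exclusion_operator a n g)"
    unfolding supported_in_def
  proof (intro allI impI)
    fix \<eta> \<xi> :: config assume e: "\<forall>x\<in>?W. \<eta> x = \<xi> x"
    have g: "g \<eta>' = g \<xi>'" if "\<forall>x\<in>?W. \<eta>' x = \<xi>' x" for \<eta>' \<xi>'
      using M that unfolding supported_in_def by auto
    show "exclusion_operator a n g \<eta> = exclusion_operator a n g \<xi>"
      unfolding eq
    proof (rule sum.cong[OF refl])
      fix x assume x: "x \<in> ?Z"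
      then have "\<eta> x = \<xi> x" "\<eta> (x + 1) = \<xi> (x + 1)" using e by auto
      moreover from this have "g (exchange x (x + 1) \<eta>) = g (exchange x (x + 1) \<xi>)"
        using e by (intro g) (auto simp: exchange_def)
      moreover have "g \<eta> = g \<xi>" using e by (rule g)
      ultimately show "bond_rate a n x \<eta> * (g (exchange x (x + 1) \<eta>) - g \<eta>)
        = bond_rate a n x \<xi> * (g (exchange x (x + 1) \<xi>) - g \<xi>)"
        by (simp add: bond_rate_def)
    qed
  qed
  then show ?thesis unfolding local_function_def by blast
qed

lemma sum_telescope_int:
  fixes u :: "int \<Rightarrow> real"
  assumes "i \<le> j" shows "(\<Sum>z\<in>{i..<j}. u z - u (z + 1)) = u i - u j"
  using assms
proof (induction j rule: int_ge_induct)
  case (step j)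
  have "{i..<j + 1} = insert j {i..<j}" using step by auto
  then show ?case using step by simp
qed simp

context bernoulli_density
begin

lemma dot_scale_right: "dot g (\<lambda>\<eta>. c * k \<eta>) = c * dot g k"
  by (simp add: dot_def mult.left_commute)

lemma dot_divide_right: "dot g (\<lambda>\<eta>. k \<eta> / c) = dot g k / c"
  by (simp add: dot_def)

text \<open>Where the two sites of the bond differ, the jump rate is \<open>1/2 + (p - q) D / 2\<close> with \<open>D = \<plusminus>1\<close> the difference of the occupations;
  where they agree, the exchange does nothing. The constant part gives the gradient. In the drift part the
  product of \<open>D\<close>, \<open>g\<close> and \<open>g \<circ> exchange\<close> changes sign under the exchange and integrates to zero, and \<open>D g\<^sup>2\<close> remains.\<close>

lemma dot_bond_term:
  assumes g: "bounded_meas g"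
  shows "dot g (\<lambda>\<eta>. bond_rate a n z \<eta> * (g (exchange z (z + 1) \<eta>) - g \<eta>))
    = - (1 / 4) * (grad z (z + 1) g)\<^sup>2
      - (p_rate a n - q_rate a n) / 2 * dot (\<lambda>\<eta>. of_bool (\<eta> z) - of_bool (\<eta> (z + 1))) (\<lambda>\<eta>. g \<eta> * g \<eta>)"
proof -
  define e where "e \<eta> = exchange z (z + 1) \<eta>" for \<eta>
  define D where "D \<eta> = of_bool (\<eta> z) - (of_bool (\<eta> (z + 1)) :: real)" for \<eta> :: config
  let ?d = "(p_rate a n - q_rate a n) / 2"
  have ge: "bounded_meas (\<lambda>\<eta>. g (e \<eta>))" unfolding e_def by (rule bounded_meas_exchange[OF g])
  have D: "bounded_meas D" unfolding D_def by (intro bounded_meas_intros)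
  have pq: "q_rate a n = 1 - p_rate a n" by (simp add: q_rate_def)
  have rate: "bond_rate a n z \<eta> * (g (e \<eta>) - g \<eta>) = (g (e \<eta>) - g \<eta>) / 2 + ?d * (D \<eta> * g (e \<eta>) - D \<eta> * g \<eta>)" for \<eta>
  proof (cases "\<eta> z = \<eta> (z + 1)")
    case True
    then have "e \<eta> = \<eta>" unfolding e_def exchange_def by (auto simp: fun_eq_iff)
    then show ?thesis by simp
  next
    case False
    then have r: "bond_rate a n z \<eta> = 1 / 2 + ?d * D \<eta>"
      unfolding bond_rate_def D_def pq by (cases "\<eta> z"; cases "\<eta> (z + 1)") (auto simp: field_simps)
    have "r * (v - w) = (v - w) / 2 + d * (u * v - u * w)" if "r = 1 / 2 + d * u" for r d u v w :: real
      using that by (simp add: algebra_simps)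
    from this[OF r] show ?thesis .
  qed
  have anti: "dot g (\<lambda>\<eta>. D \<eta> * g (e \<eta>)) = 0"
  proof -
    have De: "D (e \<eta>) = - D \<eta>" for \<eta> by (simp add: D_def e_def exchange_def)
    have ee: "e (e \<eta>) = \<eta>" for \<eta> by (simp add: e_def)
    have "dot g (\<lambda>\<eta>. D \<eta> * g (e \<eta>)) = dot (\<lambda>\<eta>. g (e \<eta>)) (\<lambda>\<eta>. D (e \<eta>) * g (e (e \<eta>)))"
      using dot_exchange[OF g bounded_meas_mult[OF D ge], of z "z + 1"] unfolding e_def by simp
    also have "\<dots> = dot (\<lambda>\<eta>. g (e \<eta>)) (\<lambda>\<eta>. - (D \<eta> * g \<eta>))" by (simp add: De ee)
    also have "\<dots> = - dot g (\<lambda>\<eta>. D \<eta> * g (e \<eta>))" by (simp add: dot_def mult_ac)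
    finally show ?thesis by simp
  qed
  have sq: "(grad z (z + 1) g)\<^sup>2 = 2 * dot g g - 2 * dot g (\<lambda>\<eta>. g (e \<eta>))"
  proof -
    have "dot (\<lambda>\<eta>. g (e \<eta>)) (\<lambda>\<eta>. g (e \<eta>)) = dot g g" unfolding e_def by (rule dot_exchange[OF g g])
    moreover have "(grad z (z + 1) g)\<^sup>2 = dot (\<lambda>\<eta>. g \<eta> - g (e \<eta>)) (\<lambda>\<eta>. g \<eta> - g (e \<eta>))"
      unfolding grad_def l2_power2 e_def ..
    ultimately show ?thesis
      using g ge bounded_meas_diff[OF g ge] by (simp add: dot_diff_left dot_diff_right dot_commute[of "\<lambda>\<eta>. g (e \<eta>)" g])
  qed
  have "dot g (\<lambda>\<eta>. bond_rate a n z \<eta> * (g (e \<eta>) - g \<eta>))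
    = dot g (\<lambda>\<eta>. (g (e \<eta>) - g \<eta>) / 2 + ?d * (D \<eta> * g (e \<eta>) - D \<eta> * g \<eta>))" by (simp only: rate)
  also have "\<dots> = dot g (\<lambda>\<eta>. (g (e \<eta>) - g \<eta>) / 2) + dot g (\<lambda>\<eta>. ?d * (D \<eta> * g (e \<eta>) - D \<eta> * g \<eta>))"
    by (intro dot_add_right g bounded_meas_divide bounded_meas_mult bounded_meas_diff bounded_meas_const ge D)
  also have "dot g (\<lambda>\<eta>. (g (e \<eta>) - g \<eta>) / 2) = (dot g (\<lambda>\<eta>. g (e \<eta>)) - dot g g) / 2"
    using g ge by (simp add: dot_divide_right dot_diff_right)
  also have "dot g (\<lambda>\<eta>. ?d * (D \<eta> * g (e \<eta>) - D \<eta> * g \<eta>)) = ?d * (dot g (\<lambda>\<eta>. D \<eta> * g (e \<eta>)) - dot g (\<lambda>\<eta>. D \<eta> * g \<eta>))"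
    using g bounded_meas_mult[OF D ge] bounded_meas_mult[OF D g]
    by (simp only: dot_scale_right dot_diff_right)
  also have "dot g (\<lambda>\<eta>. D \<eta> * g \<eta>) = dot D (\<lambda>\<eta>. g \<eta> * g \<eta>)" by (simp add: dot_def mult_ac)
  finally have "dot g (\<lambda>\<eta>. bond_rate a n z \<eta> * (g (e \<eta>) - g \<eta>))
      = - (1 / 4) * (grad z (z + 1) g)\<^sup>2 - ?d * dot D (\<lambda>\<eta>. g \<eta> * g \<eta>)"
    unfolding anti sq by (simp add: field_simps)
  moreover have "D = (\<lambda>\<eta>. of_bool (\<eta> z) - of_bool (\<eta> (z + 1)))" by (simp add: D_def fun_eq_iff)
  ultimately show ?thesis by (simp only: e_def)
qed

text \<open>Summed over the bonds, the drift terms telescope to the difference of the occupations at \<open>-M\<close> and \<open>M\<close> against \<open>g\<^sup>2\<close>. Both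
  sites lie outside the support, so exchanging them shows that this integral is zero.\<close>

lemma energy_identity:
  assumes sup: "supported_in {- int M<..<int M} g"
  shows "dot g (exclusion_operator a n g) = - (1 / 4) * bond_energy {- int M..<int M} g"
proof -
  let ?Z = "{- int M..<int M}" and ?d = "(p_rate a n - q_rate a n) / 2"
  let ?D = "\<lambda>z (\<eta>::config). of_bool (\<eta> z) - (of_bool (\<eta> (z + 1)) :: real)"
  have "local_function g" using sup unfolding local_function_def by blast
  then have g: "bounded_meas g" by (rule local_function_bounded_meas)
  have gg: "bounded_meas (\<lambda>\<eta>. g \<eta> * g \<eta>)" by (rule bounded_meas_mult[OF g g])
  have bt: "bounded_meas (\<lambda>\<eta>. bond_rate a n z \<eta> * (g (exchange z (z + 1) \<eta>) - g \<eta>))" for z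
    unfolding bond_rate_def by (intro bounded_meas_intros bounded_meas_exchange[OF g] g)
  have eq: "exclusion_operator a n g = (\<lambda>\<eta>. \<Sum>x\<in>?Z. bond_rate a n x \<eta> * (g (exchange x (x + 1) \<eta>) - g \<eta>))"
    by (intro ext exclusion_operator_eq_sum[OF sup]) auto
  have "dot g (exclusion_operator a n g)
      = (\<Sum>z\<in>?Z. dot g (\<lambda>\<eta>. bond_rate a n z \<eta> * (g (exchange z (z + 1) \<eta>) - g \<eta>)))"
    unfolding eq dot_commute[of g] by (rule dot_sum_left[OF bt g])
  also have "\<dots> = - (1 / 4) * bond_energy ?Z g - ?d * (\<Sum>z\<in>?Z. dot (?D z) (\<lambda>\<eta>. g \<eta> * g \<eta>))"
    unfolding dot_bond_term[OF g] bond_energy_def by (simp add: sum_subtractf sum_distrib_left sum_negf)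
  also have "(\<Sum>z\<in>?Z. dot (?D z) (\<lambda>\<eta>. g \<eta> * g \<eta>)) = dot (\<lambda>\<eta>. \<Sum>z\<in>?Z. ?D z \<eta>) (\<lambda>\<eta>. g \<eta> * g \<eta>)"
    by (rule dot_sum_left[symmetric]) (intro bounded_meas_intros gg)+
  also have "(\<lambda>\<eta>. \<Sum>z\<in>?Z. ?D z \<eta>) = (\<lambda>\<eta>. of_bool (\<eta> (- int M)) - of_bool (\<eta> (int M)))"
    by (intro ext sum_telescope_int) simp
  also have "dot (\<lambda>\<eta>. of_bool (\<eta> (- int M)) - of_bool (\<eta> (int M))) (\<lambda>\<eta>. g \<eta> * g \<eta>) = 0" (is "dot ?e _ = 0")
  proof -
    have be: "bounded_meas ?e" by (intro bounded_meas_intros)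
    have gx: "g (exchange (- int M) (int M) \<eta>) = g \<eta>" for \<eta>
      by (rule exchange_outside_support[OF sup]) auto
    have ex: "?e (exchange (- int M) (int M) \<eta>) = - ?e \<eta>" for \<eta> by (simp add: exchange_def)
    have "dot ?e (\<lambda>\<eta>. g \<eta> * g \<eta>) = dot (\<lambda>\<eta>. ?e (exchange (- int M) (int M) \<eta>)) (\<lambda>\<eta>. g \<eta> * g \<eta>)"
      using dot_exchange[OF be gg, of "- int M" "int M"] by (simp only: gx)
    also have "\<dots> = - dot ?e (\<lambda>\<eta>. g \<eta> * g \<eta>)" unfolding ex by (rule dot_uminus_left)
    finally show ?thesis by simp
  qed
  finally show ?thesis by simp
qed

lemma energy_lower_bound:
  assumes "local_function g" "finite Z"
  shows "(1 / 4) * bond_energy Z g \<le> - dot g (exclusion_operator a n g)"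
proof -
  from local_function_supported_interval[OF assms(1)] obtain M where M: "supported_in {- int M<..<int M} g" .
  have "grad z (z + 1) g = 0" if "z \<notin> {- int M..<int M}" for z
    using exchange_outside_support[OF M, of z "z + 1"] that by (auto simp: grad_def l2_def dot_def)
  then have "bond_energy Z g = bond_energy (Z \<inter> {- int M..<int M}) g"
    unfolding bond_energy_def using assms(2) by (intro sum.mono_neutral_right) auto
  also have "\<dots> \<le> bond_energy {- int M..<int M} g" by (intro bond_energy_mono) auto
  finally show ?thesis using energy_identity[OF M, of a n] by simp
qed

text \<open>Adding a constant to \<open>g\<close> changes neither the operator applied to \<open>g\<close> nor the bond energy. Comparing the two energy identities
  leaves the integral of the operator applied to \<open>g\<close>; that it vanishes is the invariance of the Bernoulli measure.\<close>

lemma integral_exclusion_operator: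
  assumes "local_function g"
  shows "dot (\<lambda>_. 1) (exclusion_operator a n g) = 0"
proof -
  from local_function_supported_interval[OF assms] obtain M where M: "supported_in {- int M<..<int M} g" .
  then have M1: "supported_in {- int M<..<int M} (\<lambda>\<eta>. g \<eta> + 1)" unfolding supported_in_def by metis
  have op: "exclusion_operator a n (\<lambda>\<eta>. g \<eta> + 1) = exclusion_operator a n g"
    unfolding exclusion_operator_def by simp
  have en: "bond_energy Z (\<lambda>\<eta>. g \<eta> + 1) = bond_energy Z g" for Z
    unfolding bond_energy_def grad_def by simp
  have bo: "bounded_meas (exclusion_operator a n g)"
    by (intro local_function_bounded_meas local_function_exclusion_operator assms)
  have "dot (\<lambda>\<eta>. g \<eta> + 1) (exclusion_operator a n g) = dot g (exclusion_operator a n g)"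
    using energy_identity[OF M1, of a n] energy_identity[OF M, of a n] unfolding op en by simp
  then show ?thesis
    using dot_add_left[OF local_function_bounded_meas[OF assms] bounded_meas_const bo, of 1] by simp
qed

lemma abs_dot_bcontfun_le: 
  fixes g k :: "config \<Rightarrow>\<^sub>C real"
  shows "\<bar>dot (apply_bcontfun g) (apply_bcontfun k)\<bar> \<le> norm g * norm k"
proof -
  have "\<bar>dot (apply_bcontfun g) (apply_bcontfun k)\<bar> \<le> (\<integral>\<eta>. \<bar>apply_bcontfun g \<eta> * apply_bcontfun k \<eta>\<bar> \<partial>\<nu>)"
    unfolding dot_def by (rule integral_abs_bound)
  also have "\<dots> \<le> (\<integral>\<eta>. norm g * norm k \<partial>\<nu>)"
  proof (rule integral_mono)
    show "integrable \<nu> (\<lambda>\<eta>. \<bar>apply_bcontfun g \<eta> * apply_bcontfun k \<eta>\<bar>)"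
      by (intro integrable_abs dot_integrable) auto
    show "\<bar>apply_bcontfun g \<eta> * apply_bcontfun k \<eta>\<bar> \<le> norm g * norm k" for \<eta>
      unfolding abs_mult using norm_bounded[of g \<eta>] norm_bounded[of k \<eta>] by (intro mult_mono) auto
  qed simp
  finally show ?thesis by simp
qed

lemma bounded_bilinear_dot:
  "bounded_bilinear (\<lambda>g k :: config \<Rightarrow>\<^sub>C real. dot (apply_bcontfun g) (apply_bcontfun k))"
proof
  fix g g' k k' :: "config \<Rightarrow>\<^sub>C real" and r :: real
  show "dot (apply_bcontfun (g + g')) (apply_bcontfun k) = dot (apply_bcontfun g) (apply_bcontfun k) + dot (apply_bcontfun g') (apply_bcontfun k)"
    by (simp add: plus_bcontfun.rep_eq dot_add_left)
  show "dot (apply_bcontfun g) (apply_bcontfun (k + k')) = dot (apply_bcontfun g) (apply_bcontfun k) + dot (apply_bcontfun g) (apply_bcontfun k')"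
    by (simp add: plus_bcontfun.rep_eq dot_add_right)
  show "dot (apply_bcontfun (r *\<^sub>R g)) (apply_bcontfun k) = r *\<^sub>R dot (apply_bcontfun g) (apply_bcontfun k)"
    by (simp add: scaleR_bcontfun.rep_eq dot_scale_left)
  show "dot (apply_bcontfun g) (apply_bcontfun (r *\<^sub>R k)) = r *\<^sub>R dot (apply_bcontfun g) (apply_bcontfun k)"
    by (simp add: scaleR_bcontfun.rep_eq dot_scale_right)
  show "\<exists>K. \<forall>g k :: config \<Rightarrow>\<^sub>C real. norm (dot (apply_bcontfun g) (apply_bcontfun k)) \<le> norm g * norm k * K"
    by (rule exI[of _ 1]) (simp add: abs_dot_bcontfun_le)
qed

end

section \<open>The exclusion semigroup and its generator\<close>

locale exclusion_dynamics = bernoulli_density +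
  fixes a :: real and n :: nat and S :: "real \<Rightarrow> (config \<Rightarrow>\<^sub>C real) \<Rightarrow> (config \<Rightarrow>\<^sub>C real)"
  assumes semigroup: "exclusion_semigroup a n S"
begin

abbreviation bdot :: "(config \<Rightarrow>\<^sub>C real) \<Rightarrow> (config \<Rightarrow>\<^sub>C real) \<Rightarrow> real" where
  "bdot g k \<equiv> dot (apply_bcontfun g) (apply_bcontfun k)"

interpretation bdot: bounded_bilinear bdot by (rule bounded_bilinear_dot)

lemma bdot_commute: "bdot g k = bdot k g" by (rule dot_commute)

lemma markov: "markov_semigroup S" using semigroup by (simp add: exclusion_semigroup_def)

lemma S_linear: "0 \<le> t \<Longrightarrow> linear (S t)" using markov by (simp add: markov_semigroup_def)

lemma S_0 [simp]: "S 0 g = g" using markov by (simp add: markov_semigroup_def)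

lemma S_add: "0 \<le> s \<Longrightarrow> 0 \<le> t \<Longrightarrow> S (s + t) g = S s (S t g)"
  using markov by (simp add: markov_semigroup_def)

lemma S_one: "0 \<le> t \<Longrightarrow> S t (const_bcontfun 1) = const_bcontfun 1"
  using markov by (simp add: markov_semigroup_def)

lemma S_pos: "0 \<le> t \<Longrightarrow> (\<And>\<eta>. 0 \<le> apply_bcontfun g \<eta>) \<Longrightarrow> 0 \<le> apply_bcontfun (S t g) \<eta>"
  using markov by (simp add: markov_semigroup_def)

lemma S_right_continuous: "0 \<le> t \<Longrightarrow> ((\<lambda>s. S s g) \<longlongrightarrow> S t g) (at_right t)"
  using markov by (simp add: markov_semigroup_def)

text \<open>Positivity is applied to \<open>norm g \<plusminus> g\<close>, and constants are preserved.\<close>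

lemma S_contraction:
  assumes t: "0 \<le> t" shows "norm (S t g) \<le> norm g"
proof (rule norm_bound)
  fix \<eta>
  have c: "const_bcontfun (norm g) = norm g *\<^sub>R (const_bcontfun 1 :: config \<Rightarrow>\<^sub>C real)"
    by (rule bcontfun_eqI) (simp add: scaleR_bcontfun.rep_eq)
  have Sc: "S t (const_bcontfun (norm g)) = const_bcontfun (norm g)"
    unfolding c linear_scale[OF S_linear[OF t]] S_one[OF t] ..
  have b: "- norm g \<le> apply_bcontfun g \<xi>" "apply_bcontfun g \<xi> \<le> norm g" for \<xi>
    using norm_bounded[of g \<xi>] by (auto simp: abs_le_iff)
  have "0 \<le> apply_bcontfun (S t (const_bcontfun (norm g) - g)) \<eta>"
    by (rule S_pos[OF t]) (simp add: minus_bcontfun.rep_eq b)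
  moreover have "0 \<le> apply_bcontfun (S t (const_bcontfun (norm g) + g)) \<eta>"
  proof (rule S_pos[OF t])
    show "0 \<le> apply_bcontfun (const_bcontfun (norm g) + g) \<xi>" for \<xi>
      using b(1)[of \<xi>] by (simp add: plus_bcontfun.rep_eq)
  qed
  ultimately show "norm (apply_bcontfun (S t g) \<eta>) \<le> norm g"
    by (simp add: linear_diff[OF S_linear[OF t]] linear_add[OF S_linear[OF t]] Sc minus_bcontfun.rep_eq plus_bcontfun.rep_eq)
qed

lemma S_diff: "0 \<le> t \<Longrightarrow> S t (g - k) = S t g - S t k"
  by (rule linear_diff[OF S_linear])

abbreviation generator :: "((config \<Rightarrow>\<^sub>C real) \<times> (config \<Rightarrow>\<^sub>C real)) set" where
  "generator \<equiv> generator_graph S"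

lemma generatorD: "(g, k) \<in> generator \<Longrightarrow> ((\<lambda>t. (S t g - g) /\<^sub>R t) \<longlongrightarrow> k) (at_right 0)"
  by (simp add: generator_graph_def)

lemma generatorI: "((\<lambda>t. (S t g - g) /\<^sub>R t) \<longlongrightarrow> k) (at_right 0) \<Longrightarrow> (g, k) \<in> generator"
  by (simp add: generator_graph_def)

lemma eventually_at_right_0_pos: "\<forall>\<^sub>F t in at_right (0::real). 0 < t"
  by (simp add: eventually_at_right_less)

lemma generator_zero: "(0, 0) \<in> generator"
proof (rule generatorI)
  have "\<forall>\<^sub>F t in at_right (0::real). (S t 0 - 0) /\<^sub>R t = 0"
    using eventually_at_right_0_pos by eventually_elim (simp add: linear_0[OF S_linear])
  then show "((\<lambda>t. (S t 0 - 0) /\<^sub>R t) \<longlongrightarrow> 0) (at_right 0)" by (rule tendsto_eventually)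
qed

lemma generator_add:
  assumes "(g, k) \<in> generator" "(g', k') \<in> generator" shows "(g + g', k + k') \<in> generator"
proof (rule generatorI, rule Lim_transform_eventually)
  show "((\<lambda>t. (S t g - g) /\<^sub>R t + (S t g' - g') /\<^sub>R t) \<longlongrightarrow> k + k') (at_right 0)"
    by (intro tendsto_add generatorD assms)
  show "\<forall>\<^sub>F t in at_right 0. (S t g - g) /\<^sub>R t + (S t g' - g') /\<^sub>R t = (S t (g + g') - (g + g')) /\<^sub>R t"
    using eventually_at_right_0_pos by eventually_elim (simp add: linear_add[OF S_linear] scaleR_right_diff_distrib scaleR_right_distrib)
qed

lemma generator_scale:
  assumes "(g, k) \<in> generator" shows "(r *\<^sub>R g, r *\<^sub>R k) \<in> generator"
proof (rule generatorI, rule Lim_transform_eventually)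
  show "((\<lambda>t. r *\<^sub>R ((S t g - g) /\<^sub>R t)) \<longlongrightarrow> r *\<^sub>R k) (at_right 0)"
    by (intro tendsto_scaleR tendsto_const generatorD assms)
  show "\<forall>\<^sub>F t in at_right 0. r *\<^sub>R ((S t g - g) /\<^sub>R t) = (S t (r *\<^sub>R g) - r *\<^sub>R g) /\<^sub>R t"
    using eventually_at_right_0_pos
    by eventually_elim (simp add: linear_scale[OF S_linear] scaleR_right_diff_distrib mult.commute)
qed

lemma generator_sum:
  assumes "\<And>i. i \<in> I \<Longrightarrow> (g i, k i) \<in> generator" shows "(\<Sum>i\<in>I. g i, \<Sum>i\<in>I. k i) \<in> generator"
  using assms
proof (induction I rule: infinite_finite_induct)
  case (insert i I)
  then show ?case using generator_add[of "g i" "k i"] by simp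
qed (auto simp: generator_zero)

lemma generator_tendsto_zero:
  assumes "(g, k) \<in> generator" shows "((\<lambda>h. (S h g - g) /\<^sub>R h - k) \<longlongrightarrow> 0) (at_right 0)"
  using tendsto_diff[OF generatorD[OF assms] tendsto_const[of k]] by simp

lemma generator_S:
  assumes gk: "(g, k) \<in> generator" and t: "0 \<le> t" shows "(S t g, S t k) \<in> generator"
proof (rule generatorI)
  have "((\<lambda>h. (S h (S t g) - S t g) /\<^sub>R h - S t k) \<longlongrightarrow> 0) (at_right 0)"
  proof (rule Lim_null_comparison[OF _ tendsto_norm_zero[OF generator_tendsto_zero[OF gk]]])
    show "\<forall>\<^sub>F h in at_right 0. norm ((S h (S t g) - S t g) /\<^sub>R h - S t k) \<le> norm ((S h g - g) /\<^sub>R h - k)"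
      using eventually_at_right_0_pos
    proof eventually_elim
      case (elim h)
      have "(S h (S t g) - S t g) /\<^sub>R h - S t k = S t ((S h g - g) /\<^sub>R h - k)"
        using elim t S_add[of h t g] S_add[of t h g]
        by (simp add: S_diff linear_scale[OF S_linear[OF t]] add.commute)
      then show ?case using S_contraction[OF t] by simp
    qed
  qed
  then show "((\<lambda>h. (S h (S t g) - S t g) /\<^sub>R h) \<longlongrightarrow> S t k) (at_right 0)" by (rule LIM_zero_cancel)
qed

text \<open>The generator gives the derivative from the right. For the left one, \<open>S t\<close> is split as \<open>S (t - h) \<circ> S h\<close> and the
  contraction \<open>S (t - h)\<close> is dropped.\<close>

lemma S_has_vector_derivative:
  assumes gk: "(g, k) \<in> generator" and t: "0 < t"
  shows "((\<lambda>s. S s g) has_vector_derivative S t k) (at t)"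
proof -
  have right: "((\<lambda>h. (S (t + h) g - S t g) /\<^sub>R h) \<longlongrightarrow> S t k) (at_right 0)"
  proof (rule Lim_transform_eventually[OF generatorD[OF generator_S[OF gk]]])
    show "0 \<le> t" using t by simp
    show "\<forall>\<^sub>F h in at_right 0. (S h (S t g) - S t g) /\<^sub>R h = (S (t + h) g - S t g) /\<^sub>R h"
      using eventually_at_right_0_pos by eventually_elim (use t in \<open>simp add: S_add[symmetric] add.commute\<close>)
  qed
  have left: "((\<lambda>h. (S (t + h) g - S t g) /\<^sub>R h) \<longlongrightarrow> S t k) (at_left 0)"
  proof -
    have "((\<lambda>h. (S (t + - h) g - S t g) /\<^sub>R (- h) - S t k) \<longlongrightarrow> 0) (at_right 0)"
    proof (rule Lim_null_comparison)
      show "((\<lambda>h. norm ((S h g - g) /\<^sub>R h - k) + norm (S h k - k)) \<longlongrightarrow> 0) (at_right 0)"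
      proof -
        have "((\<lambda>h. S h k) \<longlongrightarrow> k) (at_right 0)" using S_right_continuous[of 0 k] by simp
        then have "((\<lambda>h. S h k - k) \<longlongrightarrow> 0) (at_right 0)" by (rule LIM_zero)
        from tendsto_add[OF tendsto_norm_zero[OF generator_tendsto_zero[OF gk]] tendsto_norm_zero[OF this]]
        show ?thesis by simp
      qed
      have "\<forall>\<^sub>F h in at_right 0. h < t" using t by (auto simp: eventually_at_right_field)
      then show "\<forall>\<^sub>F h in at_right 0. norm ((S (t + - h) g - S t g) /\<^sub>R (- h) - S t k) \<le> norm ((S h g - g) /\<^sub>R h - k) + norm (S h k - k)"
        using eventually_at_right_0_pos
      proof eventually_elim
        case (elim h)
        then have th: "0 \<le> t - h" and h: "0 \<le> h" by auto
        have Sth: "S t g' = S (t - h) (S h g')" for g' using S_add[OF th h, of g'] by simp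
        have "(S (t + - h) g - S t g) /\<^sub>R (- h) - S t k = S (t - h) (((S h g - g) /\<^sub>R h - k) - (S h k - k))"
          using elim by (simp add: Sth S_diff[OF th] linear_scale[OF S_linear[OF th]] scaleR_right_diff_distrib)
        also have "norm \<dots> \<le> norm (((S h g - g) /\<^sub>R h - k) - (S h k - k))" by (rule S_contraction[OF th])
        also have "\<dots> \<le> norm ((S h g - g) /\<^sub>R h - k) + norm (S h k - k)" by (rule norm_triangle_ineq4)
        finally show ?case .
      qed
    qed
    then have "((\<lambda>h. (S (t + - h) g - S t g) /\<^sub>R (- h)) \<longlongrightarrow> S t k) (at_right 0)" by (rule LIM_zero_cancel)
    then show ?thesis by (subst filterlim_at_left_to_right) simp
  qed
  have "((\<lambda>h. (S (t + h) g - S t g) /\<^sub>R h) \<longlongrightarrow> S t k) (at 0)"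
    by (rule filterlim_split_at[OF left right])
  then have lim: "((\<lambda>h. norm ((S (t + h) g - S t g) /\<^sub>R h - S t k)) \<longlongrightarrow> 0) (at 0)"
    by (intro tendsto_norm_zero LIM_zero)
  have "((\<lambda>h. norm (S (t + h) g - S t g - h *\<^sub>R S t k) / norm h) \<longlongrightarrow> 0) (at 0)"
  proof (rule Lim_transform_eventually[OF lim])
    have "norm ((S (t + h) g - S t g) /\<^sub>R h - S t k) = norm (S (t + h) g - S t g - h *\<^sub>R S t k) / norm h"
      if "h \<noteq> 0" for h
    proof -
      have "(S (t + h) g - S t g) /\<^sub>R h - S t k = (S (t + h) g - S t g - h *\<^sub>R S t k) /\<^sub>R h"
        using that by (simp add: scaleR_right_diff_distrib)
      then show ?thesis by (simp add: divide_inverse mult.commute)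
    qed
    then show "\<forall>\<^sub>F h in at 0. norm ((S (t + h) g - S t g) /\<^sub>R h - S t k) = norm (S (t + h) g - S t g - h *\<^sub>R S t k) / norm h"
      by (auto simp: eventually_at_filter)
  qed
  then show ?thesis
    unfolding has_vector_derivative_def has_derivative_at by (simp add: bounded_linear_scaleR_left)
qed

end

section \<open>A Kipnis--Varadhan inequality in discrete time\<close>

context exclusion_dynamics
begin

interpretation bdot: bounded_bilinear bdot by (rule bounded_bilinear_dot)

text \<open>The generator is the closure of its restriction to local functions, so closed conditions need only be checked there.\<close>

lemma generator_subset:
  assumes "closed C"
    and "\<And>g k. local_function (apply_bcontfun g) \<Longrightarrow>
      (\<And>\<eta>. apply_bcontfun k \<eta> = (real n)\<^sup>2 * exclusion_operator a n (apply_bcontfun g) \<eta>) \<Longrightarrow> (g, k) \<in> C"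
  shows "generator \<subseteq> C"
proof -
  have eq: "generator = closure {(g, k). local_function (apply_bcontfun g) \<and>
      (\<forall>\<eta>. apply_bcontfun k \<eta> = (real n)\<^sup>2 * exclusion_operator a n (apply_bcontfun g) \<eta>)}"
    using semigroup by (simp add: exclusion_semigroup_def)
  show ?thesis unfolding eq by (rule closure_minimal) (use assms in auto)
qed

lemma local_function_in_generator:
  assumes "local_function g"
  obtains k where "(Bcontfun g, k) \<in> generator"
proof -
  let ?k = "\<lambda>\<eta>. (real n)\<^sup>2 * exclusion_operator a n g \<eta>"
  have "local_function ?k"
    using local_function_exclusion_operator[OF assms, of a n] unfolding local_function_def supported_in_def by metis
  then have k: "apply_bcontfun (Bcontfun ?k) = ?k" by (intro Bcontfun_inverse local_function_bcontfun)
  have g: "apply_bcontfun (Bcontfun g) = g" by (intro Bcontfun_inverse local_function_bcontfun assms)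
  have "(Bcontfun g, Bcontfun ?k) \<in> closure {(g, k). local_function (apply_bcontfun g) \<and>
      (\<forall>\<eta>. apply_bcontfun k \<eta> = (real n)\<^sup>2 * exclusion_operator a n (apply_bcontfun g) \<eta>)}"
    using assms g k by (intro subsetD[OF closure_subset]) auto
  then show ?thesis using semigroup that by (auto simp: exclusion_semigroup_def)
qed

lemma generator_mean_zero:
  assumes "(g, k) \<in> generator" shows "bdot (const_bcontfun 1) k = 0"
proof -
  have "generator \<subseteq> {gk. bdot (const_bcontfun 1) (snd gk) = 0}"
  proof (rule generator_subset)
    show "closed {gk. bdot (const_bcontfun 1) (snd gk) = 0}"
      by (intro closed_Collect_eq bdot.continuous_on continuous_intros)
    fix g k assume g: "local_function (apply_bcontfun g)"
      and k: "\<And>\<eta>. apply_bcontfun k \<eta> = (real n)\<^sup>2 * exclusion_operator a n (apply_bcontfun g) \<eta>"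
    have "apply_bcontfun k = (\<lambda>\<eta>. (real n)\<^sup>2 * exclusion_operator a n (apply_bcontfun g) \<eta>)" using k by auto
    moreover have "apply_bcontfun (const_bcontfun 1) = (\<lambda>_::config. 1::real)" by auto
    ultimately show "(g, k) \<in> {gk. bdot (const_bcontfun 1) (snd gk) = 0}"
      using integral_exclusion_operator[OF g, of a n] by (simp add: dot_scale_right)
  qed
  then show ?thesis using assms by auto
qed

lemma generator_energy_bound:
  assumes loc: "\<And>g. local_function g \<Longrightarrow> 2 * dot (apply_bcontfun F) g - \<kappa> \<le> - ((real n)\<^sup>2 * dot g (exclusion_operator a n g))"
    and gk: "(g, k) \<in> generator"
  shows "2 * bdot F g - \<kappa> \<le> - bdot g k"
proof -
  have "generator \<subseteq> {gk. 2 * bdot F (fst gk) - \<kappa> \<le> - bdot (fst gk) (snd gk)}"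
  proof (rule generator_subset)
    show "closed {gk. 2 * bdot F (fst gk) - \<kappa> \<le> - bdot (fst gk) (snd gk)}"
      by (intro closed_Collect_le bdot.continuous_on continuous_intros)
    fix g k assume g: "local_function (apply_bcontfun g)"
      and k: "\<And>\<eta>. apply_bcontfun k \<eta> = (real n)\<^sup>2 * exclusion_operator a n (apply_bcontfun g) \<eta>"
    have "apply_bcontfun k = (\<lambda>\<eta>. (real n)\<^sup>2 * exclusion_operator a n (apply_bcontfun g) \<eta>)" using k by auto
    then show "(g, k) \<in> {gk. 2 * bdot F (fst gk) - \<kappa> \<le> - bdot (fst gk) (snd gk)}"
      using loc[OF g] by (simp add: dot_scale_right)
  qed
  then show ?thesis using gk by auto
qed

lemma S_continuous_on:
  assumes gk: "(g, k) \<in> generator" shows "continuous_on {0..b} (\<lambda>t. S t g)"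
  unfolding continuous_on_def
proof
  fix t assume t: "t \<in> {0..b}"
  show "((\<lambda>t. S t g) \<longlongrightarrow> S t g) (at t within {0..b})"
  proof (cases "t = 0")
    case True
    have "((\<lambda>t. S t g) \<longlongrightarrow> S 0 g) (at_right 0)" by (rule S_right_continuous) simp
    then have "((\<lambda>t. S t g) \<longlongrightarrow> S 0 g) (at 0 within {0..})" by (simp add: at_within_Ici_at_right)
    then show ?thesis using True by (auto intro: tendsto_within_subset)
  next
    case False
    then have "isCont (\<lambda>t. S t g) t" using t by (intro has_vector_derivative_continuous[OF S_has_vector_derivative[OF gk]]) auto
    then show ?thesis by (auto simp: isCont_def intro: tendsto_within_subset)
  qed
qed

text \<open>The derivative of the mean of \<open>S u g\<close> is the mean of an element of the range of the generator, which is zero.\<close>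

lemma S_invariant:
  assumes gk: "(g, k) \<in> generator" and t: "0 \<le> t"
  shows "bdot (const_bcontfun 1) (S t g) = bdot (const_bcontfun 1) g"
proof (cases "t = 0")
  case False
  let ?f = "\<lambda>t. bdot (const_bcontfun 1) (S t g)"
  have "?f t = ?f 0"
  proof (rule DERIV_isconst_end[where f="?f" and a=0 and b=t])
    show "0 < t" using t False by simp
    show "continuous_on {0..t} ?f" by (intro bdot.continuous_on continuous_on_const S_continuous_on[OF gk])
    fix u assume u: "0 < u" "u < t"
    have "(?f has_vector_derivative bdot (const_bcontfun 1) (S u k) + bdot 0 (S u g)) (at u)"
      by (intro bdot.has_vector_derivative has_vector_derivative_const S_has_vector_derivative[OF gk u(1)])
    moreover have "bdot (const_bcontfun 1) (S u k) = 0"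
      using generator_mean_zero[OF generator_S[OF gk]] u by simp
    ultimately have "(?f has_vector_derivative 0) (at u)"
      by (simp only: bdot.zero_left add.right_neutral)
    then show "DERIV ?f u :> 0"
      by (simp only: has_real_derivative_iff_has_vector_derivative)
  qed
  then show ?thesis by simp
qed simp

lemma S_increment_le:
  assumes gk: "(g, k) \<in> generator" and t: "0 \<le> t"
  shows "norm (S t g - g) \<le> t * norm k"
proof (cases "t = 0")
  case False
  have "norm (S t g - S 0 g) \<le> t * norm k - 0 * norm k"
  proof (rule differentiable_bound_general[where f'="\<lambda>u. S u k" and \<phi>'="\<lambda>_. norm k"])
    show "0 < t" using t False by simp
    show "continuous_on {0..t} (\<lambda>t. S t g)" by (rule S_continuous_on[OF gk])
    show "continuous_on {0..t} (\<lambda>t. t * norm k)" by (intro continuous_intros)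
    fix u assume u: "0 < u" "u < t"
    show "((\<lambda>t. S t g) has_vector_derivative S u k) (at u)" by (rule S_has_vector_derivative[OF gk u(1)])
    show "((\<lambda>t. t * norm k) has_vector_derivative norm k) (at u)"
      by (auto intro!: derivative_eq_intros simp: has_real_derivative_iff_has_vector_derivative[symmetric])
    show "norm (S u k) \<le> norm k" using u by (intro S_contraction) simp
  qed
  then show ?thesis by simp
qed simp

text \<open>The squared norm of \<open>S u W\<close> has derivative \<open>2 \<langle>S u W, S u W'\<rangle>\<close>, which the energy inequality bounds by
  \<open>2 \<kappa> - 4 \<langle>F, S u W\<rangle>\<close>. Replacing \<open>S u W\<close> by \<open>W\<close> in the last term costs at most \<open>\<delta>\<close> times the norm of \<open>W'\<close>, since \<open>u \<le> \<delta>\<close>.\<close>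

lemma kipnis_varadhan_step:
  assumes energy: "\<And>g k. (g, k) \<in> generator \<Longrightarrow> 2 * bdot F g - \<kappa> \<le> - bdot g k"
    and W: "(W, W') \<in> generator" and d: "0 \<le> \<delta>"
  shows "bdot (S \<delta> W) (S \<delta> W) \<le> bdot W W - 4 * \<delta> * bdot F W + 2 * \<delta> * \<kappa> + 4 * \<delta>\<^sup>2 * (norm F * norm W')"
proof -
  define c where "c = - 4 * bdot F W + 2 * \<kappa> + 4 * (norm F * (\<delta> * norm W'))"
  define f where "f u = bdot (S u W) (S u W) - u * c" for u
  have "f \<delta> \<le> f 0"
  proof (rule DERIV_nonpos_imp_decreasing_open[OF d])
    show "continuous_on {0..\<delta>} f"
      unfolding f_def by (intro continuous_intros bdot.continuous_on S_continuous_on[OF W])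
    fix u assume u: "0 < u" "u < \<delta>"
    have "((\<lambda>u. bdot (S u W) (S u W)) has_vector_derivative bdot (S u W) (S u W') + bdot (S u W') (S u W)) (at u)"
      by (intro bdot.has_vector_derivative S_has_vector_derivative[OF W u(1)])
    then have "((\<lambda>u. bdot (S u W) (S u W)) has_real_derivative 2 * bdot (S u W) (S u W')) (at u)"
      by (simp add: has_real_derivative_iff_has_vector_derivative bdot_commute[of "S u W'"])
    then have der: "(f has_real_derivative 2 * bdot (S u W) (S u W') - c) (at u)"
      unfolding f_def by (auto intro!: derivative_eq_intros)
    have "2 * bdot F (S u W) - \<kappa> \<le> - bdot (S u W) (S u W')"
      using u by (intro energy generator_S[OF W]) simp
    moreover have "bdot F (S u W) \<ge> bdot F W - norm F * (\<delta> * norm W')"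
    proof -
      have "\<bar>bdot F (S u W - W)\<bar> \<le> norm F * norm (S u W - W)" by (rule abs_dot_bcontfun_le)
      also have "\<dots> \<le> norm F * (u * norm W')" using u by (intro mult_left_mono S_increment_le[OF W]) auto
      also have "\<dots> \<le> norm F * (\<delta> * norm W')" using u by (intro mult_left_mono mult_right_mono) auto
      finally show ?thesis unfolding bdot.diff_right by linarith
    qed
    ultimately have "2 * bdot (S u W) (S u W') - c \<le> 0" unfolding c_def by linarith
    with der show "\<exists>y. DERIV f u :> y \<and> y \<le> 0" by blast
  qed
  then show ?thesis by (simp add: f_def c_def algebra_simps power2_eq_square)
qed

text \<open>The discrete solution of the backward equation. The index runs against time: \<open>potential \<delta> F (Suc j)\<close> collects the
  present impulse \<open>\<delta> F j\<close> and, transported by the semigroup, the later impulses \<open>\<delta> F i\<close> with \<open>i < j\<close>.\<close>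

primrec potential :: "real \<Rightarrow> (nat \<Rightarrow> (config \<Rightarrow>\<^sub>C real)) \<Rightarrow> nat \<Rightarrow> (config \<Rightarrow>\<^sub>C real)" where
  "potential \<delta> F 0 = 0"
| "potential \<delta> F (Suc j) = \<delta> *\<^sub>R F j + S \<delta> (potential \<delta> F j)"

lemma potential_generator:
  assumes "\<And>j. (F j, K j) \<in> generator" "0 \<le> \<delta>"
  shows "(potential \<delta> F j, potential \<delta> K j) \<in> generator"
proof (induction j)
  case (Suc j)
  then show ?case using assms by (auto intro!: generator_add generator_scale generator_S)
qed (simp add: generator_zero)

lemma norm_potential_le:
  assumes "\<And>j. norm (K j) \<le> B" "0 \<le> \<delta>"
  shows "norm (potential \<delta> K j) \<le> real j * (\<delta> * B)"
proof (induction j)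
  case (Suc j)
  have "norm (potential \<delta> K (Suc j)) \<le> norm (\<delta> *\<^sub>R K j) + norm (S \<delta> (potential \<delta> K j))"
    using norm_triangle_ineq[of "\<delta> *\<^sub>R K j" "S \<delta> (potential \<delta> K j)"] by simp
  also have "\<dots> \<le> \<delta> * B + real j * (\<delta> * B)"
    using assms Suc S_contraction[OF assms(2), of "potential \<delta> K j"] by (intro add_mono) (auto intro: mult_left_mono)
  finally show ?case by (simp add: algebra_simps)
qed simp

text \<open>The amount by which adding the impulse \<open>\<delta> F j\<close> to the later ones increases the second moment of their sum.\<close>

definition increment :: "real \<Rightarrow> (nat \<Rightarrow> (config \<Rightarrow>\<^sub>C real)) \<Rightarrow> nat \<Rightarrow> real" where
  "increment \<delta> F j = 2 * bdot (\<delta> *\<^sub>R F j) (S \<delta> (potential \<delta> F j)) + bdot (\<delta> *\<^sub>R F j) (\<delta> *\<^sub>R F j)"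

text \<open>The squared norm of \<open>S \<delta> (potential \<delta> F j)\<close> starts at zero and stays nonnegative. In each step it grows by at most the discretised
  \<open>\<kappa>\<close> minus the increment, so the increments add up to at most the total of the \<open>\<kappa>\<close> terms. The last term is of order \<open>\<delta>\<close> when \<open>N \<delta>\<close> is fixed.\<close>

proposition kipnis_varadhan_discrete:
  assumes d: "0 \<le> \<delta>" and FK: "\<And>j. (F j, K j) \<in> generator"
    and energy: "\<And>j g k. (g, k) \<in> generator \<Longrightarrow> 2 * bdot (F j) g - \<kappa> \<le> - bdot g k"
    and B: "\<And>j. norm (F j) \<le> B" "\<And>j. norm (K j) \<le> B'"
  shows "(\<Sum>j<N. increment \<delta> F j) \<le> real N * (2 * \<delta> * \<kappa> + 4 * \<delta>\<^sup>2 * (B * (real N * (\<delta> * B'))))"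
proof -
  let ?W = "potential \<delta> F"
  have B0: "0 \<le> B" "0 \<le> B'" using B[of 0] norm_ge_zero order_trans by blast+
  have "bdot (S \<delta> (?W j)) (S \<delta> (?W j)) + (\<Sum>i<j. increment \<delta> F i)
      \<le> real j * (2 * \<delta> * \<kappa> + 4 * \<delta>\<^sup>2 * (B * (real N * (\<delta> * B'))))" if "j \<le> N" for j
    using that
  proof (induction j)
    case 0
    show ?case by (simp add: linear_0[OF S_linear[OF d]] dot_def)
  next
    case (Suc j)
    let ?u = "\<delta> *\<^sub>R F j" and ?v = "S \<delta> (?W j)"
    have step: "bdot (S \<delta> (?W (Suc j))) (S \<delta> (?W (Suc j))) \<le> bdot (?W (Suc j)) (?W (Suc j))
      - 4 * \<delta> * bdot (F j) (?W (Suc j)) + 2 * \<delta> * \<kappa> + 4 * \<delta>\<^sup>2 * (norm (F j) * norm (potential \<delta> K (Suc j)))"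
      by (rule kipnis_varadhan_step[OF energy potential_generator[OF FK d] d])
    have e: "bdot (?W (Suc j)) (?W (Suc j)) = bdot ?v ?v + increment \<delta> F j"
      unfolding increment_def potential.simps bdot.add_left bdot.add_right bdot_commute[of ?v ?u] by linarith
    have "increment \<delta> F j \<le> 2 * bdot ?u (?W (Suc j))"
    proof -
      have "2 * y + x \<le> 2 * (x + y)" if "0 \<le> x" for x y :: real using that by simp
      from this[OF dot_self_nonneg] show ?thesis
        unfolding increment_def potential.simps bdot.add_right .
    qed
    also have "\<dots> = 2 * (\<delta> * bdot (F j) (?W (Suc j)))" by (simp only: bdot.scaleR_left real_scaleR_def)
    finally have p: "2 * increment \<delta> F j \<le> 4 * \<delta> * bdot (F j) (?W (Suc j))" by simp
    have "norm (F j) * norm (potential \<delta> K (Suc j)) \<le> B * (real N * (\<delta> * B'))"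
    proof (intro mult_mono B B0)
      have "norm (potential \<delta> K (Suc j)) \<le> real (Suc j) * (\<delta> * B')" by (rule norm_potential_le[OF B(2) d])
      also have "\<dots> \<le> real N * (\<delta> * B')" using Suc.prems d B0 by (intro mult_right_mono) auto
      finally show "norm (potential \<delta> K (Suc j)) \<le> real N * (\<delta> * B')" .
    qed simp
    then have err: "4 * \<delta>\<^sup>2 * (norm (F j) * norm (potential \<delta> K (Suc j))) \<le> 4 * \<delta>\<^sup>2 * (B * (real N * (\<delta> * B')))"
      by (intro mult_left_mono) auto
    have "bdot (S \<delta> (?W (Suc j))) (S \<delta> (?W (Suc j))) \<le> bdot ?v ?v - increment \<delta> F j + (2 * \<delta> * \<kappa> + 4 * \<delta>\<^sup>2 * (B * (real N * (\<delta> * B'))))"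
      using step e p err by linarith
    moreover have "bdot ?v ?v + (\<Sum>i<j. increment \<delta> F i) \<le> real j * (2 * \<delta> * \<kappa> + 4 * \<delta>\<^sup>2 * (B * (real N * (\<delta> * B'))))"
      using Suc by simp
    moreover have "b' + (s + p) \<le> (1 + x) * E" if "b' \<le> b - p + E" "b + s \<le> x * E" for b b' s p x E :: real
      using that by (simp add: algebra_simps)
    ultimately show ?case unfolding sum.lessThan_Suc of_nat_Suc by blast
  qed
  from this[of N] show ?thesis using dot_self_nonneg[of "apply_bcontfun (S \<delta> (?W N))"] by linarith
qed

lemma potential_eq_sum:
  assumes "0 \<le> \<delta>"
  shows "S \<delta> (potential \<delta> F j) = (\<Sum>i<j. \<delta> *\<^sub>R S (real (j - i) * \<delta>) (F i))"
proof (induction j)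
  case 0
  show ?case by (simp add: linear_0[OF S_linear[OF assms]])
next
  case (Suc j)
  have "S \<delta> (S \<delta> (potential \<delta> F j)) = (\<Sum>i<j. \<delta> *\<^sub>R S (real (Suc j - i) * \<delta>) (F i))"
    unfolding Suc linear_sum[OF S_linear[OF assms]]
  proof (rule sum.cong[OF refl])
    fix i assume "i \<in> {..<j}"
    then have "real (Suc j - i) * \<delta> = \<delta> + real (j - i) * \<delta>" by (simp add: of_nat_diff algebra_simps)
    then show "S \<delta> (\<delta> *\<^sub>R S (real (j - i) * \<delta>) (F i)) = \<delta> *\<^sub>R S (real (Suc j - i) * \<delta>) (F i)"
      using assms by (simp add: linear_scale[OF S_linear[OF assms]] S_add[OF assms])
  qed
  then show ?case
    by (simp add: linear_add[OF S_linear[OF assms]] linear_scale[OF S_linear[OF assms]] add.commute)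
qed

end

section \<open>The stationary process\<close>

locale exclusion_path = exclusion_dynamics +
  fixes M :: "'w measure" and X :: "real \<Rightarrow> 'w \<Rightarrow> config"
  assumes markov_process: "markov_process S M X"
    and initial: "distr M config_algebra (X 0) = bernoulli_measure \<rho>"
begin

interpretation bdot: bounded_bilinear bdot by (rule bounded_bilinear_dot)

sublocale path: prob_space M using markov_process by (simp add: markov_process_def)

lemma X_measurable: "0 \<le> s \<Longrightarrow> X s \<in> measurable M config_algebra"
  using markov_process by (simp add: markov_process_def)

lemma X_right_continuous: "\<omega> \<in> space M \<Longrightarrow> 0 \<le> s \<Longrightarrow> ((\<lambda>u. X u \<omega>) \<longlongrightarrow> X s \<omega>) (at_right s)"
  using markov_process by (simp add: markov_process_def)

lemma observable_measurable:
  assumes "bounded_meas g" "0 \<le> s" shows "(\<lambda>\<omega>. g (X s \<omega>)) \<in> borel_measurable M"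
  using measurable_compose[OF X_measurable[OF assms(2)] bounded_meas_measurable[OF assms(1)]] .

lemma observable_mult_integrable:
  assumes "bounded_meas g" "bounded_meas k" "0 \<le> s" "0 \<le> t"
  shows "integrable M (\<lambda>\<omega>. g (X s \<omega>) * k (X t \<omega>))"
proof -
  from assms obtain B C where BC: "\<forall>\<eta>. \<bar>g \<eta>\<bar> \<le> B" "\<forall>\<eta>. \<bar>k \<eta>\<bar> \<le> C" by (auto simp: bounded_meas_def)
  then have "\<bar>g \<eta> * k \<xi>\<bar> \<le> B * C" for \<eta> \<xi>
    unfolding abs_mult by (intro mult_mono) (auto intro: order_trans[OF abs_ge_zero])
  then show ?thesis
    using observable_measurable[OF assms(1,3)] observable_measurable[OF assms(2,4)]
    by (intro path.integrable_const_bound[where B="B * C"]) auto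
qed

text \<open>The Markov property, tested against an observable at time \<open>s\<close>, which is measurable for the past up to \<open>s\<close>.\<close>

lemma two_time_correlation:
  assumes g: "bounded_meas g" and s: "0 \<le> s" and t: "0 \<le> t"
  shows "(\<integral>\<omega>. g (X s \<omega>) * apply_bcontfun k (X (s + t) \<omega>) \<partial>M)
    = (\<integral>\<omega>. g (X s \<omega>) * apply_bcontfun (S t k) (X s \<omega>) \<partial>M)"
proof -
  let ?G = "\<Union>r\<in>{0..s}. {X r -` A \<inter> space M |A. A \<in> sets config_algebra}"
  let ?F = "natural_filtration M X s"
  have sub: "?G \<subseteq> sets M" using measurable_sets[OF X_measurable] by auto
  have Fsets: "sets ?F = sigma_sets (space M) ?G" and Fspace: "space ?F = space M"
    unfolding natural_filtration_def using sub sets.sets_into_space by (auto intro!: sets_measure_of space_measure_of)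
  have "subalgebra M ?F"
    unfolding subalgebra_def Fspace Fsets using sets.sigma_sets_subset[OF sub] by simp
  then interpret fs: finite_measure_subalgebra M ?F by unfold_locales
  have Xs: "X s \<in> measurable ?F config_algebra"
  proof (rule measurableI)
    fix A assume "A \<in> sets config_algebra"
    then have "X s -` A \<inter> space M \<in> {X s -` A \<inter> space M |A. A \<in> sets config_algebra}" by blast
    then have "X s -` A \<inter> space M \<in> ?G" using s by (intro UN_I[of s]) simp_all
    then show "X s -` A \<inter> space ?F \<in> sets ?F" unfolding Fsets Fspace by (rule sigma_sets.Basic)
  qed simp
  have gX: "(\<lambda>\<omega>. g (X s \<omega>)) \<in> borel_measurable ?F"
    by (rule measurable_compose[OF Xs bounded_meas_measurable[OF g]])
  have kX: "(\<lambda>\<omega>. apply_bcontfun k (X (s + t) \<omega>)) \<in> borel_measurable M"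
    using s t by (intro observable_measurable) auto
  have "(\<integral>\<omega>. g (X s \<omega>) * apply_bcontfun k (X (s + t) \<omega>) \<partial>M)
    = (\<integral>\<omega>. g (X s \<omega>) * real_cond_exp M ?F (\<lambda>\<omega>. apply_bcontfun k (X (s + t) \<omega>)) \<omega> \<partial>M)"
    using s t by (intro fs.real_cond_exp_intg(2)[symmetric] gX kX observable_mult_integrable g) auto
  also have "\<dots> = (\<integral>\<omega>. g (X s \<omega>) * apply_bcontfun (S t k) (X s \<omega>) \<partial>M)"
  proof (rule integral_cong_AE)
    have "AE \<omega> in M. real_cond_exp M ?F (\<lambda>\<omega>. apply_bcontfun k (X (s + t) \<omega>)) \<omega> = apply_bcontfun (S t k) (X s \<omega>)"
      using markov_process s t by (simp add: markov_process_def)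
    then show "AE \<omega> in M. g (X s \<omega>) * real_cond_exp M ?F (\<lambda>\<omega>. apply_bcontfun k (X (s + t) \<omega>)) \<omega>
        = g (X s \<omega>) * apply_bcontfun (S t k) (X s \<omega>)"
      by eventually_elim simp
  qed (use observable_measurable[OF g s] observable_measurable[OF bcontfun_bounded_meas s] in \<open>auto intro!: borel_measurable_times\<close>)
  finally show ?thesis .
qed

text \<open>Indicators of cylinder sets are local functions, and for those the mean is constant in time.\<close>

lemma law_X:
  assumes s: "0 \<le> s" shows "distr M config_algebra (X s) = \<nu>"
proof -
  have loc: "(\<integral>\<omega>. g (X s \<omega>) \<partial>M) = (\<integral>\<eta>. g \<eta> \<partial>\<nu>)" if g: "local_function g" for g
  proof -
    \<comment> \<open>Local functions lie in the domain, where the mean is known to be constant.\<close>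
    obtain k where k: "(Bcontfun g, k) \<in> generator" using local_function_in_generator[OF g] .
    have ag: "apply_bcontfun (Bcontfun g) = g" by (intro Bcontfun_inverse local_function_bcontfun g)
    have "(\<integral>\<omega>. g (X s \<omega>) \<partial>M) = (\<integral>\<omega>. apply_bcontfun (S s (Bcontfun g)) (X 0 \<omega>) \<partial>M)"
      using two_time_correlation[OF bounded_meas_const[of 1], of 0 s "Bcontfun g"] s ag by simp
    also have "\<dots> = (\<integral>\<eta>. apply_bcontfun (S s (Bcontfun g)) \<eta> \<partial>distr M config_algebra (X 0))"
      by (rule integral_distr[symmetric, OF X_measurable]) (auto intro: bounded_meas_measurable)
    also have "\<dots> = bdot (const_bcontfun 1) (S s (Bcontfun g))" unfolding initial by (simp add: dot_def)
    also have "\<dots> = bdot (const_bcontfun 1) (Bcontfun g)" by (rule S_invariant[OF k s])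
    also have "\<dots> = (\<integral>\<eta>. g \<eta> \<partial>\<nu>)" by (simp add: dot_def ag)
    finally show ?thesis .
  qed
  have "prob_space (distr M config_algebra (X s))" by (rule path.prob_space_distr[OF X_measurable[OF s]])
  then interpret d: prob_space "distr M config_algebra (X s)" .
  show ?thesis
  proof (rule measure_eqI_PiM_infinite[where I=UNIV and M="\<lambda>_. count_space UNIV"])
    show "sets (distr M config_algebra (X s)) = sets (Pi\<^sub>M UNIV (\<lambda>_. count_space UNIV))"
      by (simp add: config_algebra_def)
    show "sets \<nu> = sets (Pi\<^sub>M UNIV (\<lambda>_. count_space UNIV))" by (simp add: config_algebra_def)
    show "finite_measure (distr M config_algebra (X s))" by (rule d.finite_measure_axioms)
    fix A :: "int \<Rightarrow> bool set" and J :: "int set"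
    assume J: "finite J" and A: "\<And>i. i \<in> J \<Longrightarrow> A i \<in> sets (count_space (UNIV :: bool set))"
    let ?E = "prod_emb UNIV (\<lambda>_::int. count_space UNIV) J (Pi\<^sub>E J A)"
    have E: "?E = {\<eta>. \<forall>i\<in>J. \<eta> i \<in> A i}" by (auto simp: prod_emb_def space_PiM PiE_iff extensional_def)
    have Em: "?E \<in> sets config_algebra" unfolding config_algebra_def using J A by (intro sets_PiM_I) auto
    have "supported_in J (indicator ?E)" unfolding E supported_in_def by (auto simp: indicator_def)
    then have "local_function (indicator ?E)" using J unfolding local_function_def by blast
    then have "(\<integral>\<omega>. indicat_real ?E (X s \<omega>) \<partial>M) = (\<integral>\<eta>. indicat_real ?E \<eta> \<partial>\<nu>)" by (rule loc)
    moreover have "(\<integral>\<omega>. indicat_real ?E (X s \<omega>) \<partial>M) = (\<integral>\<eta>. indicat_real ?E \<eta> \<partial>distr M config_algebra (X s))"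
      using Em by (intro integral_distr[symmetric, OF X_measurable[OF s]]) auto
    ultimately have "measure (distr M config_algebra (X s)) ?E = measure \<nu> ?E" using Em by simp
    then show "emeasure (distr M config_algebra (X s)) ?E = emeasure \<nu> ?E"
      by (simp add: d.emeasure_eq_measure emeasure_eq_measure)
  qed
qed

lemma expectation_X:
  assumes "bounded_meas g" "0 \<le> s" shows "(\<integral>\<omega>. g (X s \<omega>) \<partial>M) = (\<integral>\<eta>. g \<eta> \<partial>\<nu>)"
  using integral_distr[OF X_measurable[OF assms(2)], of g] law_X[OF assms(2)] bounded_meas_measurable[OF assms(1)]
  by simp

lemma correlation_X:
  assumes s: "0 \<le> s" and t: "0 \<le> t"
  shows "(\<integral>\<omega>. apply_bcontfun g (X s \<omega>) * apply_bcontfun k (X (s + t) \<omega>) \<partial>M) = bdot g (S t k)"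
  unfolding two_time_correlation[OF bcontfun_bounded_meas s t] dot_def
  by (rule expectation_X[OF bounded_meas_mult[OF bcontfun_bounded_meas bcontfun_bounded_meas] s])

text \<open>The impulse with index \<open>i\<close> acts at time \<open>(N - i) \<delta>\<close>, in accordance with the reversed order in \<open>potential\<close>.\<close>

lemma second_moment_increment_sum:
  assumes d: "0 \<le> \<delta>"
  shows "(\<integral>\<omega>. (\<Sum>i<N. \<delta> * apply_bcontfun (F i) (X (real (N - i) * \<delta>) \<omega>))\<^sup>2 \<partial>M) = (\<Sum>j<N. increment \<delta> F j)"
proof -
  let ?r = "\<lambda>i. real (N - i) * \<delta>"
  let ?Y = "\<lambda>i \<omega>. \<delta> * apply_bcontfun (F i) (X (?r i) \<omega>)"
  have r: "0 \<le> ?r i" for i using d by simp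
  have int: "integrable M (\<lambda>\<omega>. ?Y i \<omega> * ?Y j \<omega>)" for i j
  proof -
    have "integrable M (\<lambda>\<omega>. (\<delta> * \<delta>) * (apply_bcontfun (F i) (X (?r i) \<omega>) * apply_bcontfun (F j) (X (?r j) \<omega>)))"
      by (intro integrable_mult_right observable_mult_integrable r) auto
    then show ?thesis by (simp add: mult_ac)
  qed
  have cor: "(\<integral>\<omega>. ?Y j \<omega> * ?Y i \<omega> \<partial>M) = bdot (\<delta> *\<^sub>R F j) (\<delta> *\<^sub>R S (real (j - i) * \<delta>) (F i))" if "i \<le> j" "j \<le> N" for i j
  proof -
    have "?r i = ?r j + real (j - i) * \<delta>" using that by (simp add: of_nat_diff algebra_simps)
    then have "(\<integral>\<omega>. apply_bcontfun (F j) (X (?r j) \<omega>) * apply_bcontfun (F i) (X (?r i) \<omega>) \<partial>M) = bdot (F j) (S (real (j - i) * \<delta>) (F i))"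
      using correlation_X[of "?r j" "real (j - i) * \<delta>" "F j" "F i"] d by simp
    moreover have "(\<integral>\<omega>. ?Y j \<omega> * ?Y i \<omega> \<partial>M) = (\<integral>\<omega>. (\<delta> * \<delta>) * (apply_bcontfun (F j) (X (?r j) \<omega>) * apply_bcontfun (F i) (X (?r i) \<omega>)) \<partial>M)"
      by (intro Bochner_Integration.integral_cong refl) (simp add: mult_ac)
    ultimately show ?thesis by (simp only: bdot.scaleR_left bdot.scaleR_right real_scaleR_def integral_mult_right_zero mult.assoc)
  qed
  have "integrable M (\<lambda>\<omega>. (\<Sum>i<j. ?Y i \<omega>)\<^sup>2) \<and> (\<integral>\<omega>. (\<Sum>i<j. ?Y i \<omega>)\<^sup>2 \<partial>M) = (\<Sum>i<j. increment \<delta> F i)" if "j \<le> N" for j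
    using that
  proof (induction j)
    case (Suc j)
    have sq: "(\<Sum>i<Suc j. ?Y i \<omega>)\<^sup>2 = (\<Sum>i<j. ?Y i \<omega>)\<^sup>2 + (2 * (\<Sum>i<j. ?Y j \<omega> * ?Y i \<omega>) + ?Y j \<omega> * ?Y j \<omega>)" for \<omega>
      by (simp add: power2_eq_square algebra_simps sum_distrib_left)
    have i1: "integrable M (\<lambda>\<omega>. (\<Sum>i<j. ?Y i \<omega>)\<^sup>2)" using Suc by simp
    have i2: "integrable M (\<lambda>\<omega>. 2 * (\<Sum>i<j. ?Y j \<omega> * ?Y i \<omega>))" by (intro integrable_mult_right Bochner_Integration.integrable_sum int)
    have "(\<integral>\<omega>. (\<Sum>i<Suc j. ?Y i \<omega>)\<^sup>2 \<partial>M) = (\<integral>\<omega>. (\<Sum>i<j. ?Y i \<omega>)\<^sup>2 \<partial>M)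
      + ((\<integral>\<omega>. 2 * (\<Sum>i<j. ?Y j \<omega> * ?Y i \<omega>) \<partial>M) + (\<integral>\<omega>. ?Y j \<omega> * ?Y j \<omega> \<partial>M))"
      unfolding sq by (subst Bochner_Integration.integral_add[OF i1 Bochner_Integration.integrable_add[OF i2 int]])
        (simp only: Bochner_Integration.integral_add[OF i2 int])
    also have "(\<integral>\<omega>. 2 * (\<Sum>i<j. ?Y j \<omega> * ?Y i \<omega>) \<partial>M) = 2 * (\<Sum>i<j. \<integral>\<omega>. ?Y j \<omega> * ?Y i \<omega> \<partial>M)"
      by (simp only: integral_mult_right_zero Bochner_Integration.integral_sum[OF int])
    also have "(\<Sum>i<j. \<integral>\<omega>. ?Y j \<omega> * ?Y i \<omega> \<partial>M) = (\<Sum>i<j. bdot (\<delta> *\<^sub>R F j) (\<delta> *\<^sub>R S (real (j - i) * \<delta>) (F i)))"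
      using Suc.prems by (intro sum.cong refl cor) auto
    also have "\<dots> = bdot (\<delta> *\<^sub>R F j) (S \<delta> (potential \<delta> F j))"
      unfolding potential_eq_sum[OF d] by (rule bdot.sum_right[symmetric])
    also have "(\<integral>\<omega>. ?Y j \<omega> * ?Y j \<omega> \<partial>M) = bdot (\<delta> *\<^sub>R F j) (\<delta> *\<^sub>R F j)"
      using cor[of j j] Suc.prems by simp
    also have "(\<integral>\<omega>. (\<Sum>i<j. ?Y i \<omega>)\<^sup>2 \<partial>M) = (\<Sum>i<j. increment \<delta> F i)" using Suc by simp
    finally have "(\<integral>\<omega>. (\<Sum>i<Suc j. ?Y i \<omega>)\<^sup>2 \<partial>M) = (\<Sum>i<Suc j. increment \<delta> F i)"
      by (simp only: sum.lessThan_Suc increment_def)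
    moreover have "integrable M (\<lambda>\<omega>. (\<Sum>i<Suc j. ?Y i \<omega>)\<^sup>2)"
      unfolding sq by (intro Bochner_Integration.integrable_add i1 i2 int)
    ultimately show ?case by blast
  qed simp
  then show ?thesis by blast
qed

end

section \<open>Riemann sums along right-continuous paths\<close>

definition right_endpoint_step :: "real \<Rightarrow> (real \<Rightarrow> real) \<Rightarrow> nat \<Rightarrow> real \<Rightarrow> real" where
  "right_endpoint_step t v N s =
     (\<Sum>k<N. indicator {real k * (t / real N)..<real (Suc k) * (t / real N)} s * v (real (Suc k) * (t / real N)))"

lemma right_endpoint_step_eq:
  assumes t: "0 < t" and N: "0 < N" and s: "0 \<le> s" "s < t"
  obtains u where "s < u" "u \<le> s + t / real N" "right_endpoint_step t v N s = v u"
proof -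
  define \<delta> where "\<delta> = t / real N"
  have d: "0 < \<delta>" using t N by (simp add: \<delta>_def)
  have Nd: "real N * \<delta> = t" using N by (simp add: \<delta>_def)
  define i where "i = nat \<lfloor>s / \<delta>\<rfloor>"
  have f0: "0 \<le> \<lfloor>s / \<delta>\<rfloor>" using s d by simp
  have i1: "real i \<le> s / \<delta>" "s / \<delta> < real i + 1" using f0 by (auto simp: i_def)
  then have i2: "real i * \<delta> \<le> s" "s < real (Suc i) * \<delta>"
    using d by (simp_all add: pos_le_divide_eq pos_divide_less_eq algebra_simps)
  have "real i * \<delta> < real N * \<delta>" using i2 s Nd by linarith
  then have iN: "i < N" using d by simp
  have uniq: "s \<in> {real k * \<delta>..<real (Suc k) * \<delta>} \<longleftrightarrow> k = i" for k
  proof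
    assume k: "s \<in> {real k * \<delta>..<real (Suc k) * \<delta>}"
    then have "real k * \<delta> < real (Suc i) * \<delta>" "real i * \<delta> < real (Suc k) * \<delta>" using i2 by auto
    then have "real k < real (Suc i)" "real i < real (Suc k)" using d by simp_all
    then show "k = i" by linarith
  qed (use i2 in auto)
  have "right_endpoint_step t v N s = (\<Sum>k<N. if k = i then v (real (Suc k) * \<delta>) else 0)"
    unfolding right_endpoint_step_def \<delta>_def[symmetric] indicator_def uniq by (intro sum.cong refl) auto
  also have "\<dots> = v (real (Suc i) * \<delta>)" using iN by simp
  finally have "right_endpoint_step t v N s = v (real (Suc i) * \<delta>)" .
  moreover have "real (Suc i) * \<delta> \<le> s + \<delta>" using i2 by (simp add: algebra_simps)
  ultimately show ?thesis using i2 by (intro that[of "real (Suc i) * \<delta>"]) (auto simp: \<delta>_def)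
qed

text \<open>The evaluation point lies strictly to the right of \<open>s\<close>, so right-continuity of \<open>v\<close> suffices.\<close>

lemma right_endpoint_step_tendsto:
  assumes t: "0 < t" and s: "0 \<le> s" "s < t" and v: "(v \<longlongrightarrow> v s) (at_right s)"
  shows "(\<lambda>N. right_endpoint_step t v N s) \<longlonglongrightarrow> v s"
proof (rule LIMSEQ_I)
  fix e :: real assume e: "0 < e"
  have "\<forall>\<^sub>F u in at_right s. dist (v u) (v s) < e" using v e by (rule tendstoD)
  then obtain b where b: "s < b" "\<And>u. s < u \<Longrightarrow> u < b \<Longrightarrow> dist (v u) (v s) < e"
    by (auto simp: eventually_at_right_field)
  obtain N0 :: nat where N0: "t / (b - s) < real N0" using reals_Archimedean2 by blast
  show "\<exists>no. \<forall>N\<ge>no. norm (right_endpoint_step t v N s - v s) < e"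
  proof (intro exI[of _ "Suc N0"] allI impI)
    fix N assume N: "Suc N0 \<le> N"
    then have "t / (b - s) < real N" "0 < N" using N0 by auto
    then have "t / real N < b - s" using b(1) by (simp add: field_simps)
    moreover obtain u where u: "s < u" "u \<le> s + t / real N" "right_endpoint_step t v N s = v u"
      using right_endpoint_step_eq[OF t \<open>0 < N\<close> s] .
    ultimately show "norm (right_endpoint_step t v N s - v s) < e"
      using b(2)[of u] by (simp add: dist_norm)
  qed
qed

lemma set_integrable_bounded_Ico:
  fixes \<phi> :: "real \<Rightarrow> real"
  assumes "\<phi> \<in> borel_measurable borel" "\<And>s. \<bar>\<phi> s\<bar> \<le> C"
  shows "set_integrable lborel {a..<b} \<phi>"
proof -
  have "emeasure lborel {a..<b} < \<infinity>" by (cases "a \<le> b") simp_all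
  then show ?thesis
    unfolding set_integrable_def using assms
    by (intro integrableI_bounded_set_indicator[where B=C]) auto
qed

lemma right_endpoint_riemann_sums:
  fixes v \<phi> :: "real \<Rightarrow> real"
  assumes t: "0 < t" and phi: "\<phi> \<in> borel_measurable borel" "\<And>s. \<bar>\<phi> s\<bar> \<le> C"
    and v: "\<And>s. 0 \<le> s \<Longrightarrow> (v \<longlongrightarrow> v s) (at_right s)" "\<And>s. \<bar>v s\<bar> \<le> B"
  shows "(\<lambda>N. \<Sum>k<N. (LBINT s:{real k * (t / real N)..<real (Suc k) * (t / real N)}. \<phi> s) * v (real (Suc k) * (t / real N)))
    \<longlonglongrightarrow> (LBINT s:{0..t}. \<phi> s * v s)"
    and "set_integrable lborel {0..t} (\<lambda>s. \<phi> s * v s)"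
proof -
  define w where "w N s = indicator {0..<t} s * (\<phi> s * right_endpoint_step t v N s)" for N s
  have C: "0 \<le> C" "0 \<le> B" using phi(2)[of 0] v(2)[of 0] by linarith+
  have wm: "w N \<in> borel_measurable lborel" for N
    unfolding w_def right_endpoint_step_def using phi(1) by measurable
  have lim: "(\<lambda>N. w N s) \<longlonglongrightarrow> indicator {0..<t} s * (\<phi> s * v s)" for s
  proof (cases "s \<in> {0..<t}")
    case True
    then show ?thesis unfolding w_def using t v(1)[of s]
      by (intro tendsto_mult tendsto_const right_endpoint_step_tendsto) auto
  qed (simp add: w_def)
  have lm: "(\<lambda>s. indicator {0..<t} s * (\<phi> s * v s)) \<in> borel_measurable lborel"
    by (rule borel_measurable_LIMSEQ_real[OF lim wm])
  have bound: "norm (w N s) \<le> indicator {0..t} s * (C * B)" if N: "0 < N" for N s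
  proof (cases "s \<in> {0..<t}")
    case True
    then obtain u where "right_endpoint_step t v N s = v u"
      using right_endpoint_step_eq[OF t N, of s v] by auto
    then show ?thesis using True phi(2)[of s] v(2)[of u] C
      by (simp add: w_def abs_mult) (intro mult_mono, auto)
  qed (use C in \<open>simp add: w_def indicator_def\<close>)
  have bi: "integrable lborel (\<lambda>s. indicator {0..t} s * (C * B))"
    using borel_integrable_atLeastAtMost'[of 0 t "\<lambda>_. C * B"] by (simp add: set_integrable_def)
  have int: "(\<lambda>N. integral\<^sup>L lborel (w (Suc N))) \<longlonglongrightarrow> integral\<^sup>L lborel (\<lambda>s. indicator {0..<t} s * (\<phi> s * v s))"
    and intg: "integrable lborel (\<lambda>s. indicator {0..<t} s * (\<phi> s * v s))"
    using integral_dominated_convergence[OF lm wm bi, of Suc] integrable_dominated_convergence[OF lm wm bi, of Suc] lim bound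
    by (auto simp: LIMSEQ_Suc[OF lim])
  have ae: "AE s in lborel. indicator {0..<t} s * (\<phi> s * v s) = indicator {0..t} s *\<^sub>R (\<phi> s * v s)"
    using AE_lborel_singleton[of t] by eventually_elim (auto simp: indicator_def)
  have lm2: "(\<lambda>s. indicator {0..t} s *\<^sub>R (\<phi> s * v s)) \<in> borel_measurable lborel"
  proof -
    have "(\<lambda>s. indicator {0..t} s *\<^sub>R (\<phi> s * v s)) = (\<lambda>s. indicator {0..<t} s * (\<phi> s * v s) + indicator {t} s * (\<phi> t * v t))"
      using t by (auto simp: fun_eq_iff indicator_def)
    then show ?thesis using lm by simp
  qed
  show "set_integrable lborel {0..t} (\<lambda>s. \<phi> s * v s)"
    unfolding set_integrable_def using intg ae lm lm2 by (subst integrable_cong_AE[symmetric]) auto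
  have eqI: "integral\<^sup>L lborel (\<lambda>s. indicator {0..<t} s * (\<phi> s * v s)) = (LBINT s:{0..t}. \<phi> s * v s)"
    unfolding set_lebesgue_integral_def by (rule integral_cong_AE[OF lm lm2 ae])
  have phii: "set_integrable lborel {a..<b} \<phi>" for a b
    by (rule set_integrable_bounded_Ico[OF phi])
  have sum: "integral\<^sup>L lborel (w N) = (\<Sum>k<N. (LBINT s:{real k * (t / real N)..<real (Suc k) * (t / real N)}. \<phi> s) * v (real (Suc k) * (t / real N)))"
    if "0 < N" for N
  proof -
    let ?I = "\<lambda>k. {real k * (t / real N)..<real (Suc k) * (t / real N)}"
    have sub: "?I k \<subseteq> {0..<t}" if "k < N" for k
    proof -
      have "real (Suc k) * (t / real N) \<le> real N * (t / real N)" using that t by (intro mult_right_mono) auto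
      also have "\<dots> = t" using \<open>0 < N\<close> by simp
      finally show ?thesis using t by auto
    qed
    have absorb: "p * (q * (r * u)) = (r * q) * u" if "p * r = r" for p q r u :: real
    proof -
      have "p * (q * (r * u)) = (p * r) * (q * u)" by (simp only: mult_ac)
      then show ?thesis by (simp only: that mult_ac)
    qed
    have "w N = (\<lambda>s. \<Sum>k<N. (indicator (?I k) s *\<^sub>R \<phi> s) * v (real (Suc k) * (t / real N)))"
    proof
      fix s
      show "w N s = (\<Sum>k<N. (indicator (?I k) s *\<^sub>R \<phi> s) * v (real (Suc k) * (t / real N)))"
        unfolding w_def right_endpoint_step_def sum_distrib_left
      proof (rule sum.cong[OF refl])
        fix k assume "k \<in> {..<N}"
        then have "indicator {0..<t} s * indicator (?I k) s = (indicator (?I k) s :: real)"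
          using sub[of k] by (auto simp: indicator_def)
        then show "indicator {0..<t} s * (\<phi> s * (indicator (?I k) s * v (real (Suc k) * (t / real N))))
          = (indicator (?I k) s *\<^sub>R \<phi> s) * v (real (Suc k) * (t / real N))"
          unfolding real_scaleR_def by (rule absorb)
      qed
    qed
    then show ?thesis
      using phii unfolding set_lebesgue_integral_def set_integrable_def
      by (simp add: Bochner_Integration.integral_sum del: of_nat_Suc)
  qed
  have "(\<lambda>N. \<Sum>k<Suc N. (LBINT s:{real k * (t / real (Suc N))..<real (Suc k) * (t / real (Suc N))}. \<phi> s) * v (real (Suc k) * (t / real (Suc N))))
    \<longlonglongrightarrow> (LBINT s:{0..t}. \<phi> s * v s)"
    using int unfolding eqI sum[OF zero_less_Suc] .
  then show "(\<lambda>N. \<Sum>k<N. (LBINT s:{real k * (t / real N)..<real (Suc k) * (t / real N)}. \<phi> s) * v (real (Suc k) * (t / real N)))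
    \<longlonglongrightarrow> (LBINT s:{0..t}. \<phi> s * v s)" by (rule LIMSEQ_imp_Suc)
qed

text \<open>Jensen's inequality, obtained by pairing the vector of averages with itself and using \<open>2 x y \<le> x\<^sup>2 + y\<^sup>2\<close>.\<close>

lemma interval_average_bound:
  fixes \<phi> :: "'x \<Rightarrow> real \<Rightarrow> real"
  assumes d: "0 < \<delta>" and A: "finite A"
    and phi: "\<And>x. x \<in> A \<Longrightarrow> set_integrable lborel {a..<a + \<delta>} (\<phi> x)"
    and H: "\<And>s. s \<in> {a..<a + \<delta>} \<Longrightarrow> (\<Sum>x\<in>A. (\<phi> x s)\<^sup>2) \<le> H"
  shows "(\<Sum>x\<in>A. ((LBINT s:{a..<a + \<delta>}. \<phi> x s) / \<delta>)\<^sup>2) \<le> H"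
proof -
  let ?I = "{a..<a + \<delta>}"
  define b where "b x = (LBINT s:?I. \<phi> x s) / \<delta>" for x
  define Q where "Q = (\<Sum>x\<in>A. (b x)\<^sup>2)"
  have "\<delta> * Q = (\<Sum>x\<in>A. b x * (LBINT s:?I. \<phi> x s))"
    unfolding Q_def sum_distrib_left using d by (intro sum.cong refl) (simp add: b_def power2_eq_square)
  also have "\<dots> = (LBINT s:?I. \<Sum>x\<in>A. b x * \<phi> x s)"
    using phi A unfolding set_lebesgue_integral_def set_integrable_def
    by (simp add: sum_distrib_left scaleR_sum_right mult.left_commute Bochner_Integration.integral_sum)
  also have "\<dots> \<le> (LBINT s:?I. Q / 2 + H / 2)"
  proof (rule set_integral_mono)
    have "set_integrable lborel ?I (\<lambda>s. b x * \<phi> x s)" if "x \<in> A" for x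
      using phi[OF that] by (rule set_integrable_mult_right)
    then show "set_integrable lborel ?I (\<lambda>s. \<Sum>x\<in>A. b x * \<phi> x s)"
      unfolding set_integrable_def scaleR_sum_right by (rule Bochner_Integration.integrable_sum)
    show "set_integrable lborel ?I (\<lambda>s. Q / 2 + H / 2)"
      by (rule set_integrable_bounded_Ico[where C="\<bar>Q / 2 + H / 2\<bar>"]) auto
    fix s assume s: "s \<in> ?I"
    have "(\<Sum>x\<in>A. b x * \<phi> x s) \<le> (\<Sum>x\<in>A. (b x)\<^sup>2 / 2 + (\<phi> x s)\<^sup>2 / 2)"
    proof (rule sum_mono)
      fix x
      have "0 \<le> (b x - \<phi> x s)\<^sup>2" by simp
      then show "b x * \<phi> x s \<le> (b x)\<^sup>2 / 2 + (\<phi> x s)\<^sup>2 / 2" by (simp add: power2_eq_square algebra_simps)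
    qed
    also have "\<dots> = Q / 2 + (\<Sum>x\<in>A. (\<phi> x s)\<^sup>2) / 2" by (simp add: Q_def sum.distrib sum_divide_distrib)
    also have "\<dots> \<le> Q / 2 + H / 2" using H[OF s] by simp
    finally show "(\<Sum>x\<in>A. b x * \<phi> x s) \<le> Q / 2 + H / 2" .
  qed
  also have "\<dots> = \<delta> * (Q / 2 + H / 2)" using d by (simp add: set_lebesgue_integral_def mult.commute)
  finally have "Q \<le> Q / 2 + H / 2" using d by simp
  then show ?thesis by (simp add: Q_def b_def)
qed

section \<open>Time integrals of finite sums\<close>

context exclusion_path
begin

interpretation bdot: bounded_bilinear bdot by (rule bounded_bilinear_dot)

lemma local_observable_right_continuous:
  assumes "local_function g" "\<omega> \<in> space M" "0 \<le> s"
  shows "((\<lambda>u. g (X u \<omega>)) \<longlongrightarrow> g (X s \<omega>)) (at_right s)"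
  using continuous_on_tendsto_compose[OF local_function_continuous[OF assms(1)] X_right_continuous[OF assms(2,3)]]
  by simp

text \<open>On a grid with \<open>N\<close> intervals the impulses are the averages of the coefficients over the intervals; each vector of averages
  still has squared norm at most \<open>H\<close>. The static estimate becomes the energy inequality with \<open>\<kappa> = 4 K\<^sup>2 H / n\<^sup>2\<close>, and the error in
  \<open>kipnis_varadhan_discrete\<close> vanishes as \<open>N\<close> grows.\<close>

proposition time_integral_second_moment:
  assumes t: "0 < t" and n: "0 < n" and A: "finite A" and V: "\<And>x. local_function (V x)"
    and phi: "\<And>x. x \<in> A \<Longrightarrow> \<phi> x \<in> borel_measurable borel"
    and H: "\<And>s. (\<Sum>x\<in>A. (\<phi> x s)\<^sup>2) \<le> H"
    and Z: "finite Z"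
    and dual: "\<And>b g. local_function g \<Longrightarrow>
      \<bar>\<Sum>x\<in>A. b x * dot (V x) g\<bar> \<le> K * sqrt (\<Sum>x\<in>A. (b x)\<^sup>2) * sqrt (bond_energy Z g)"
    and K: "0 \<le> K"
  shows "\<And>\<omega>. \<omega> \<in> space M \<Longrightarrow> set_integrable lborel {0..t} (\<lambda>s. \<Sum>x\<in>A. \<phi> x s * V x (X s \<omega>))"
    and "(\<integral>\<^sup>+\<omega>. ennreal ((LBINT s:{0..t}. \<Sum>x\<in>A. \<phi> x s * V x (X s \<omega>))\<^sup>2) \<partial>M)
      \<le> ennreal (8 * K\<^sup>2 * H * t / (real n)\<^sup>2)"
proof -
  have "0 \<le> (\<Sum>x\<in>A. (\<phi> x 0)\<^sup>2)" by (intro sum_nonneg) simp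
  then have H0: "0 \<le> H" using H[of 0] by linarith
  have phi_le: "\<bar>\<phi> x s\<bar> \<le> sqrt H" if "x \<in> A" for x s
  proof -
    have "(\<phi> x s)\<^sup>2 \<le> (\<Sum>x\<in>A. (\<phi> x s)\<^sup>2)" using A that by (intro member_le_sum) auto
    then have "sqrt ((\<phi> x s)\<^sup>2) \<le> sqrt H" using H[of s] by (intro real_sqrt_le_mono) linarith
    then show ?thesis by simp
  qed
  have bV: "apply_bcontfun (Bcontfun (V x)) = V x" for x
    by (intro Bcontfun_inverse local_function_bcontfun V)
  have "\<exists>k. (Bcontfun (V x), k) \<in> generator" for x
    using local_function_in_generator[OF V[of x]] by blast
  then obtain KV where KV: "\<And>x. (Bcontfun (V x), KV x) \<in> generator" by metis
  have V_bdd: "\<bar>V x \<eta>\<bar> \<le> norm (Bcontfun (V x))" for x \<eta>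
    using norm_bounded[of "Bcontfun (V x)" \<eta>] by (simp add: bV)
  define \<delta> where "\<delta> N = t / real N" for N
  define b where "b N k x = (LBINT s:{real k * \<delta> N..<real (Suc k) * \<delta> N}. \<phi> x s) / \<delta> N" for N k x
  define F where "F N j = (\<Sum>x\<in>A. b N (N - Suc j) x *\<^sub>R Bcontfun (V x))" for N j
  define FK where "FK N j = (\<Sum>x\<in>A. b N (N - Suc j) x *\<^sub>R KV x)" for N j
  define \<kappa> where "\<kappa> = 4 * K\<^sup>2 * H / (real n)\<^sup>2"
  define B where "B = (\<Sum>x\<in>A. sqrt H * norm (Bcontfun (V x)))"
  define B' where "B' = (\<Sum>x\<in>A. sqrt H * norm (KV x))"
  define R where "R N \<omega> = (\<Sum>i<N. \<delta> N * apply_bcontfun (F N i) (X (real (N - i) * \<delta> N) \<omega>))" for N \<omega>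
  define I where "I \<omega> = (LBINT s:{0..t}. \<Sum>x\<in>A. \<phi> x s * V x (X s \<omega>))" for \<omega>
  have dpos: "0 < \<delta> N" if "0 < N" for N using t that by (simp add: \<delta>_def)
  have b2: "(\<Sum>x\<in>A. (b N k x)\<^sup>2) \<le> H" if N: "0 < N" for N k
  proof -
    have e: "real (Suc k) * \<delta> N = real k * \<delta> N + \<delta> N" by (simp add: algebra_simps)
    show ?thesis unfolding b_def e
      by (rule interval_average_bound[OF dpos[OF N] A]) (use phi phi_le H in \<open>auto intro: set_integrable_bounded_Ico\<close>)
  qed
  have b_le: "\<bar>b N k x\<bar> \<le> sqrt H" if "0 < N" "x \<in> A" for N k x
  proof -
    have "(b N k x)\<^sup>2 \<le> (\<Sum>x\<in>A. (b N k x)\<^sup>2)" using A that by (intro member_le_sum) auto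
    then have "sqrt ((b N k x)\<^sup>2) \<le> sqrt H" using b2[OF that(1), of k] by (intro real_sqrt_le_mono) linarith
    then show ?thesis by simp
  qed
  have apF: "apply_bcontfun (F N j) = (\<lambda>\<eta>. \<Sum>x\<in>A. b N (N - Suc j) x * V x \<eta>)" for N j
    using A unfolding F_def
    by (induction A rule: finite_induct) (auto simp: fun_eq_iff plus_bcontfun.rep_eq scaleR_bcontfun.rep_eq bV zero_bcontfun.rep_eq)
  have second: "(\<integral>\<omega>. (R N \<omega>)\<^sup>2 \<partial>M) \<le> 2 * t * \<kappa> + 4 * t\<^sup>2 * B * B' * \<delta> N" if N: "0 < N" for N
  proof -
    have Nd: "real N * \<delta> N = t" using N by (simp add: \<delta>_def)
    have "(\<integral>\<omega>. (R N \<omega>)\<^sup>2 \<partial>M) = (\<Sum>j<N. increment (\<delta> N) (F N) j)"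
      unfolding R_def using dpos[OF N] by (intro second_moment_increment_sum) simp
    also have "\<dots> \<le> real N * (2 * \<delta> N * \<kappa> + 4 * (\<delta> N)\<^sup>2 * (B * (real N * (\<delta> N * B'))))"
    proof (rule kipnis_varadhan_discrete)
      show "0 \<le> \<delta> N" using dpos[OF N] by simp
      show "(F N j, FK N j) \<in> generator" for j
        unfolding F_def FK_def by (intro generator_sum generator_scale KV)
      show "norm (F N j) \<le> B" for j
        unfolding F_def B_def using b_le[OF N] by (intro order_trans[OF norm_sum sum_mono]) (auto intro: mult_right_mono)
      show "norm (FK N j) \<le> B'" for j
        unfolding FK_def B'_def using b_le[OF N] by (intro order_trans[OF norm_sum sum_mono]) (auto intro: mult_right_mono)
      fix j g k assume gk: "(g, k) \<in> generator"
      show "2 * bdot (F N j) g - \<kappa> \<le> - bdot g k"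
      proof (rule generator_energy_bound[OF _ gk])
        fix g assume g: "local_function g"
        let ?E = "bond_energy Z g"
        have bg: "bounded_meas g" by (rule local_function_bounded_meas[OF g])
        have "dot (apply_bcontfun (F N j)) g = (\<Sum>x\<in>A. b N (N - Suc j) x * dot (V x) g)"
          unfolding apF using local_function_bounded_meas[OF V] bg
          by (subst dot_sum_left) (auto simp: dot_scale_left intro: bounded_meas_mult)
        also have "\<dots> \<le> K * sqrt (\<Sum>x\<in>A. (b N (N - Suc j) x)\<^sup>2) * sqrt ?E"
          using dual[OF g, of "b N (N - Suc j)"] by linarith
        also have "\<dots> \<le> K * sqrt H * sqrt ?E"
          using b2[OF N] K by (intro mult_right_mono mult_left_mono real_sqrt_le_mono) auto
        finally have 1: "dot (apply_bcontfun (F N j)) g \<le> K * sqrt H * sqrt ?E" .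
        \<comment> \<open>Young's inequality, with the weights for which \<open>v\<^sup>2\<close> is a quarter of \<open>n\<^sup>2\<close> times the bond energy.\<close>
        define u where "u = 2 * K * sqrt H / real n"
        define v where "v = real n * sqrt ?E / 2"
        have "2 * (K * sqrt H * sqrt ?E) = 2 * u * v" using n by (simp add: u_def v_def field_simps)
        also have "\<dots> \<le> u\<^sup>2 + v\<^sup>2" by (rule sum_squares_bound)
        also have "u\<^sup>2 = \<kappa>" using H0 by (simp add: u_def \<kappa>_def power_divide power_mult_distrib)
        also have "v\<^sup>2 = (real n)\<^sup>2 * ((1 / 4) * ?E)" by (simp add: v_def power_divide power_mult_distrib)
        also have "\<dots> \<le> (real n)\<^sup>2 * (- dot g (exclusion_operator a n g))"
          by (intro mult_left_mono energy_lower_bound g Z) simp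
        finally show "2 * dot (apply_bcontfun (F N j)) g - \<kappa> \<le> - ((real n)\<^sup>2 * dot g (exclusion_operator a n g))"
          using 1 by simp
      qed
    qed
    also have "\<dots> = 2 * (real N * \<delta> N) * \<kappa> + 4 * (real N * \<delta> N)\<^sup>2 * B * B' * \<delta> N"
      by (simp add: power2_eq_square algebra_simps)
    finally show ?thesis unfolding Nd .
  qed
  have sum1: "set_integrable lborel {0..t} (\<lambda>s. \<phi> x s * V x (X s \<omega>))"
    and lim1: "(\<lambda>N. \<Sum>k<N. (LBINT s:{real k * \<delta> N..<real (Suc k) * \<delta> N}. \<phi> x s) * V x (X (real (Suc k) * \<delta> N) \<omega>))
      \<longlonglongrightarrow> (LBINT s:{0..t}. \<phi> x s * V x (X s \<omega>))" if w: "\<omega> \<in> space M" and x: "x \<in> A" for x \<omega>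
    using right_endpoint_riemann_sums[where v="\<lambda>s. V x (X s \<omega>)", OF t phi[OF x] phi_le[OF x] local_observable_right_continuous[OF V w] V_bdd]
    unfolding \<delta>_def by auto
  show integ: "set_integrable lborel {0..t} (\<lambda>s. \<Sum>x\<in>A. \<phi> x s * V x (X s \<omega>))" if w: "\<omega> \<in> space M" for \<omega>
    using sum1[OF w] unfolding set_integrable_def scaleR_sum_right by (rule Bochner_Integration.integrable_sum)
  have lim: "(\<lambda>N. R N \<omega>) \<longlonglongrightarrow> I \<omega>" if w: "\<omega> \<in> space M" for \<omega>
  proof -
    have Ieq: "I \<omega> = (\<Sum>x\<in>A. LBINT s:{0..t}. \<phi> x s * V x (X s \<omega>))"
      using sum1[OF w] unfolding I_def set_lebesgue_integral_def set_integrable_def scaleR_sum_right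
      by (rule Bochner_Integration.integral_sum)
    have Req: "R N \<omega> = (\<Sum>x\<in>A. \<Sum>k<N. (LBINT s:{real k * \<delta> N..<real (Suc k) * \<delta> N}. \<phi> x s) * V x (X (real (Suc k) * \<delta> N) \<omega>))"
      if N: "0 < N" for N
    proof -
      have "R N \<omega> = (\<Sum>i<N. \<Sum>x\<in>A. (LBINT s:{real (N - Suc i) * \<delta> N..<real (Suc (N - Suc i)) * \<delta> N}. \<phi> x s) * V x (X (real (Suc (N - Suc i)) * \<delta> N) \<omega>))"
        unfolding R_def
      proof (rule sum.cong[OF refl])
        fix i assume "i \<in> {..<N}"
        then have i: "N - i = Suc (N - Suc i)" by auto
        show "\<delta> N * apply_bcontfun (F N i) (X (real (N - i) * \<delta> N) \<omega>) =
          (\<Sum>x\<in>A. (LBINT s:{real (N - Suc i) * \<delta> N..<real (Suc (N - Suc i)) * \<delta> N}. \<phi> x s) * V x (X (real (Suc (N - Suc i)) * \<delta> N) \<omega>))"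
          unfolding apF i sum_distrib_left
        proof (rule sum.cong[OF refl])
          fix x
          have "\<delta> N * (q / \<delta> N * w) = q * w" for q w using dpos[OF N] by simp
          then show "\<delta> N * (b N (N - Suc i) x * V x (X (real (Suc (N - Suc i)) * \<delta> N) \<omega>))
            = (LBINT s:{real (N - Suc i) * \<delta> N..<real (Suc (N - Suc i)) * \<delta> N}. \<phi> x s) * V x (X (real (Suc (N - Suc i)) * \<delta> N) \<omega>)"
            unfolding b_def .
        qed
      qed
      also have "\<dots> = (\<Sum>k<N. \<Sum>x\<in>A. (LBINT s:{real k * \<delta> N..<real (Suc k) * \<delta> N}. \<phi> x s) * V x (X (real (Suc k) * \<delta> N) \<omega>))"
        by (rule sum.nat_diff_reindex)
      also have "\<dots> = (\<Sum>x\<in>A. \<Sum>k<N. (LBINT s:{real k * \<delta> N..<real (Suc k) * \<delta> N}. \<phi> x s) * V x (X (real (Suc k) * \<delta> N) \<omega>))"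
        by (rule sum.swap)
      finally show ?thesis .
    qed
    have "(\<lambda>N. \<Sum>x\<in>A. \<Sum>k<N. (LBINT s:{real k * \<delta> N..<real (Suc k) * \<delta> N}. \<phi> x s) * V x (X (real (Suc k) * \<delta> N) \<omega>)) \<longlonglongrightarrow> I \<omega>"
      unfolding Ieq by (intro tendsto_sum lim1 w)
    then show ?thesis
      by (rule Lim_transform_eventually) (use eventually_gt_at_top[of 0] in eventually_elim, simp only: Req)
  qed
  have Rm: "R N \<in> borel_measurable M" if "0 < N" for N
    unfolding R_def using dpos[OF that]
    by (intro borel_measurable_sum borel_measurable_times borel_measurable_const observable_measurable) auto
  have Rint: "integrable M (\<lambda>\<omega>. (R N \<omega>)\<^sup>2)" if N: "0 < N" for N
  proof (rule path.integrable_const_bound)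
    have "\<bar>R N \<omega>\<bar> \<le> (\<Sum>i<N. \<delta> N * norm (F N i))" for \<omega>
      unfolding R_def using dpos[OF N] norm_bounded[of "F N _"]
      by (intro order_trans[OF sum_abs sum_mono]) (auto simp: abs_mult intro: mult_left_mono)
    then have "(R N \<omega>)\<^sup>2 \<le> (\<Sum>i<N. \<delta> N * norm (F N i))\<^sup>2" for \<omega>
      by (meson abs_le_square_iff abs_ge_self order_trans)
    then show "AE \<omega> in M. norm ((R N \<omega>)\<^sup>2) \<le> (\<Sum>i<N. \<delta> N * norm (F N i))\<^sup>2" by simp
    show "(\<lambda>\<omega>. (R N \<omega>)\<^sup>2) \<in> borel_measurable M" using Rm[OF N] by measurable
  qed
  have "(\<integral>\<^sup>+\<omega>. ennreal ((I \<omega>)\<^sup>2) \<partial>M) = (\<integral>\<^sup>+\<omega>. liminf (\<lambda>N. ennreal ((R (Suc N) \<omega>)\<^sup>2)) \<partial>M)"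
  proof (rule nn_integral_cong)
    fix \<omega> assume w: "\<omega> \<in> space M"
    have "(\<lambda>N. ennreal ((R (Suc N) \<omega>)\<^sup>2)) \<longlonglongrightarrow> ennreal ((I \<omega>)\<^sup>2)"
      by (intro tendsto_ennrealI tendsto_power LIMSEQ_Suc lim w)
    then show "ennreal ((I \<omega>)\<^sup>2) = liminf (\<lambda>N. ennreal ((R (Suc N) \<omega>)\<^sup>2))"
      by (rule lim_imp_Liminf[symmetric, rotated]) simp
  qed
  also have "\<dots> \<le> liminf (\<lambda>N. \<integral>\<^sup>+\<omega>. ennreal ((R (Suc N) \<omega>)\<^sup>2) \<partial>M)"
    by (intro nn_integral_liminf) (use Rm in measurable)
  also have "\<dots> \<le> liminf (\<lambda>N. ennreal (2 * t * \<kappa> + 4 * t\<^sup>2 * B * B' * \<delta> (Suc N)))"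
  proof (intro Liminf_mono always_eventually allI)
    fix N
    have "(\<integral>\<^sup>+\<omega>. ennreal ((R (Suc N) \<omega>)\<^sup>2) \<partial>M) = ennreal (\<integral>\<omega>. (R (Suc N) \<omega>)\<^sup>2 \<partial>M)"
      by (intro nn_integral_eq_integral Rint) auto
    also have "\<dots> \<le> ennreal (2 * t * \<kappa> + 4 * t\<^sup>2 * B * B' * \<delta> (Suc N))"
      by (intro ennreal_leI second) simp
    finally show "(\<integral>\<^sup>+\<omega>. ennreal ((R (Suc N) \<omega>)\<^sup>2) \<partial>M) \<le> ennreal (2 * t * \<kappa> + 4 * t\<^sup>2 * B * B' * \<delta> (Suc N))" .
  qed
  also have "\<dots> = ennreal (2 * t * \<kappa> + 4 * t\<^sup>2 * B * B' * 0)"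
  proof (rule lim_imp_Liminf)
    have "\<delta> \<longlonglongrightarrow> 0" unfolding \<delta>_def by (rule lim_const_over_n)
    then show "(\<lambda>N. ennreal (2 * t * \<kappa> + 4 * t\<^sup>2 * B * B' * \<delta> (Suc N))) \<longlonglongrightarrow> ennreal (2 * t * \<kappa> + 4 * t\<^sup>2 * B * B' * 0)"
      by (intro tendsto_ennrealI tendsto_add tendsto_mult tendsto_const LIMSEQ_Suc)
  qed simp
  also have "2 * t * \<kappa> + 4 * t\<^sup>2 * B * B' * 0 = 8 * K\<^sup>2 * H * t / (real n)\<^sup>2" by (simp add: \<kappa>_def)
  finally show "(\<integral>\<^sup>+\<omega>. ennreal ((LBINT s:{0..t}. \<Sum>x\<in>A. \<phi> x s * V x (X s \<omega>))\<^sup>2) \<partial>M)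
      \<le> ennreal (8 * K\<^sup>2 * H * t / (real n)\<^sup>2)" unfolding I_def .
qed

end

section \<open>Jointly measurable mean-square sums\<close>

lemma tendsto_zero_ennreal_geometric:
  assumes "\<And>k. \<forall>\<^sub>F A in F. u A \<le> ennreal (c * (1 / 4) ^ k)"
  shows "(u \<longlongrightarrow> 0) F"
proof (rule order_tendstoI)
  fix a :: ennreal assume a: "0 < a"
  have "(\<lambda>k. ennreal (c * (1 / 4) ^ k)) \<longlonglongrightarrow> ennreal (c * 0)"
    by (intro tendsto_ennrealI tendsto_mult tendsto_const LIMSEQ_power_zero) simp
  then have "\<forall>\<^sub>F k in sequentially. ennreal (c * (1 / 4) ^ k) < a"
    using a by (intro order_tendstoD(2)) auto
  then obtain k where "ennreal (c * (1 / 4) ^ k) < a" by (auto simp: eventually_sequentially)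
  then show "\<forall>\<^sub>F A in F. u A < a" using assms[of k] by (auto elim: eventually_mono)
qed simp

lemma (in finite_measure) integral_squared_le:
  assumes "integrable M g"
  shows "ennreal ((\<integral>s. g s \<partial>M)\<^sup>2) \<le> emeasure M (space M) * (\<integral>\<^sup>+s. ennreal ((g s)\<^sup>2) \<partial>M)"
proof -
  have [measurable]: "g \<in> borel_measurable M" using assms by simp
  have "ennreal ((\<integral>s. g s \<partial>M)\<^sup>2) = (ennreal \<bar>\<integral>s. g s \<partial>M\<bar>)\<^sup>2" by (simp add: ennreal_power)
  also have "ennreal \<bar>\<integral>s. g s \<partial>M\<bar> \<le> (\<integral>\<^sup>+s. ennreal \<bar>g s\<bar> * 1 \<partial>M)"
    using integral_norm_bound_ennreal[OF assms] by simp
  also have "(\<integral>\<^sup>+s. ennreal \<bar>g s\<bar> * 1 \<partial>M)\<^sup>2 \<le> (\<integral>\<^sup>+s. (ennreal \<bar>g s\<bar>)\<^sup>2 \<partial>M) * (\<integral>\<^sup>+s. 1\<^sup>2 \<partial>M)"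
    by (rule Cauchy_Schwarz_nn_integral) auto
  also have "\<dots> = emeasure M (space M) * (\<integral>\<^sup>+s. ennreal ((g s)\<^sup>2) \<partial>M)"
    by (simp add: ennreal_power mult.commute)
  finally show ?thesis by (simp add: power_mono)
qed

lemma square_sum_le: "(x + y)\<^sup>2 \<le> 2 * x\<^sup>2 + 2 * (y::real)\<^sup>2"
  using sum_squares_bound[of x y] by (simp add: power2_sum)

lemma nn_integral_square_sum_le:
  assumes "u \<in> borel_measurable M" "v \<in> borel_measurable M"
  shows "(\<integral>\<^sup>+\<omega>. ennreal ((u \<omega> + v \<omega>)\<^sup>2) \<partial>M)
    \<le> 2 * (\<integral>\<^sup>+\<omega>. ennreal ((u \<omega>)\<^sup>2) \<partial>M) + 2 * (\<integral>\<^sup>+\<omega>. ennreal ((v \<omega>)\<^sup>2) \<partial>M)"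
proof -
  have "(\<integral>\<^sup>+\<omega>. ennreal ((u \<omega> + v \<omega>)\<^sup>2) \<partial>M) \<le> (\<integral>\<^sup>+\<omega>. 2 * ennreal ((u \<omega>)\<^sup>2) + 2 * ennreal ((v \<omega>)\<^sup>2) \<partial>M)"
  proof (rule nn_integral_mono)
    fix \<omega>
    have "ennreal ((u \<omega> + v \<omega>)\<^sup>2) \<le> ennreal (2 * (u \<omega>)\<^sup>2 + 2 * (v \<omega>)\<^sup>2)" by (rule ennreal_leI[OF square_sum_le])
    then show "ennreal ((u \<omega> + v \<omega>)\<^sup>2) \<le> 2 * ennreal ((u \<omega>)\<^sup>2) + 2 * ennreal ((v \<omega>)\<^sup>2)"
      by (simp add: ennreal_plus ennreal_mult)
  qed
  also have "\<dots> = 2 * (\<integral>\<^sup>+\<omega>. ennreal ((u \<omega>)\<^sup>2) \<partial>M) + 2 * (\<integral>\<^sup>+\<omega>. ennreal ((v \<omega>)\<^sup>2) \<partial>M)"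
    using assms by (subst nn_integral_add) (auto simp: nn_integral_cmult)
  finally show ?thesis .
qed

text \<open>Here \<open>s\<close> stands for the time and \<open>q x s\<close> for the squared coefficient of the \<open>x\<close>-th term; the hypothesis on \<open>Y\<close> is a form of
  almost orthogonality of the terms.\<close>

locale L2_family = prob_space M + R: finite_measure R
  for M :: "'w measure" and R :: "'r measure" +
  fixes Y :: "int \<Rightarrow> 'r \<Rightarrow> 'w \<Rightarrow> real" and q :: "int \<Rightarrow> 'r \<Rightarrow> real" and C H :: real
  assumes Y_measurable: "\<And>x. (\<lambda>(s, \<omega>). Y x s \<omega>) \<in> borel_measurable (R \<Otimes>\<^sub>M M)"
    and q_measurable: "\<And>x. q x \<in> borel_measurable R"
    and q_nonneg: "\<And>x s. 0 \<le> q x s"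
    and C_nonneg: "0 \<le> C"
    and q_summable: "\<And>A s. s \<in> space R \<Longrightarrow> finite A \<Longrightarrow> (\<Sum>x\<in>A. q x s) \<le> H"
    and Y_bound: "\<And>A s. s \<in> space R \<Longrightarrow> finite A \<Longrightarrow>
      (\<integral>\<^sup>+\<omega>. ennreal ((\<Sum>x\<in>A. Y x s \<omega>)\<^sup>2) \<partial>M) \<le> ennreal (C * (\<Sum>x\<in>A. q x s))"
begin

definition window :: "nat \<Rightarrow> int set" where "window N = {- int N..int N}"

definition partial_sum :: "nat \<Rightarrow> 'r \<Rightarrow> 'w \<Rightarrow> real" where
  "partial_sum N s \<omega> = (\<Sum>x\<in>window N. Y x s \<omega>)"

definition mass :: "nat \<Rightarrow> 'r \<Rightarrow> real" where "mass N s = (\<Sum>x\<in>window N. q x s)"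

definition total_mass :: "'r \<Rightarrow> real" where "total_mass s = lim (\<lambda>N. mass N s)"

text \<open>The window is chosen separately for each \<open>s\<close>, but measurably in \<open>s\<close>. With tails below \<open>1 / 4\<^sup>k\<close>, consecutive partial sums have summable
  \<open>L\<^sup>1\<close> distance, so they converge almost surely and not just in mean square.\<close>

definition cutoff :: "nat \<Rightarrow> 'r \<Rightarrow> nat" where
  "cutoff k s = (LEAST N. total_mass s - mass N s \<le> (1 / 4) ^ k)"

definition L2_limit :: "'r \<Rightarrow> 'w \<Rightarrow> real" where
  "L2_limit s \<omega> = lim (\<lambda>k. partial_sum (cutoff k s) s \<omega>)"

lemma finite_window [simp]: "finite (window N)" by (simp add: window_def)

lemma window_mono: "N \<le> N' \<Longrightarrow> window N \<subseteq> window N'" by (auto simp: window_def)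

lemma finite_subset_window:
  assumes "finite A" shows "\<exists>N. A \<subseteq> window N"
proof
  show "A \<subseteq> window (nat (Max (insert 0 (abs ` A))))"
  proof
    fix x assume "x \<in> A"
    then have "\<bar>x\<bar> \<le> Max (insert 0 (abs ` A))" using assms by (intro Max_ge) auto
    then show "x \<in> window (nat (Max (insert 0 (abs ` A))))" by (auto simp: window_def)
  qed
qed

lemma Y_section: "s \<in> space R \<Longrightarrow> Y x s \<in> borel_measurable M"
  using measurable_compose[OF measurable_Pair1' Y_measurable[of x]] by simp

lemma partial_sum_measurable: "(\<lambda>(s, \<omega>). partial_sum N s \<omega>) \<in> borel_measurable (R \<Otimes>\<^sub>M M)"
  unfolding partial_sum_def split_beta'
  by (intro borel_measurable_sum) (use Y_measurable in \<open>simp add: split_beta'\<close>)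

lemma partial_sum_section: "s \<in> space R \<Longrightarrow> partial_sum N s \<in> borel_measurable M"
  unfolding partial_sum_def by (intro borel_measurable_sum Y_section)

lemma mass_mono: "N \<le> N' \<Longrightarrow> mass N s \<le> mass N' s"
  unfolding mass_def by (intro sum_mono2 window_mono) (auto intro: q_nonneg)

lemma mass_tendsto:
  assumes "s \<in> space R" shows "(\<lambda>N. mass N s) \<longlonglongrightarrow> total_mass s"
proof -
  have "convergent (\<lambda>N. mass N s)"
  proof (rule Bseq_mono_convergent)
    show "Bseq (\<lambda>N. mass N s)"
    proof (rule BseqI')
      fix N show "norm (mass N s) \<le> H"
        using q_summable[OF assms, of "window N"] q_nonneg by (simp add: mass_def sum_nonneg)
    qed
  qed (simp add: mass_mono)
  then show ?thesis unfolding total_mass_def by (simp add: convergent_LIMSEQ_iff)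
qed

lemma sum_q_le_total_mass:
  assumes "s \<in> space R" "finite A" shows "(\<Sum>x\<in>A. q x s) \<le> total_mass s"
proof -
  obtain N where "A \<subseteq> window N" using finite_subset_window[OF assms(2)] by blast
  then have "(\<Sum>x\<in>A. q x s) \<le> mass N s" unfolding mass_def by (intro sum_mono2) (auto intro: q_nonneg)
  also have "\<dots> \<le> total_mass s"
    using mass_tendsto[OF assms(1)] by (rule incseq_le[rotated]) (simp add: incseq_def mass_mono)
  finally show ?thesis .
qed

lemma cutoff_mass:
  assumes "s \<in> space R" shows "total_mass s - mass (cutoff k s) s \<le> (1 / 4) ^ k"
  unfolding cutoff_def
proof (rule LeastI_ex)
  have "\<forall>\<^sub>F N in sequentially. dist (mass N s) (total_mass s) < (1 / 4) ^ k"
    by (rule tendstoD[OF mass_tendsto[OF assms]]) simp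
  then obtain N where "dist (mass N s) (total_mass s) < (1 / 4) ^ k" by (auto simp: eventually_sequentially)
  then show "\<exists>N. total_mass s - mass N s \<le> (1 / 4) ^ k" by (intro exI[of _ N]) (simp add: dist_real_def)
qed

lemma cutoff_mono:
  assumes "s \<in> space R" "k \<le> j" shows "cutoff k s \<le> cutoff j s"
proof -
  have "(1 / 4 :: real) ^ j \<le> (1 / 4) ^ k" using assms(2) by (intro power_decreasing) auto
  then have "total_mass s - mass (cutoff j s) s \<le> (1 / 4) ^ k" using cutoff_mass[OF assms(1), of j] by linarith
  then show ?thesis unfolding cutoff_def[of k] by (rule Least_le)
qed

lemma tail_bound:
  assumes s: "s \<in> space R" and A: "finite A" "window (cutoff k s) \<subseteq> A"
  shows "(\<integral>\<^sup>+\<omega>. ennreal (((\<Sum>x\<in>A. Y x s \<omega>) - partial_sum (cutoff k s) s \<omega>)\<^sup>2) \<partial>M) \<le> ennreal (C * (1 / 4) ^ k)"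
proof -
  let ?D = "A - window (cutoff k s)"
  have "(\<Sum>x\<in>A. Y x s \<omega>) - partial_sum (cutoff k s) s \<omega> = (\<Sum>x\<in>?D. Y x s \<omega>)" for \<omega>
    unfolding partial_sum_def using A by (simp add: sum_diff)
  then have "(\<integral>\<^sup>+\<omega>. ennreal (((\<Sum>x\<in>A. Y x s \<omega>) - partial_sum (cutoff k s) s \<omega>)\<^sup>2) \<partial>M)
      \<le> ennreal (C * (\<Sum>x\<in>?D. q x s))" using Y_bound[OF s, of ?D] A by simp
  also have "\<dots> \<le> ennreal (C * (1 / 4) ^ k)"
  proof (intro ennreal_leI mult_left_mono C_nonneg)
    have "(\<Sum>x\<in>?D. q x s) = (\<Sum>x\<in>A. q x s) - mass (cutoff k s) s" unfolding mass_def using A by (simp add: sum_diff)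
    also have "\<dots> \<le> total_mass s - mass (cutoff k s) s" using sum_q_le_total_mass[OF s A(1)] by simp
    finally show "(\<Sum>x\<in>?D. q x s) \<le> (1 / 4) ^ k" using cutoff_mass[OF s, of k] by linarith
  qed
  finally show ?thesis .
qed

text \<open>The windows increase with \<open>k\<close>, so a later partial sum differs from an earlier one by terms of its tail.\<close>

lemma tail_bound_partial:
  assumes s: "s \<in> space R" and "k \<le> j"
  shows "(\<integral>\<^sup>+\<omega>. ennreal ((partial_sum (cutoff j s) s \<omega> - partial_sum (cutoff k s) s \<omega>)\<^sup>2) \<partial>M) \<le> ennreal (C * (1 / 4) ^ k)"
  using tail_bound[OF s finite_window window_mono[OF cutoff_mono[OF assms]]] unfolding partial_sum_def .

lemma partial_sums_converge_AE:
  assumes s: "s \<in> space R"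
  shows "AE \<omega> in M. (\<lambda>k. partial_sum (cutoff k s) s \<omega>) \<longlonglongrightarrow> L2_limit s \<omega>"
proof -
  define D where "D k \<omega> = partial_sum (cutoff (Suc k) s) s \<omega> - partial_sum (cutoff k s) s \<omega>" for k \<omega>
  have Dm [measurable]: "D k \<in> borel_measurable M" for k
    unfolding D_def by (intro borel_measurable_diff partial_sum_section[OF s])
  have D1: "(\<integral>\<^sup>+\<omega>. ennreal \<bar>D k \<omega>\<bar> \<partial>M) \<le> ennreal ((1 + C) * (1 / 2) ^ k)" for k
  proof -
    \<comment> \<open>This trades the \<open>L\<^sup>1\<close> norm for the squared \<open>L\<^sup>2\<close> norm, which is at most \<open>C / 4\<^sup>k\<close>, at a geometric price.\<close>
    have "\<bar>x\<bar> \<le> (1 / 2) ^ k + 2 ^ k * x\<^sup>2" for x :: real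
    proof -
      have "2 * (1 / 2) ^ k * \<bar>x\<bar> \<le> ((1 / 2) ^ k)\<^sup>2 + \<bar>x\<bar>\<^sup>2" by (rule sum_squares_bound)
      then have "2 ^ k * (2 * (1 / 2) ^ k * \<bar>x\<bar>) \<le> 2 ^ k * (((1 / 2) ^ k)\<^sup>2 + \<bar>x\<bar>\<^sup>2)" by (intro mult_left_mono) auto
      then have "2 * \<bar>x\<bar> \<le> (1 / 2) ^ k + 2 ^ k * x\<^sup>2"
        by (simp add: algebra_simps power2_eq_square power_divide)
      then show ?thesis by simp
    qed
    then have "(\<integral>\<^sup>+\<omega>. ennreal \<bar>D k \<omega>\<bar> \<partial>M) \<le> (\<integral>\<^sup>+\<omega>. ennreal ((1 / 2) ^ k) + ennreal (2 ^ k) * ennreal ((D k \<omega>)\<^sup>2) \<partial>M)"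
      by (intro nn_integral_mono) (simp add: ennreal_mult[symmetric] ennreal_plus[symmetric] del: ennreal_plus)
    also have "\<dots> = ennreal ((1 / 2) ^ k) + ennreal (2 ^ k) * (\<integral>\<^sup>+\<omega>. ennreal ((D k \<omega>)\<^sup>2) \<partial>M)"
      by (subst nn_integral_add) (auto simp: nn_integral_cmult emeasure_space_1)
    also have "\<dots> \<le> ennreal ((1 / 2) ^ k) + ennreal (2 ^ k) * ennreal (C * (1 / 4) ^ k)"
      unfolding D_def by (intro add_left_mono mult_left_mono tail_bound_partial[OF s]) auto
    also have "\<dots> = ennreal ((1 / 2) ^ k + 2 ^ k * (C * (1 / 4) ^ k))"
      using C_nonneg by (simp add: ennreal_mult[symmetric] ennreal_plus[symmetric] del: ennreal_plus)
    also have "2 ^ k * (C * (1 / 4) ^ k) = C * (1 / 2 :: real) ^ k"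
      by (simp add: power_divide power_mult_distrib[symmetric] field_simps)
    finally show ?thesis by (simp add: algebra_simps)
  qed
  have "(\<integral>\<^sup>+\<omega>. (\<Sum>k. ennreal \<bar>D k \<omega>\<bar>) \<partial>M) = (\<Sum>k. \<integral>\<^sup>+\<omega>. ennreal \<bar>D k \<omega>\<bar> \<partial>M)"
    by (rule nn_integral_suminf) measurable
  also have "\<dots> \<le> (\<Sum>k. ennreal ((1 + C) * (1 / 2) ^ k))" by (intro suminf_le D1) auto
  also have "\<dots> < \<infinity>"
    using C_nonneg by (subst suminf_ennreal2) (auto intro!: summable_mult summable_geometric)
  finally have "AE \<omega> in M. (\<Sum>k. ennreal \<bar>D k \<omega>\<bar>) \<noteq> \<infinity>" by (intro nn_integral_PInf_AE) auto
  then show ?thesis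
  proof eventually_elim
    case (elim \<omega>)
    then have "summable (\<lambda>k. \<bar>D k \<omega>\<bar>)" by (intro summable_suminf_not_top) auto
    then have "summable (\<lambda>k. D k \<omega>)" by (rule summable_rabs_cancel)
    then have "(\<lambda>k. \<Sum>j<k. D j \<omega>) \<longlonglongrightarrow> (\<Sum>j. D j \<omega>)" by (rule summable_LIMSEQ)
    then have "(\<lambda>k. partial_sum (cutoff 0 s) s \<omega> + (\<Sum>j<k. D j \<omega>)) \<longlonglongrightarrow> partial_sum (cutoff 0 s) s \<omega> + (\<Sum>j. D j \<omega>)"
      by (intro tendsto_add tendsto_const)
    moreover have "partial_sum (cutoff 0 s) s \<omega> + (\<Sum>j<k. D j \<omega>) = partial_sum (cutoff k s) s \<omega>" for k
      by (induction k) (auto simp: D_def)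
    ultimately have "convergent (\<lambda>k. partial_sum (cutoff k s) s \<omega>)" by (auto simp: convergent_def)
    then show ?case unfolding L2_limit_def by (simp add: convergent_LIMSEQ_iff)
  qed
qed

lemma cutoff_measurable: "cutoff k \<in> measurable R (count_space UNIV)"
proof -
  have [measurable]: "mass N \<in> borel_measurable R" for N
    unfolding mass_def by (intro borel_measurable_sum q_measurable)
  have [measurable]: "total_mass \<in> borel_measurable R"
    unfolding total_mass_def by (intro borel_measurable_lim_metric) measurable
  show ?thesis unfolding cutoff_def by measurable
qed

lemma L2_limit_measurable: "(\<lambda>(s, \<omega>). L2_limit s \<omega>) \<in> borel_measurable (R \<Otimes>\<^sub>M M)"
  unfolding L2_limit_def split_beta'
proof (rule borel_measurable_lim_metric)
  fix k
  have "(\<lambda>z. cutoff k (fst z)) \<in> measurable (R \<Otimes>\<^sub>M M) (count_space UNIV)"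
    using measurable_compose[OF measurable_fst cutoff_measurable] .
  moreover have "(\<lambda>z. partial_sum N (fst z) (snd z)) \<in> borel_measurable (R \<Otimes>\<^sub>M M)" for N
    using partial_sum_measurable[of N] by (simp add: split_beta')
  ultimately show "(\<lambda>z. partial_sum (cutoff k (fst z)) (fst z) (snd z)) \<in> borel_measurable (R \<Otimes>\<^sub>M M)"
    by (rule measurable_compose_countable[rotated])
qed

text \<open>Fatou's lemma bounds the distance of a partial sum to the almost sure limit; every larger finite set differs from the
  partial sum only by part of the tail.\<close>

proposition L2_limit_is_L2_sum:
  assumes s: "s \<in> space R" shows "has_L2_sum M (\<lambda>x \<omega>. Y x s \<omega>) (L2_limit s)"
  unfolding has_L2_sum_def
proof
  show Gm: "L2_limit s \<in> borel_measurable M"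
    using measurable_compose[OF measurable_Pair1'[OF s] L2_limit_measurable] by simp
  have lim: "(\<integral>\<^sup>+\<omega>. ennreal ((partial_sum (cutoff k s) s \<omega> - L2_limit s \<omega>)\<^sup>2) \<partial>M) \<le> ennreal (C * (1 / 4) ^ k)" for k
  proof -
    let ?p = "\<lambda>j \<omega>. partial_sum (cutoff j s) s \<omega>"
    have "(\<integral>\<^sup>+\<omega>. ennreal ((?p k \<omega> - L2_limit s \<omega>)\<^sup>2) \<partial>M) = (\<integral>\<^sup>+\<omega>. liminf (\<lambda>j. ennreal ((?p j \<omega> - ?p k \<omega>)\<^sup>2)) \<partial>M)"
    proof (rule nn_integral_cong_AE)
      show "AE \<omega> in M. ennreal ((?p k \<omega> - L2_limit s \<omega>)\<^sup>2) = liminf (\<lambda>j. ennreal ((?p j \<omega> - ?p k \<omega>)\<^sup>2))"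
        using partial_sums_converge_AE[OF s]
      proof eventually_elim
        case (elim \<omega>)
        then have "(\<lambda>j. ennreal ((?p j \<omega> - ?p k \<omega>)\<^sup>2)) \<longlonglongrightarrow> ennreal ((L2_limit s \<omega> - ?p k \<omega>)\<^sup>2)"
          by (intro tendsto_ennrealI tendsto_power tendsto_diff tendsto_const)
        then have "liminf (\<lambda>j. ennreal ((?p j \<omega> - ?p k \<omega>)\<^sup>2)) = ennreal ((L2_limit s \<omega> - ?p k \<omega>)\<^sup>2)"
          by (rule lim_imp_Liminf[rotated]) simp
        then show ?case by (simp add: power2_commute)
      qed
    qed
    also have "\<dots> \<le> liminf (\<lambda>j. \<integral>\<^sup>+\<omega>. ennreal ((?p j \<omega> - ?p k \<omega>)\<^sup>2) \<partial>M)"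
      using partial_sum_section[OF s] by (intro nn_integral_liminf) measurable
    also have "\<dots> \<le> liminf (\<lambda>j. ennreal (C * (1 / 4) ^ k))"
      by (rule Liminf_mono) (use eventually_ge_at_top[of k] in eventually_elim, rule tail_bound_partial[OF s])
    finally show ?thesis by (simp add: Liminf_const)
  qed
  show "((\<lambda>A. \<integral>\<^sup>+\<omega>. ennreal (((\<Sum>x\<in>A. Y x s \<omega>) - L2_limit s \<omega>)\<^sup>2) \<partial>M) \<longlongrightarrow> 0) (finite_subsets_at_top UNIV)"
  proof (rule tendsto_zero_ennreal_geometric)
    fix k
    have "\<forall>\<^sub>F A in finite_subsets_at_top UNIV. finite A \<and> window (cutoff k s) \<subseteq> A"
      unfolding eventually_finite_subsets_at_top by (intro exI[of _ "window (cutoff k s)"]) auto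
    then show "\<forall>\<^sub>F A in finite_subsets_at_top UNIV.
      (\<integral>\<^sup>+\<omega>. ennreal (((\<Sum>x\<in>A. Y x s \<omega>) - L2_limit s \<omega>)\<^sup>2) \<partial>M) \<le> ennreal ((4 * C) * (1 / 4) ^ k)"
    proof eventually_elim
      case (elim A)
      let ?p = "partial_sum (cutoff k s) s"
      have "(\<integral>\<^sup>+\<omega>. ennreal ((((\<Sum>x\<in>A. Y x s \<omega>) - ?p \<omega>) + (?p \<omega> - L2_limit s \<omega>))\<^sup>2) \<partial>M)
        \<le> 2 * (\<integral>\<^sup>+\<omega>. ennreal (((\<Sum>x\<in>A. Y x s \<omega>) - ?p \<omega>)\<^sup>2) \<partial>M) + 2 * (\<integral>\<^sup>+\<omega>. ennreal ((?p \<omega> - L2_limit s \<omega>)\<^sup>2) \<partial>M)"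
        by (intro nn_integral_square_sum_le borel_measurable_diff borel_measurable_sum Y_section partial_sum_section s Gm)
      also have "\<dots> \<le> 2 * ennreal (C * (1 / 4) ^ k) + 2 * ennreal (C * (1 / 4) ^ k)"
        using elim by (intro add_mono mult_left_mono lim tail_bound[OF s]) auto
      also have "\<dots> = ennreal ((4 * C) * (1 / 4) ^ k)"
      proof -
        have "2 * ennreal r + 2 * ennreal r = ennreal (4 * r)" if "0 \<le> r" for r
        proof -
          have "2 * ennreal r = ennreal (2 * r)" using that by (simp add: ennreal_mult)
          then have "2 * ennreal r + 2 * ennreal r = ennreal (2 * r + 2 * r)" using that by (simp only: ennreal_plus)
          then show ?thesis by simp
        qed
        then show ?thesis using C_nonneg by (simp add: mult.assoc)
      qed
      finally show ?case by simp
    qed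
  qed
qed

end

context L2_family
begin

lemma filterlim_window: "filterlim window (finite_subsets_at_top UNIV) sequentially"
  unfolding filterlim_finite_subsets_at_top
proof (intro allI impI)
  fix A :: "int set" assume "finite A \<and> A \<subseteq> UNIV"
  then have "\<exists>N. A \<subseteq> window N" by (intro finite_subset_window) simp
  then obtain N where N: "A \<subseteq> window N" ..
  show "\<forall>\<^sub>F N in sequentially. finite (window N) \<and> A \<subseteq> window N \<and> window N \<subseteq> UNIV"
    using eventually_ge_at_top[of N]
  proof eventually_elim
    case (elim K)
    then show ?case using N window_mono[of N K] by auto
  qed
qed

definition L2_error :: "('r \<Rightarrow> 'w \<Rightarrow> real) \<Rightarrow> nat \<Rightarrow> 'r \<Rightarrow> ennreal" where
  "L2_error G N s = (\<integral>\<^sup>+\<omega>. ennreal ((partial_sum N s \<omega> - G s \<omega>)\<^sup>2) \<partial>M)"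

lemma L2_error_tendsto:
  assumes "has_L2_sum M (\<lambda>x \<omega>. Y x s \<omega>) (G s)"
  shows "(\<lambda>N. L2_error G N s) \<longlonglongrightarrow> 0"
proof -
  have "((\<lambda>A. \<integral>\<^sup>+\<omega>. ennreal (((\<Sum>x\<in>A. Y x s \<omega>) - G s \<omega>)\<^sup>2) \<partial>M) \<longlongrightarrow> 0) (finite_subsets_at_top UNIV)"
    using assms by (simp add: has_L2_sum_def)
  from filterlim_compose[OF this filterlim_window] show ?thesis
    unfolding L2_error_def partial_sum_def .
qed

text \<open>A bound that is uniform in the time, as needed for dominated convergence in \<open>L2_sum_integral_bound\<close>. It follows by comparing
  with a partial sum over a much larger window.\<close>

lemma L2_error_le:
  assumes s: "s \<in> space R" and G: "has_L2_sum M (\<lambda>x \<omega>. Y x s \<omega>) (G s)"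
  shows "L2_error G N s \<le> 2 * ennreal (C * H)"
proof (rule LIMSEQ_le_const)
  have Gm: "G s \<in> borel_measurable M" using G by (simp add: has_L2_sum_def)
  have "(\<lambda>K. 2 * ennreal (C * H) + 2 * L2_error G K s) \<longlonglongrightarrow> 2 * ennreal (C * H) + 2 * 0"
    by (intro tendsto_add tendsto_const ennreal_tendsto_cmult L2_error_tendsto[where G=G and s=s, OF G]) simp
  then show "(\<lambda>K. 2 * ennreal (C * H) + 2 * L2_error G K s) \<longlonglongrightarrow> 2 * ennreal (C * H)" by simp
  show "\<exists>K0. \<forall>K\<ge>K0. L2_error G N s \<le> 2 * ennreal (C * H) + 2 * L2_error G K s"
  proof (intro exI[of _ N] allI impI)
    fix K assume K: "N \<le> K"
    have "L2_error G N s = (\<integral>\<^sup>+\<omega>. ennreal (((partial_sum N s \<omega> - partial_sum K s \<omega>) + (partial_sum K s \<omega> - G s \<omega>))\<^sup>2) \<partial>M)"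
      by (simp add: L2_error_def)
    also have "\<dots> \<le> 2 * (\<integral>\<^sup>+\<omega>. ennreal ((partial_sum N s \<omega> - partial_sum K s \<omega>)\<^sup>2) \<partial>M) + 2 * L2_error G K s"
      unfolding L2_error_def by (intro nn_integral_square_sum_le borel_measurable_diff partial_sum_section s Gm)
    also have "(\<integral>\<^sup>+\<omega>. ennreal ((partial_sum N s \<omega> - partial_sum K s \<omega>)\<^sup>2) \<partial>M) \<le> ennreal (C * H)"
    proof -
      let ?D = "window K - window N"
      have "partial_sum K s \<omega> - partial_sum N s \<omega> = (\<Sum>x\<in>?D. Y x s \<omega>)" for \<omega>
        unfolding partial_sum_def using window_mono[OF K] by (simp add: sum_diff)
      then have "(\<integral>\<^sup>+\<omega>. ennreal ((partial_sum N s \<omega> - partial_sum K s \<omega>)\<^sup>2) \<partial>M) \<le> ennreal (C * (\<Sum>x\<in>?D. q x s))"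
        using Y_bound[OF s, of ?D] by (simp add: power2_commute)
      also have "\<dots> \<le> ennreal (C * H)" by (intro ennreal_leI mult_left_mono C_nonneg q_summable s) simp
      finally show ?thesis .
    qed
    finally show "L2_error G N s \<le> 2 * ennreal (C * H) + 2 * L2_error G K s"
      by (simp add: mult_left_mono add_right_mono)
  qed
qed

text \<open>By Fubini's theorem, the expected time integral of the squared truncation error is the time integral of the errors, which tends to
  zero. The factor \<open>2\<close> comes from \<open>(x + y)\<^sup>2 \<le> 2 x\<^sup>2 + 2 y\<^sup>2\<close>.\<close>

proposition L2_sum_integral_bound:
  assumes Gm: "(\<lambda>(s, \<omega>). G s \<omega>) \<in> borel_measurable (R \<Otimes>\<^sub>M M)"
    and G: "\<And>s. s \<in> space R \<Longrightarrow> has_L2_sum M (\<lambda>x \<omega>. Y x s \<omega>) (G s)"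
    and P_int: "\<And>N \<omega>. \<omega> \<in> space M \<Longrightarrow> integrable R (\<lambda>s. partial_sum N s \<omega>)"
    and P_bound: "\<And>N. (\<integral>\<^sup>+\<omega>. ennreal ((\<integral>s. partial_sum N s \<omega> \<partial>R)\<^sup>2) \<partial>M) \<le> B"
  shows "AE \<omega> in M. integrable R (\<lambda>s. G s \<omega>)"
    and "(\<integral>\<^sup>+\<omega>. ennreal ((\<integral>s. G s \<omega> \<partial>R)\<^sup>2) \<partial>M) \<le> 2 * B"
proof -
  interpret pair: pair_sigma_finite R M by unfold_locales
  let ?r = "emeasure R (space R)"
  have rfin: "?r < \<top>" by (simp add: R.emeasure_eq_measure)
  have [measurable]: "(\<lambda>(s, \<omega>). partial_sum N s \<omega>) \<in> borel_measurable (R \<Otimes>\<^sub>M M)" for N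
    by (rule partial_sum_measurable)
  note Gm [measurable]
  have dm: "(\<lambda>(s, \<omega>). ennreal ((partial_sum N s \<omega> - G s \<omega>)\<^sup>2)) \<in> borel_measurable (R \<Otimes>\<^sub>M M)" for N
    by measurable
  have em: "L2_error G N \<in> borel_measurable R" for N
    unfolding L2_error_def by (rule borel_measurable_nn_integral[OF dm])
  have fub: "(\<integral>\<^sup>+\<omega>. (\<integral>\<^sup>+s. ennreal ((partial_sum N s \<omega> - G s \<omega>)\<^sup>2) \<partial>R) \<partial>M) = (\<integral>\<^sup>+s. L2_error G N s \<partial>R)" for N
    unfolding L2_error_def by (rule pair.Fubini'[OF dm])
  have err: "(\<lambda>N. \<integral>\<^sup>+s. L2_error G N s \<partial>R) \<longlonglongrightarrow> (\<integral>\<^sup>+s. 0 \<partial>R)"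
  proof (rule nn_integral_dominated_convergence[where w="\<lambda>_. 2 * ennreal (C * H)"])
    show "(\<integral>\<^sup>+s. 2 * ennreal (C * H) \<partial>R) < \<infinity>" using rfin by (simp add: ennreal_mult_less_top)
  qed (auto intro: em L2_error_le G L2_error_tendsto[where G=G])
  have fin: "(\<integral>\<^sup>+s. L2_error G 0 s \<partial>R) \<noteq> \<infinity>"
  proof -
    have "(\<integral>\<^sup>+s. L2_error G 0 s \<partial>R) \<le> (\<integral>\<^sup>+s. 2 * ennreal (C * H) \<partial>R)" by (intro nn_integral_mono L2_error_le G)
    also have "\<dots> < \<infinity>" using rfin by (simp add: ennreal_mult_less_top)
    finally show ?thesis by simp
  qed
  have inm: "(\<lambda>\<omega>. \<integral>\<^sup>+s. ennreal ((partial_sum N s \<omega> - G s \<omega>)\<^sup>2) \<partial>R) \<in> borel_measurable M" for N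
    by (rule R.borel_measurable_nn_integral) measurable
  have Gsec: "(\<lambda>s. G s \<omega>) \<in> borel_measurable R" if "\<omega> \<in> space M" for \<omega>
    using measurable_compose[OF measurable_Pair2'[OF that] Gm] by simp
  have Psec: "(\<lambda>s. partial_sum N s \<omega>) \<in> borel_measurable R" if "\<omega> \<in> space M" for \<omega> N
    using measurable_compose[OF measurable_Pair2'[OF that] partial_sum_measurable[of N]] by simp
  have "AE \<omega> in M. (\<integral>\<^sup>+s. ennreal ((partial_sum 0 s \<omega> - G s \<omega>)\<^sup>2) \<partial>R) \<noteq> \<infinity>"
    using fin unfolding fub[symmetric] by (rule nn_integral_PInf_AE[OF inm])
  then show integrable: "AE \<omega> in M. integrable R (\<lambda>s. G s \<omega>)"
  proof (rule AE_mp, intro AE_I2 impI)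
    fix \<omega> assume w: "\<omega> \<in> space M" and f: "(\<integral>\<^sup>+s. ennreal ((partial_sum 0 s \<omega> - G s \<omega>)\<^sup>2) \<partial>R) \<noteq> \<infinity>"
    have "integrable R (\<lambda>s. partial_sum 0 s \<omega> - G s \<omega>)"
    proof (rule integrableI_bounded)
      show "(\<lambda>s. partial_sum 0 s \<omega> - G s \<omega>) \<in> borel_measurable R" by (intro borel_measurable_diff Psec Gsec w)
      have "(\<integral>\<^sup>+s. ennreal (norm (partial_sum 0 s \<omega> - G s \<omega>)) \<partial>R) \<le> (\<integral>\<^sup>+s. 1 + ennreal ((partial_sum 0 s \<omega> - G s \<omega>)\<^sup>2) \<partial>R)"
      proof (rule nn_integral_mono)
        fix s
        have "norm u \<le> 1 + u\<^sup>2" for u :: real using sum_squares_bound[of 1 "\<bar>u\<bar>"] by simp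
        then have "ennreal (norm (partial_sum 0 s \<omega> - G s \<omega>)) \<le> ennreal (1 + (partial_sum 0 s \<omega> - G s \<omega>)\<^sup>2)"
          by (rule ennreal_leI)
        then show "ennreal (norm (partial_sum 0 s \<omega> - G s \<omega>)) \<le> 1 + ennreal ((partial_sum 0 s \<omega> - G s \<omega>)\<^sup>2)"
          by (simp add: ennreal_plus)
      qed
      also have "\<dots> = ?r + (\<integral>\<^sup>+s. ennreal ((partial_sum 0 s \<omega> - G s \<omega>)\<^sup>2) \<partial>R)"
        using Psec[OF w, of 0] Gsec[OF w] by (subst nn_integral_add) auto
      also have "\<dots> < \<infinity>" using rfin f by (simp add: less_top)
      finally show "(\<integral>\<^sup>+s. ennreal (norm (partial_sum 0 s \<omega> - G s \<omega>)) \<partial>R) < \<infinity>" .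
    qed
    then show "integrable R (\<lambda>s. G s \<omega>)"
      using Bochner_Integration.integrable_diff[OF P_int[OF w, of 0]] by fastforce
  qed
  have step: "(\<integral>\<^sup>+\<omega>. ennreal ((\<integral>s. G s \<omega> \<partial>R)\<^sup>2) \<partial>M) \<le> 2 * B + 2 * ?r * (\<integral>\<^sup>+s. L2_error G N s \<partial>R)" for N
  proof -
    let ?D = "\<lambda>\<omega>. \<integral>\<^sup>+s. ennreal ((partial_sum N s \<omega> - G s \<omega>)\<^sup>2) \<partial>R"
    have Pm: "(\<lambda>\<omega>. \<integral>s. partial_sum N s \<omega> \<partial>R) \<in> borel_measurable M"
      by (rule R.borel_measurable_lebesgue_integral) measurable
    have "(\<integral>\<^sup>+\<omega>. ennreal ((\<integral>s. G s \<omega> \<partial>R)\<^sup>2) \<partial>M) \<le> (\<integral>\<^sup>+\<omega>. 2 * ennreal ((\<integral>s. partial_sum N s \<omega> \<partial>R)\<^sup>2) + 2 * ?r * ?D \<omega> \<partial>M)"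
    proof (rule nn_integral_mono_AE, rule AE_mp[OF integrable], intro AE_I2 impI)
      fix \<omega> assume w: "\<omega> \<in> space M" and i: "integrable R (\<lambda>s. G s \<omega>)"
      let ?g = "\<lambda>s. partial_sum N s \<omega> - G s \<omega>"
      have ig: "integrable R ?g" by (intro Bochner_Integration.integrable_diff P_int w i)
      have "(\<integral>s. G s \<omega> \<partial>R) = (\<integral>s. partial_sum N s \<omega> \<partial>R) + - (\<integral>s. ?g s \<partial>R)"
        using i P_int[OF w, of N] by simp
      then have "(\<integral>s. G s \<omega> \<partial>R)\<^sup>2 \<le> 2 * (\<integral>s. partial_sum N s \<omega> \<partial>R)\<^sup>2 + 2 * (\<integral>s. ?g s \<partial>R)\<^sup>2"
        using square_sum_le[of "\<integral>s. partial_sum N s \<omega> \<partial>R" "- (\<integral>s. ?g s \<partial>R)"] by (simp only: power2_minus)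
      then have "ennreal ((\<integral>s. G s \<omega> \<partial>R)\<^sup>2) \<le> ennreal (2 * (\<integral>s. partial_sum N s \<omega> \<partial>R)\<^sup>2 + 2 * (\<integral>s. ?g s \<partial>R)\<^sup>2)"
        by (rule ennreal_leI)
      also have "\<dots> = 2 * ennreal ((\<integral>s. partial_sum N s \<omega> \<partial>R)\<^sup>2) + 2 * ennreal ((\<integral>s. ?g s \<partial>R)\<^sup>2)"
        by (simp only: ennreal_plus[OF mult_nonneg_nonneg mult_nonneg_nonneg] ennreal_mult zero_le_power2 zero_le_numeral ennreal_numeral)
      also have "\<dots> \<le> 2 * ennreal ((\<integral>s. partial_sum N s \<omega> \<partial>R)\<^sup>2) + 2 * (?r * ?D \<omega>)"
        by (intro add_left_mono mult_left_mono R.integral_squared_le ig) simp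
      finally show "ennreal ((\<integral>s. G s \<omega> \<partial>R)\<^sup>2) \<le> 2 * ennreal ((\<integral>s. partial_sum N s \<omega> \<partial>R)\<^sup>2) + 2 * ?r * ?D \<omega>"
        by (simp only: mult.assoc)
    qed
    also have "\<dots> = 2 * (\<integral>\<^sup>+\<omega>. ennreal ((\<integral>s. partial_sum N s \<omega> \<partial>R)\<^sup>2) \<partial>M) + 2 * ?r * (\<integral>\<^sup>+\<omega>. ?D \<omega> \<partial>M)"
      using Pm inm[of N] by (subst nn_integral_add) (auto simp: nn_integral_cmult)
    also have "\<dots> \<le> 2 * B + 2 * ?r * (\<integral>\<^sup>+s. L2_error G N s \<partial>R)"
      unfolding fub by (intro add_right_mono mult_left_mono P_bound) simp
    finally show ?thesis .
  qed
  show "(\<integral>\<^sup>+\<omega>. ennreal ((\<integral>s. G s \<omega> \<partial>R)\<^sup>2) \<partial>M) \<le> 2 * B"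
  proof (rule LIMSEQ_le_const)
    have "(\<lambda>N. 2 * B + 2 * ?r * (\<integral>\<^sup>+s. L2_error G N s \<partial>R)) \<longlonglongrightarrow> 2 * B + 2 * ?r * (\<integral>\<^sup>+s. 0 \<partial>R)"
      using rfin by (intro tendsto_add tendsto_const ennreal_tendsto_cmult err) (simp add: ennreal_mult_less_top)
    then show "(\<lambda>N. 2 * B + 2 * ?r * (\<integral>\<^sup>+s. L2_error G N s \<partial>R)) \<longlonglongrightarrow> 2 * B" by simp
  qed (use step in blast)
qed

end

section \<open>Sums of translates of a local function\<close>

context bernoulli_density
begin

lemma l2_scale: "l2 (\<lambda>\<eta>. c * g \<eta>) = \<bar>c\<bar> * l2 g"
proof -
  have "dot (\<lambda>\<eta>. c * g \<eta>) (\<lambda>\<eta>. c * g \<eta>) = c\<^sup>2 * dot g g"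
    by (simp add: dot_scale_left dot_scale_right power2_eq_square)
  then show ?thesis by (simp add: l2_def real_sqrt_mult)
qed

lemma l2_sum_le:
  assumes "finite I" "\<And>i. i \<in> I \<Longrightarrow> bounded_meas (g i)"
  shows "l2 (\<lambda>\<eta>. \<Sum>i\<in>I. g i \<eta>) \<le> (\<Sum>i\<in>I. l2 (g i))"
  using assms
proof (induction I rule: finite_induct)
  case empty
  then show ?case by (simp add: l2_def dot_def)
next
  case (insert i I)
  have "l2 (\<lambda>\<eta>. g i \<eta> + (\<Sum>i\<in>I. g i \<eta>)) \<le> l2 (g i) + l2 (\<lambda>\<eta>. \<Sum>i\<in>I. g i \<eta>)"
    using insert.prems by (intro l2_triangle bounded_meas_sum) auto
  then show ?case using insert by simp
qed

text \<open>Distinct translates of a nonempty finite set are distinct sets, so the monomials are orthogonal.\<close>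

lemma dot_self_translates:
  assumes S: "finite S" "S \<noteq> {}" and A: "finite A"
  shows "dot (\<lambda>\<eta>. \<Sum>x\<in>A. c x * \<Psi> ((+) x ` S) \<eta>) (\<lambda>\<eta>. \<Sum>x\<in>A. c x * \<Psi> ((+) x ` S) \<eta>) \<le> (\<Sum>x\<in>A. (c x)\<^sup>2)"
proof -
  let ?U = "\<lambda>\<eta>. \<Sum>x\<in>A. c x * \<Psi> ((+) x ` S) \<eta>"
  have inj: "(+) x ` S = (+) y ` S \<longleftrightarrow> x = y" for x y :: int
  proof
    assume e: "(+) x ` S = (+) y ` S"
    have "(\<Sum>i\<in>(+) z ` S. i) = int (card S) * z + (\<Sum>i\<in>S. i)" for z
      by (subst sum.reindex) (auto simp: sum.distrib)
    from this[of x] this[of y] have "int (card S) * x = int (card S) * y" unfolding e by linarith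
    then show "x = y" using S by (simp add: card_gt_0_iff)
  qed simp
  have bm: "bounded_meas ?U" "\<And>x. bounded_meas (\<lambda>\<eta>. c x * \<Psi> ((+) x ` S) \<eta>)" by (intro bounded_meas_intros)+
  have "dot ?U ?U = (\<Sum>x\<in>A. c x * (\<Sum>y\<in>A. c y * dot (\<Psi> ((+) y ` S)) (\<Psi> ((+) x ` S))))"
  proof -
    have "dot (\<Psi> T) ?U = (\<Sum>y\<in>A. c y * dot (\<Psi> ((+) y ` S)) (\<Psi> T))" for T
      by (subst dot_commute, subst dot_sum_left[OF bm(2)]) (simp_all add: dot_scale_left)
    then show ?thesis
      by (subst dot_sum_left[OF bm(2) bm(1)]) (simp add: dot_scale_left)
  qed
  also have "\<dots> = (\<Sum>x\<in>A. \<Sum>y\<in>A. if y = x then (c x)\<^sup>2 * (\<rho> * (1 - \<rho>)) ^ card S else 0)"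
    unfolding sum_distrib_left using S rho_pos rho_less_1
    by (intro sum.cong refl) (auto simp: dot_def integral_centred_monomial_mult inj power2_eq_square card_image)
  also have "\<dots> = (\<Sum>x\<in>A. (c x)\<^sup>2 * (\<rho> * (1 - \<rho>)) ^ card S)" using A by simp
  also have "\<dots> \<le> (\<Sum>x\<in>A. (c x)\<^sup>2)"
  proof (rule sum_mono)
    fix x
    have "\<rho> * (1 - \<rho>) \<le> 1" using rho_pos rho_less_1 by (intro mult_le_one) auto
    then have "(\<rho> * (1 - \<rho>)) ^ card S \<le> 1" using rho_pos rho_less_1 by (intro power_le_one) auto
    then show "(c x)\<^sup>2 * (\<rho> * (1 - \<rho>)) ^ card S \<le> (c x)\<^sup>2" by (simp add: mult_left_le)
  qed
  finally show ?thesis .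
qed

text \<open>A mean-zero \<open>g\<close> has no constant term in its expansion, and the translates of every other monomial are orthogonal.\<close>

lemma translates_l2_bound:
  assumes B: "finite B" "supported_in B g" and mean: "dot g (\<lambda>_. 1) = 0"
  shows "\<exists>C\<ge>0. \<forall>A c. finite A \<longrightarrow>
    l2 (\<lambda>\<eta>. \<Sum>x\<in>A. c x * g (shift x \<eta>)) \<le> C * sqrt (\<Sum>x\<in>A. (c x)\<^sup>2)"
proof -
  from supported_in_fourier[OF B, of \<rho>] obtain w where w: "\<And>\<eta>. g \<eta> = (\<Sum>S\<in>Pow B. w S * \<Psi> S \<eta>)" by blast
  have fin: "finite S" if "S \<in> Pow B" for S using that B finite_subset by auto
  have bmw: "bounded_meas (\<lambda>\<eta>. w S * \<Psi> S \<eta>)" for S by (intro bounded_meas_intros)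
  have "dot g (\<lambda>_. 1) = (\<Sum>S\<in>Pow B. w S * dot (\<Psi> S) (\<lambda>_. 1))"
    unfolding w by (subst dot_sum_left[OF bmw]) (simp_all add: dot_scale_left)
  also have "\<dots> = (\<Sum>S\<in>Pow B. if S = {} then w {} else 0)"
    using fin rho_pos rho_less_1
    by (intro sum.cong refl) (auto simp: dot_def integral_centred_monomial card_gt_0_iff)
  also have "\<dots> = w {}" using B by (simp add: sum.delta)
  finally have w0: "w {} = 0" using mean by simp
  show ?thesis
  proof (intro exI[of _ "\<Sum>S\<in>Pow B. \<bar>w S\<bar>"] conjI allI impI)
    show "0 \<le> (\<Sum>S\<in>Pow B. \<bar>w S\<bar>)" by (intro sum_nonneg) simp
    fix A :: "int set" and c :: "int \<Rightarrow> real" assume A: "finite A"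
    let ?U = "\<lambda>S \<eta>. \<Sum>x\<in>A. c x * \<Psi> ((+) x ` S) \<eta>"
    have bmU: "bounded_meas (\<lambda>\<eta>. w S * ?U S \<eta>)" for S by (intro bounded_meas_intros)
    have eq: "(\<Sum>x\<in>A. c x * g (shift x \<eta>)) = (\<Sum>S\<in>Pow B. w S * ?U S \<eta>)" for \<eta>
      unfolding w centred_monomial_shift sum_distrib_left
      by (subst sum.swap) (simp add: mult.left_commute)
    have "l2 (\<lambda>\<eta>. \<Sum>S\<in>Pow B. w S * ?U S \<eta>) \<le> (\<Sum>S\<in>Pow B. l2 (\<lambda>\<eta>. w S * ?U S \<eta>))"
      using B by (intro l2_sum_le bmU) auto
    also have "\<dots> \<le> (\<Sum>S\<in>Pow B. \<bar>w S\<bar> * sqrt (\<Sum>x\<in>A. (c x)\<^sup>2))"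
    proof (rule sum_mono)
      fix S assume S: "S \<in> Pow B"
      show "l2 (\<lambda>\<eta>. w S * ?U S \<eta>) \<le> \<bar>w S\<bar> * sqrt (\<Sum>x\<in>A. (c x)\<^sup>2)"
      proof (cases "S = {}")
        case True
        then show ?thesis using w0 by (simp add: l2_def dot_def)
      next
        case False
        then have "l2 (?U S) \<le> sqrt (\<Sum>x\<in>A. (c x)\<^sup>2)"
          unfolding l2_def using dot_self_translates[OF fin[OF S] False A, of c] by (intro real_sqrt_le_mono)
        then show ?thesis unfolding l2_scale by (intro mult_left_mono) auto
      qed
    qed
    finally show "l2 (\<lambda>\<eta>. \<Sum>x\<in>A. c x * g (shift x \<eta>)) \<le> (\<Sum>S\<in>Pow B. \<bar>w S\<bar>) * sqrt (\<Sum>x\<in>A. (c x)\<^sup>2)"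
      unfolding eq by (simp add: sum_distrib_right)
  qed
qed

lemma sym_mean_shift: "sym_mean k B (shift x \<eta>) = sym_mean k ((+) x ` B) \<eta>"
proof -
  have "(\<Sum>S | S \<subseteq> B \<and> card S = k. \<Psi> ((+) x ` S) \<eta>) = (\<Sum>S | S \<subseteq> (+) x ` B \<and> card S = k. \<Psi> S \<eta>)"
  proof (rule sum.reindex_bij_witness[of _ "image ((+) (- x))" "image ((+) x)"])
    fix S
    show "(+) (- x) ` (+) x ` S = S" "(+) x ` (+) (- x) ` S = S" by (auto simp: image_image)
    show "(+) x ` S \<in> {S. S \<subseteq> (+) x ` B \<and> card S = k}" if "S \<in> {S. S \<subseteq> B \<and> card S = k}"
      using that by (auto simp: card_image)
    show "(+) (- x) ` S \<in> {S. S \<subseteq> B \<and> card S = k}" if "S \<in> {S. S \<subseteq> (+) x ` B \<and> card S = k}"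
      using that by (auto simp: card_image)
  qed simp
  then show ?thesis by (simp add: sym_mean_def centred_monomial_shift card_image)
qed

lemma block_fluctuation_shift: "block_fluctuation \<gamma> L l x \<eta> = block_fluctuation \<gamma> L l 0 (shift x \<eta>)"
proof -
  have "(+) x ` {0..<int l} = {x..<x + int l}" by (simp add: image_add_atLeastLessThan add.commute)
  moreover have "(+) 0 ` S = S" for S :: "int set" by simp
  ultimately show ?thesis
    unfolding block_fluctuation_def sym_mean_shift by (simp add: centred_monomial_shift)
qed

lemma block_fluctuation_supported:
  assumes "L \<le> l" shows "supported_in {x..<x + int l} (block_fluctuation \<gamma> L l x)"
  unfolding supported_in_def
proof (intro allI impI)
  fix \<eta> \<xi> :: config assume e: "\<forall>y\<in>{x..<x + int l}. \<eta> y = \<xi> y"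
  have mon: "\<Psi> S \<eta> = \<Psi> S \<xi>" if "S \<subseteq> {x..<x + int l}" for S
    unfolding centred_monomial_def using that e by (intro prod.cong) auto
  have "sym_mean k {x..<x + int l} \<eta> = sym_mean k {x..<x + int l} \<xi>" for k
    unfolding sym_mean_def by (intro arg_cong2[where f="(/)"] sum.cong refl mon) auto
  moreover have "\<Psi> ((+) x ` S) \<eta> = \<Psi> ((+) x ` S) \<xi>" if "S \<in> Pow {0..<int L}" for S
    using that assms by (intro mon) fastforce
  ultimately show "block_fluctuation \<gamma> L l x \<eta> = block_fluctuation \<gamma> L l x \<xi>"
    unfolding block_fluctuation_def by (intro sum.cong refl) simp
qed

lemma local_function_block_fluctuation:
  "L \<le> l \<Longrightarrow> local_function (block_fluctuation \<gamma> L l x)"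
  unfolding local_function_def using block_fluctuation_supported by blast

lemma block_fluctuation_mean_zero:
  assumes "L \<le> l" "1 \<le> l" shows "dot (block_fluctuation \<gamma> L l x) (\<lambda>_. 1) = 0"
proof -
  obtain K where K: "l = Suc K" using assms(2) by (cases l) auto
  have bm: "bounded_meas (\<lambda>\<eta>. \<gamma> S * (\<Psi> ((+) x ` S) \<eta> - sym_mean (card S) {x..<x + int l} \<eta>))" for S
    by (intro bounded_meas_intros bounded_meas_sym_mean)
  have "dot (\<lambda>\<eta>. \<Psi> ((+) x ` S) \<eta> - sym_mean (card S) {x..<x + int l} \<eta>) (\<lambda>_. 1) = 0" if S: "S \<in> Pow {0..<int L}" for S
  proof -
    have sub: "(+) x ` S \<subseteq> {x..x + int K}" using S K assms(1) by fastforce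
    have "bond_energy {x..<x + int K} (\<lambda>_. 1) = 0" by (simp add: bond_energy_def grad_def l2_def dot_def)
    moreover have "card ((+) x ` S) = card S" by (simp add: card_image)
    moreover have "{x..x + int K} = {x..<x + int l}" using K by auto
    ultimately show ?thesis using monomial_sym_mean_le[OF bounded_meas_const[of 1] sub] by simp
  qed
  then show ?thesis
    unfolding block_fluctuation_def
    by (subst dot_sum_left[OF bm]) (simp_all add: dot_scale_left)
qed

end

section \<open>Fluctuations of a local function around its block average\<close>

context exclusion_path
begin

text \<open>The time is approximated from the right by grid points, of which there are countably many.\<close>

lemma local_observable_jointly_measurable:
  assumes g: "local_function g"
  shows "(\<lambda>(s, \<omega>). g (X s \<omega>)) \<in> borel_measurable (restrict_space borel {0..t} \<Otimes>\<^sub>M M)"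
proof (rule borel_measurable_LIMSEQ_real)
  let ?k = "\<lambda>(N::nat) z. nat \<lfloor>fst z * real (Suc N)\<rfloor>"
  let ?r = "\<lambda>N k. (real k + 1) / real (Suc N)"
  fix N
  have "(\<lambda>z. g (X (?r N k) (snd z))) \<in> borel_measurable (restrict_space borel {0..t} \<Otimes>\<^sub>M M)" for k
    by (rule measurable_compose[OF measurable_snd observable_measurable[OF local_function_bounded_meas[OF g]]]) simp
  moreover have "?k N \<in> measurable (restrict_space borel {0..t} \<Otimes>\<^sub>M M) (count_space UNIV)"
  proof -
    have f: "fst \<in> borel_measurable (restrict_space borel {0..t} \<Otimes>\<^sub>M M)"
    proof -
      have "(\<lambda>u::real. u) \<in> borel_measurable (restrict_space borel {0..t})"
        by (rule measurable_restrict_space1) simp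
      from measurable_compose[OF measurable_fst this] show ?thesis .
    qed
    have "(\<lambda>u::real. nat \<lfloor>u * real (Suc N)\<rfloor>) \<in> measurable borel (count_space UNIV)" by measurable
    from measurable_compose[OF f this] show ?thesis .
  qed
  ultimately show "(\<lambda>z. g (X (?r N (?k N z)) (snd z))) \<in> borel_measurable (restrict_space borel {0..t} \<Otimes>\<^sub>M M)"
    by (rule measurable_compose_countable)
next
  let ?k = "\<lambda>(N::nat) z. nat \<lfloor>fst z * real (Suc N)\<rfloor>"
  let ?r = "\<lambda>N k. (real k + 1) / real (Suc N)"
  fix z assume "z \<in> space (restrict_space borel {0..t} \<Otimes>\<^sub>M M)"
  then obtain s \<omega> where z: "z = (s, \<omega>)" and s: "0 \<le> s" and w: "\<omega> \<in> space M"
    by (auto simp: space_pair_measure space_restrict_space)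
  have r: "s < ?r N (?k N (s, \<omega>))" "?r N (?k N (s, \<omega>)) \<le> s + 1 / real (Suc N)" for N
  proof -
    let ?j = "\<lfloor>s * real (Suc N)\<rfloor>"
    have j: "real (nat ?j) = of_int ?j" using s by simp
    have "of_int ?j \<le> s * real (Suc N)" "s * real (Suc N) < of_int ?j + 1" by linarith+
    then show "s < ?r N (?k N (s, \<omega>))" "?r N (?k N (s, \<omega>)) \<le> s + 1 / real (Suc N)"
      unfolding fst_conv j by (simp_all add: pos_less_divide_eq pos_divide_le_eq field_simps del: of_nat_Suc)
  qed
  have "(\<lambda>N. ?r N (?k N (s, \<omega>))) \<longlonglongrightarrow> s"
  proof (rule tendsto_sandwich[where f="\<lambda>_. s" and h="\<lambda>N. s + 1 / real (Suc N)"])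
    have "(\<lambda>N. s + 1 / real (Suc N)) \<longlonglongrightarrow> s + 0" by (intro tendsto_add tendsto_const LIMSEQ_Suc[OF lim_const_over_n])
    then show "(\<lambda>N. s + 1 / real (Suc N)) \<longlonglongrightarrow> s" by simp
    show "\<forall>\<^sub>F N in sequentially. s \<le> ?r N (?k N (s, \<omega>))" by (intro always_eventually allI less_imp_le r(1))
    show "\<forall>\<^sub>F N in sequentially. ?r N (?k N (s, \<omega>)) \<le> s + 1 / real (Suc N)" by (intro always_eventually allI r(2))
  qed simp
  then have "filterlim (\<lambda>N. ?r N (?k N (s, \<omega>))) (at_right s) sequentially"
    unfolding filterlim_at using r(1)
    by (intro conjI always_eventually allI) (simp_all only: greaterThan_iff less_imp_neq[symmetric] not_False_eq_True)
  from filterlim_compose[OF local_observable_right_continuous[OF g w s] this]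
  show "(\<lambda>N. g (X (?r N (?k N z)) (snd z))) \<longlonglongrightarrow> (case z of (s, \<omega>) \<Rightarrow> g (X s \<omega>))"
    by (simp add: z)
qed

lemma nn_integral_square_observable:
  assumes g: "bounded_meas g" and s: "0 \<le> s"
  shows "(\<integral>\<^sup>+\<omega>. ennreal ((g (X s \<omega>))\<^sup>2) \<partial>M) = ennreal ((l2 g)\<^sup>2)"
proof -
  have i: "integrable M (\<lambda>\<omega>. (g (X s \<omega>))\<^sup>2)"
    using observable_mult_integrable[OF g g s s] by (simp add: power2_eq_square)
  have "(\<integral>\<omega>. (g (X s \<omega>))\<^sup>2 \<partial>M) = (l2 g)\<^sup>2"
    unfolding l2_power2 dot_def using expectation_X[OF bounded_meas_mult[OF g g] s]
    by (simp add: power2_eq_square)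
  then show ?thesis using nn_integral_eq_integral[OF i] by simp
qed

lemma cond_exp_block_X:
  assumes f: "\<And>\<eta>. f \<eta> = (\<Sum>S\<in>Pow {0..<int L}. \<gamma> S * \<Psi> S \<eta>)" and l: "L \<le> l" "1 \<le> l" and s: "0 \<le> s"
  shows "AE \<omega> in M. \<forall>x. f (shift x (X s \<omega>)) - cond_exp_block \<rho> l x (\<lambda>\<eta>. f (shift x \<eta>)) (X s \<omega>)
    = block_fluctuation \<gamma> L l x (X s \<omega>)"
  unfolding AE_all_countable
proof
  fix x
  have "AE \<eta> in distr M config_algebra (X s). cond_exp_block \<rho> l x (\<lambda>\<eta>. f (shift x \<eta>)) \<eta>
      = (\<Sum>S\<in>Pow {0..<int L}. \<gamma> S * sym_mean (card S) {x..<x + int l} \<eta>)"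
    unfolding law_X[OF s] by (rule cond_exp_block_eq[OF f l])
  from AE_distrD[OF X_measurable[OF s] this]
  show "AE \<omega> in M. f (shift x (X s \<omega>)) - cond_exp_block \<rho> l x (\<lambda>\<eta>. f (shift x \<eta>)) (X s \<omega>)
    = block_fluctuation \<gamma> L l x (X s \<omega>)"
  proof eventually_elim
    case (elim \<omega>)
    have "f (shift x (X s \<omega>)) = (\<Sum>S\<in>Pow {0..<int L}. \<gamma> S * \<Psi> ((+) x ` S) (X s \<omega>))"
      by (simp add: f centred_monomial_shift)
    then show ?case unfolding elim block_fluctuation_def by (simp add: sum_subtractf right_diff_distrib)
  qed
qed

end

lemma has_L2_sum_cong_AE:
  assumes "AE \<omega> in M. \<forall>x. Y x \<omega> = Y' x \<omega>"
  shows "has_L2_sum M Y Z \<longleftrightarrow> has_L2_sum M Y' Z"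
proof -
  have "(\<integral>\<^sup>+\<omega>. ennreal (((\<Sum>x\<in>A. Y x \<omega>) - Z \<omega>)\<^sup>2) \<partial>M) = (\<integral>\<^sup>+\<omega>. ennreal (((\<Sum>x\<in>A. Y' x \<omega>) - Z \<omega>)\<^sup>2) \<partial>M)" for A
    by (rule nn_integral_cong_AE) (use assms in eventually_elim, simp)
  then show ?thesis by (simp add: has_L2_sum_def)
qed

lemma sum_le_norm2_sq:
  assumes n: "0 < n" and H: "norm2_sq T n h = ennreal H" "0 \<le> H" and s: "s \<in> {0..T}" and A: "finite A"
  shows "(\<Sum>x\<in>A. (h s (of_int x / real n))\<^sup>2) \<le> real n * H"
proof -
  let ?q = "\<lambda>x. (h s (of_int x / real n))\<^sup>2"
  have "(\<Sum>x\<in>A. ennreal (?q x)) \<le> (\<Sum>\<^sub>\<infinity>x. ennreal (?q x))"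
    unfolding nonneg_infsum_complete[OF zero_le] by (rule SUP_upper) (use A in auto)
  then have "ennreal (1 / real n) * ennreal (\<Sum>x\<in>A. ?q x) \<le> ennreal (1 / real n) * (\<Sum>\<^sub>\<infinity>x. ennreal (?q x))"
    by (intro mult_left_mono) (simp_all add: sum_ennreal)
  also have "\<dots> \<le> norm2_sq T n h" unfolding norm2_sq_def by (rule SUP_upper[OF s])
  finally have "ennreal (1 / real n * (\<Sum>x\<in>A. ?q x)) \<le> ennreal H"
    unfolding H(1) by (subst ennreal_mult) (auto intro: sum_nonneg)
  then have "1 / real n * (\<Sum>x\<in>A. ?q x) \<le> H" using H(2) by (simp only: ennreal_le_iff)
  then show ?thesis using n by (simp add: field_simps)
qed

context exclusion_path
begin

text \<open>By stationarity the terms of the sum agree almost surely with the block fluctuations evaluated along the process, so both the existence of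
  the sum and its bound are statements about these.\<close>

lemma fluctuation_estimate:
  assumes f: "\<And>\<eta>. f \<eta> = (\<Sum>S\<in>Pow {0..<int L}. \<gamma> S * \<Psi> S \<eta>)" and l: "L \<le> l" "1 \<le> l" and n: "0 < n"
    and t: "0 < t" "t \<le> T" and \<theta>: "0 < \<theta>"
    and h: "(\<lambda>(s, u). h s u) \<in> borel_measurable (restrict_space borel {0..T} \<Otimes>\<^sub>M borel)"
    and H: "norm2_sq T n h = ennreal H" "0 \<le> H" and K: "0 \<le> K"
    and dual: "\<And>A Z c g. finite A \<Longrightarrow> finite Z \<Longrightarrow> \<forall>x\<in>A. {x..<x + int l} \<subseteq> Z \<Longrightarrow> bounded_meas g \<Longrightarrow>
      \<bar>\<Sum>x\<in>A. c x * dot (block_fluctuation \<gamma> L l x) g\<bar> \<le> K * sqrt (\<Sum>x\<in>A. (c x)\<^sup>2) * sqrt (bond_energy Z g)"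
  shows "\<exists>G. fluctuation_sum \<rho> t n l f h M X G"
    and "\<And>G. fluctuation_sum \<rho> t n l f h M X G \<Longrightarrow>
      (AE \<omega> in M. set_integrable lborel {0..t} (\<lambda>s. G s \<omega>)) \<and>
      (\<integral>\<^sup>+\<omega>. ennreal ((LBINT s:{0..t}. (1 / \<theta>) * G s \<omega>)\<^sup>2) \<partial>M) \<le> ennreal (16 * K\<^sup>2 * t / (real n * \<theta>\<^sup>2) * H)"
proof -
  let ?V = "block_fluctuation \<gamma> L l"
  let ?c = "\<lambda>x s. h s (of_int x / real n)"
  define R where "R = restrict_space lborel {0..t}"
  have spR: "space R = {0..t}" by (simp add: R_def space_restrict_space)
  have setsR: "sets R = sets (restrict_space borel {0..t})" by (simp add: R_def sets_restrict_space)
  have V: "local_function (?V x)" for x by (rule local_function_block_fluctuation[OF l(1)])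
  have bV: "bounded_meas (?V x)" for x by (rule local_function_bounded_meas[OF V])
  have cm: "(\<lambda>s. indicator {0..t} s * ?c x s) \<in> borel_measurable borel" for x
  proof -
    have "(\<lambda>s. ?c x s) \<in> borel_measurable (restrict_space borel {0..T})"
      using measurable_compose[OF measurable_Pair2'[of "of_int x / real n" borel] h] by simp
    then have "(\<lambda>s. indicator {0..T} s * ?c x s) \<in> borel_measurable borel"
      by (subst (asm) borel_measurable_restrict_space_iff) auto
    then have "(\<lambda>s. indicator {0..t} s * (indicator {0..T} s * ?c x s)) \<in> borel_measurable borel" by measurable
    also have "(\<lambda>s. indicator {0..t} s * (indicator {0..T} s * ?c x s)) = (\<lambda>s. indicator {0..t} s * ?c x s)"
      using t by (auto simp: indicator_def fun_eq_iff)
    finally show ?thesis .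
  qed
  have cR: "?c x \<in> borel_measurable R" for x
    unfolding R_def using cm[of x] by (subst borel_measurable_restrict_space_iff) auto
  have cH: "(\<Sum>x\<in>A. (?c x s)\<^sup>2) \<le> real n * H" if "s \<in> {0..t}" "finite A" for s A
    using that t by (intro sum_le_norm2_sq[OF n H]) auto
  obtain C where C: "0 \<le> C" and CV: "\<And>A c. finite A \<Longrightarrow>
      l2 (\<lambda>\<eta>. \<Sum>x\<in>A. c x * ?V 0 (shift x \<eta>)) \<le> C * sqrt (\<Sum>x\<in>A. (c x)\<^sup>2)"
    using translates_l2_bound[OF finite_atLeastLessThan_int block_fluctuation_supported[OF l(1), of 0] block_fluctuation_mean_zero[OF l]]
    by blast
  have fam: "L2_family M R (\<lambda>x s \<omega>. ?c x s * ?V x (X s \<omega>)) (\<lambda>x s. (?c x s)\<^sup>2) (C\<^sup>2) (real n * H)"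
  proof (intro L2_family.intro L2_family_axioms.intro)
    show "prob_space M" by (rule path.prob_space_axioms)
    show "finite_measure R"
      by (rule finite_measureI) (use t in \<open>simp add: R_def space_restrict_space emeasure_restrict_space\<close>)
    fix x
    show "(\<lambda>s. (?c x s)\<^sup>2) \<in> borel_measurable R" using cR[of x] by measurable
    have "(\<lambda>z. ?c x (fst z)) \<in> borel_measurable (R \<Otimes>\<^sub>M M)" by (rule measurable_compose[OF measurable_fst cR])
    moreover have "(\<lambda>z. ?V x (X (fst z) (snd z))) \<in> borel_measurable (R \<Otimes>\<^sub>M M)"
      using local_observable_jointly_measurable[OF V, of x t]
      by (simp add: split_beta' measurable_cong_sets[OF sets_pair_measure_cong[OF setsR refl] refl])
    ultimately show "(\<lambda>(s, \<omega>). ?c x s * ?V x (X s \<omega>)) \<in> borel_measurable (R \<Otimes>\<^sub>M M)"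
      unfolding split_beta' by (rule borel_measurable_times)
  next
    fix A :: "int set" and s :: real assume s: "s \<in> space R" and A: "finite A"
    then show "(\<Sum>x\<in>A. (?c x s)\<^sup>2) \<le> real n * H" using cH spR by simp
    let ?g = "\<lambda>\<eta>. \<Sum>x\<in>A. ?c x s * ?V x \<eta>"
    have "(\<integral>\<^sup>+\<omega>. ennreal ((\<Sum>x\<in>A. ?c x s * ?V x (X s \<omega>))\<^sup>2) \<partial>M) = ennreal ((l2 ?g)\<^sup>2)"
      using s spR by (intro nn_integral_square_observable bounded_meas_sum bounded_meas_mult bounded_meas_const bV) simp
    also have "\<dots> \<le> ennreal (C\<^sup>2 * (\<Sum>x\<in>A. (?c x s)\<^sup>2))"
    proof (rule ennreal_leI)
      have "l2 ?g \<le> C * sqrt (\<Sum>x\<in>A. (?c x s)\<^sup>2)"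
        using CV[OF A, of "\<lambda>x. ?c x s"] by (subst block_fluctuation_shift)
      then have "(l2 ?g)\<^sup>2 \<le> (C * sqrt (\<Sum>x\<in>A. (?c x s)\<^sup>2))\<^sup>2" by (intro power_mono) auto
      then show "(l2 ?g)\<^sup>2 \<le> C\<^sup>2 * (\<Sum>x\<in>A. (?c x s)\<^sup>2)" by (simp add: power_mult_distrib sum_nonneg)
    qed
    finally show "(\<integral>\<^sup>+\<omega>. ennreal ((\<Sum>x\<in>A. ?c x s * ?V x (X s \<omega>))\<^sup>2) \<partial>M) \<le> ennreal (C\<^sup>2 * (\<Sum>x\<in>A. (?c x s)\<^sup>2))" .
  qed auto
  interpret fam: L2_family M R "\<lambda>x s \<omega>. ?c x s * ?V x (X s \<omega>)" "\<lambda>x s. (?c x s)\<^sup>2" "C\<^sup>2" "real n * H" by (rule fam)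
  have sum_iff: "has_L2_sum M (\<lambda>x \<omega>. ?c x s * (f (shift x (X s \<omega>)) - cond_exp_block \<rho> l x (\<lambda>\<eta>. f (shift x \<eta>)) (X s \<omega>))) Z
      \<longleftrightarrow> has_L2_sum M (\<lambda>x \<omega>. ?c x s * ?V x (X s \<omega>)) Z" if "0 \<le> s" for s Z
    by (rule has_L2_sum_cong_AE) (use cond_exp_block_X[OF f l that] in eventually_elim, simp)
  have fl_iff: "fluctuation_sum \<rho> t n l f h M X G \<longleftrightarrow> (\<lambda>(s, \<omega>). G s \<omega>) \<in> borel_measurable (R \<Otimes>\<^sub>M M) \<and>
      (\<forall>s\<in>space R. has_L2_sum M (\<lambda>x \<omega>. ?c x s * ?V x (X s \<omega>)) (G s))" for G
    unfolding fluctuation_sum_def spR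
    by (simp add: sum_iff measurable_cong_sets[OF sets_pair_measure_cong[OF setsR refl] refl])
  show "\<exists>G. fluctuation_sum \<rho> t n l f h M X G"
    unfolding fl_iff using fam.L2_limit_measurable fam.L2_limit_is_L2_sum by blast
  have finite_sums: "(\<forall>\<omega>\<in>space M. set_integrable lborel {0..t} (\<lambda>s. fam.partial_sum N s \<omega>)) \<and>
      (\<integral>\<^sup>+\<omega>. ennreal ((LBINT s:{0..t}. fam.partial_sum N s \<omega>)\<^sup>2) \<partial>M) \<le> ennreal (8 * K\<^sup>2 * (real n * H) * t / (real n)\<^sup>2)" for N
  proof -
    let ?\<phi> = "\<lambda>x s. indicator {0..t} s * ?c x s" and ?Z = "{- int N..int N + int l}"
    have phiH: "(\<Sum>x\<in>fam.window N. (?\<phi> x s)\<^sup>2) \<le> real n * H" for s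
      using cH[of s "fam.window N"] H(2) by (cases "s \<in> {0..t}") auto
    have dualN: "\<bar>\<Sum>x\<in>fam.window N. b x * dot (?V x) g\<bar> \<le> K * sqrt (\<Sum>x\<in>fam.window N. (b x)\<^sup>2) * sqrt (bond_energy ?Z g)"
      if "local_function g" for b g
      by (rule dual) (use local_function_bounded_meas[OF that] in \<open>auto simp: fam.window_def\<close>)
    have eq: "indicator {0..t} s *\<^sub>R (\<Sum>x\<in>fam.window N. ?\<phi> x s * ?V x (X s \<omega>)) = indicator {0..t} s *\<^sub>R fam.partial_sum N s \<omega>" for s \<omega>
      unfolding fam.partial_sum_def by (cases "s \<in> {0..t}") auto
    note sm = time_integral_second_moment[where A="fam.window N" and V="?V" and \<phi>="?\<phi>" and H="real n * H" and Z="?Z" and K=K,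
        OF t(1) n fam.finite_window V cm phiH finite_atLeastAtMost_int dualN K]
    show ?thesis using sm unfolding set_integrable_def set_lebesgue_integral_def eq by blast
  qed
  fix G assume "fluctuation_sum \<rho> t n l f h M X G"
  then have Gm: "(\<lambda>(s, \<omega>). G s \<omega>) \<in> borel_measurable (R \<Otimes>\<^sub>M M)"
    and GL: "\<And>s. s \<in> space R \<Longrightarrow> has_L2_sum M (\<lambda>x \<omega>. ?c x s * ?V x (X s \<omega>)) (G s)" unfolding fl_iff by auto
  have intR: "integrable R u \<longleftrightarrow> set_integrable lborel {0..t} u" for u :: "real \<Rightarrow> real"
    unfolding R_def set_integrable_def by (rule integrable_restrict_space) simp
  have intR': "integral\<^sup>L R u = (LBINT s:{0..t}. u s)" for u :: "real \<Rightarrow> real"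
    unfolding R_def set_lebesgue_integral_def by (rule integral_restrict_space) simp
  have bnd: "(AE \<omega> in M. integrable R (\<lambda>s. G s \<omega>)) \<and>
    (\<integral>\<^sup>+\<omega>. ennreal ((\<integral>s. G s \<omega> \<partial>R)\<^sup>2) \<partial>M) \<le> 2 * ennreal (8 * K\<^sup>2 * (real n * H) * t / (real n)\<^sup>2)"
    using fam.L2_sum_integral_bound[OF Gm GL] finite_sums unfolding intR intR' by blast
  have Im: "(\<lambda>\<omega>. \<integral>s. G s \<omega> \<partial>R) \<in> borel_measurable M"
  proof (rule fam.R.borel_measurable_lebesgue_integral)
    note Gm [measurable]
    show "(\<lambda>(\<omega>, s). G s \<omega>) \<in> borel_measurable (M \<Otimes>\<^sub>M R)" by measurable
  qed
  have scale: "(LBINT s:{0..t}. (1 / \<theta>) * G s \<omega>) = (1 / \<theta>) * (\<integral>s. G s \<omega> \<partial>R)" for \<omega>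
    unfolding intR'[symmetric] by (rule integral_mult_right_zero)
  have "(\<integral>\<^sup>+\<omega>. ennreal ((LBINT s:{0..t}. (1 / \<theta>) * G s \<omega>)\<^sup>2) \<partial>M)
      = (\<integral>\<^sup>+\<omega>. ennreal ((1 / \<theta>)\<^sup>2) * ennreal ((\<integral>s. G s \<omega> \<partial>R)\<^sup>2) \<partial>M)"
    unfolding scale power_mult_distrib by (simp add: ennreal_mult)
  also have "\<dots> = ennreal ((1 / \<theta>)\<^sup>2) * (\<integral>\<^sup>+\<omega>. ennreal ((\<integral>s. G s \<omega> \<partial>R)\<^sup>2) \<partial>M)"
    by (intro nn_integral_cmult measurable_compose[OF borel_measurable_power[OF Im] measurable_ennreal])
  also have "\<dots> \<le> ennreal ((1 / \<theta>)\<^sup>2) * (2 * ennreal (8 * K\<^sup>2 * (real n * H) * t / (real n)\<^sup>2))"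
    using bnd by (intro mult_left_mono) auto
  also have "\<dots> = ennreal ((1 / \<theta>)\<^sup>2 * (2 * (8 * K\<^sup>2 * (real n * H) * t / (real n)\<^sup>2)))"
  proof -
    have "ennreal p * (2 * ennreal r) = ennreal (p * (2 * r))" if "0 \<le> p" "0 \<le> r" for p r
      using that by (simp add: ennreal_mult)
    then show ?thesis using H(2) t by simp
  qed
  also have "(1 / \<theta>)\<^sup>2 * (2 * (8 * K\<^sup>2 * (real n * H) * t / (real n)\<^sup>2)) = 16 * K\<^sup>2 * t / (real n * \<theta>\<^sup>2) * H"
    using n \<theta> by (simp add: field_simps power2_eq_square)
  finally show "(AE \<omega> in M. set_integrable lborel {0..t} (\<lambda>s. G s \<omega>)) \<and>
      (\<integral>\<^sup>+\<omega>. ennreal ((LBINT s:{0..t}. (1 / \<theta>) * G s \<omega>)\<^sup>2) \<partial>M) \<le> ennreal (16 * K\<^sup>2 * t / (real n * \<theta>\<^sup>2) * H)"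
    using bnd unfolding intR by blast
qed

end

theorem corollary1:
  fixes a \<rho> T :: real and m :: nat and f :: "config \<Rightarrow> real"
  assumes "a > 0" and "0 < \<rho>" and "\<rho> < 1" and "T > 0"
    and "m \<ge> 1" and "local_function f" and "has_degree \<rho> f m"
  shows "\<exists>C>0. \<forall>(l::nat) (t::real) (n::nat) (\<theta>::nat \<Rightarrow> real) (h::real \<Rightarrow> real \<Rightarrow> real)
            (M::'w measure) (X::real \<Rightarrow> 'w \<Rightarrow> config).
      l \<ge> 2 \<longrightarrow> l > m \<longrightarrow> supported_in {0..int l - 1} f \<longrightarrow>
      0 < t \<longrightarrow> t \<le> T \<longrightarrow>
      real n \<ge> a\<^sup>2 \<longrightarrow> \<theta> n > 0 \<longrightarrow>
      (\<lambda>(s, u). h s u) \<in> borel_measurable (restrict_space borel {0..T} \<Otimes>\<^sub>M borel) \<longrightarrow>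
      norm2_sq T n h < \<infinity> \<longrightarrow>
      exclusion_process a \<rho> n M X \<longrightarrow>
      (\<exists>G. fluctuation_sum \<rho> t n l f h M X G) \<and>
      (\<forall>G. fluctuation_sum \<rho> t n l f h M X G \<longrightarrow>
         (AE \<omega> in M. set_integrable lborel {0..t} (\<lambda>s. G s \<omega>)) \<and>
         (\<integral>\<^sup>+\<omega>. ennreal ((LBINT s:{0..t}. (1 / \<theta> n) * G s \<omega>)\<^sup>2) \<partial>M)
           \<le> ennreal (C * t * (c_const m l / (real n * (\<theta> n)\<^sup>2))) * norm2_sq T n h)"
proof (cases "\<exists>l. 2 \<le> l \<and> supported_in {0..int l - 1} f")
  case False
  then show ?thesis by (intro exI[of _ 1]) auto
next
  case True
  \<comment> \<open>The least admissible block length depends on \<open>f\<close> only, so a constant that depends on \<open>L\<close> is uniform in \<open>l\<close>.\<close>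
  define L where "L = (LEAST l. 2 \<le> l \<and> supported_in {0..int l - 1} f)"
  have L: "2 \<le> L" "supported_in {0..int L - 1} f" using LeastI_ex[OF True] by (auto simp: L_def)
  have L_le: "L \<le> l" if "2 \<le> l" "supported_in {0..int l - 1} f" for l
    unfolding L_def using that by (intro Least_le) simp
  interpret bernoulli_density \<rho> by unfold_locales (use assms in auto)
  have "{0..int L - 1} = {0..<int L}" by auto
  then have sup: "supported_in {0..<int L} f" using L by simp
  from supported_in_fourier[OF finite_atLeastLessThan_int sup, of \<rho>]
  obtain \<gamma> where f: "\<And>\<eta>. f \<eta> = (\<Sum>S\<in>Pow {0..<int L}. \<gamma> S * centred_monomial \<rho> S \<eta>)" by blast
  have "1 \<le> L" using L(1) by simp
  have degree: "(\<Sum>S | S \<subseteq> {0..<int L} \<and> card S = k. \<gamma> S) = 0" if "k < m" for k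
    by (rule has_degree_fourier[OF f assms(7) that])
  have "\<exists>C\<ge>0. \<forall>l A Z c g. 2 \<le> l \<longrightarrow> L \<le> l \<longrightarrow> finite A \<longrightarrow> finite Z \<longrightarrow>
    (\<forall>x\<in>A. {x..<x + int l} \<subseteq> Z) \<longrightarrow> bounded_meas g \<longrightarrow>
    \<bar>\<Sum>x\<in>A. c x * dot (block_fluctuation \<gamma> L l x) g\<bar>
      \<le> C * sqrt (c_const m l) * sqrt (\<Sum>x\<in>A. (c x)\<^sup>2) * sqrt (bond_energy Z g)"
    by (rule block_fluctuation_dual_estimate[OF assms(5) \<open>1 \<le> L\<close> degree])
  then obtain C0 where C0: "0 \<le> C0" and bound: "\<forall>l A Z c g. 2 \<le> l \<longrightarrow> L \<le> l \<longrightarrow> finite A \<longrightarrow> finite Z \<longrightarrow>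
    (\<forall>x\<in>A. {x..<x + int l} \<subseteq> Z) \<longrightarrow> bounded_meas g \<longrightarrow>
    \<bar>\<Sum>x\<in>A. c x * dot (block_fluctuation \<gamma> L l x) g\<bar>
      \<le> C0 * sqrt (c_const m l) * sqrt (\<Sum>x\<in>A. (c x)\<^sup>2) * sqrt (bond_energy Z g)"
    by (elim exE conjE)
  have dual: "\<bar>\<Sum>x\<in>A. c x * dot (block_fluctuation \<gamma> L l x) g\<bar>
      \<le> C0 * sqrt (c_const m l) * sqrt (\<Sum>x\<in>A. (c x)\<^sup>2) * sqrt (bond_energy Z g)"
    if "2 \<le> l" "L \<le> l" "finite A" "finite Z" "\<forall>x\<in>A. {x..<x + int l} \<subseteq> Z" "bounded_meas g" for l A Z c g
    by (rule bound[THEN spec[of _ l], THEN spec[of _ A], THEN spec[of _ Z], THEN spec[of _ c], THEN spec[of _ g],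
        THEN mp, THEN mp, THEN mp, THEN mp, THEN mp, THEN mp, OF that])
  define C where "C = 16 * C0\<^sup>2 + 1"
  have Cpos: "0 < C" by (simp add: C_def add_nonneg_pos)
  have "(\<exists>G. fluctuation_sum \<rho> t n l f h M X G) \<and>
      (\<forall>G. fluctuation_sum \<rho> t n l f h M X G \<longrightarrow>
         (AE \<omega> in M. set_integrable lborel {0..t} (\<lambda>s. G s \<omega>)) \<and>
         (\<integral>\<^sup>+\<omega>. ennreal ((LBINT s:{0..t}. (1 / \<theta> n) * G s \<omega>)\<^sup>2) \<partial>M)
           \<le> ennreal (C * t * (c_const m l / (real n * (\<theta> n)\<^sup>2))) * norm2_sq T n h)"
    if l: "2 \<le> l" "supported_in {0..int l - 1} f" and t: "0 < t" "t \<le> T" and n: "a\<^sup>2 \<le> real n" and \<theta>: "0 < \<theta> n"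
      and h: "(\<lambda>(s, u). h s u) \<in> borel_measurable (restrict_space borel {0..T} \<Otimes>\<^sub>M borel)"
      and fin: "norm2_sq T n h < \<infinity>" and proc: "exclusion_process a \<rho> n M X"
    for l t n \<theta> h and M :: "'w measure" and X
  proof -
    have "0 < a\<^sup>2" using assms(1) by simp
    then have n0: "0 < n" using n by (cases n) auto
    obtain S where S: "exclusion_semigroup a n S" "markov_process S M X"
      and init: "distr M config_algebra (X 0) = bernoulli_measure \<rho>"
      using proc by (auto simp: exclusion_process_def)
    interpret exclusion_path \<rho> a n S M X by unfold_locales (use S init in auto)
    obtain H where H: "norm2_sq T n h = ennreal H" "0 \<le> H" using fin by (cases "norm2_sq T n h") auto
    have c0: "0 \<le> c_const m l" by (simp add: c_const_def)
    have K: "0 \<le> C0 * sqrt (c_const m l)" using C0 c0 by simp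
    have l1: "1 \<le> l" using l(1) by simp
    have ex: "\<exists>G. fluctuation_sum \<rho> t n l f h M X G"
      by (rule fluctuation_estimate(1)[OF f L_le[OF l] l1 n0 t \<theta> h H K]) (rule dual[OF l(1) L_le[OF l]])
    have est: "(AE \<omega> in M. set_integrable lborel {0..t} (\<lambda>s. G s \<omega>)) \<and>
        (\<integral>\<^sup>+\<omega>. ennreal ((LBINT s:{0..t}. (1 / \<theta> n) * G s \<omega>)\<^sup>2) \<partial>M)
          \<le> ennreal (16 * (C0 * sqrt (c_const m l))\<^sup>2 * t / (real n * (\<theta> n)\<^sup>2) * H)"
      if G: "fluctuation_sum \<rho> t n l f h M X G" for G
      by (rule fluctuation_estimate(2)[OF f L_le[OF l] l1 n0 t \<theta> h H K _ G]) (rule dual[OF l(1) L_le[OF l]])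
    have le: "ennreal (16 * (C0 * sqrt (c_const m l))\<^sup>2 * t / (real n * (\<theta> n)\<^sup>2) * H)
        \<le> ennreal (C * t * (c_const m l / (real n * (\<theta> n)\<^sup>2))) * norm2_sq T n h"
    proof -
      have "16 * (C0 * sqrt (c_const m l))\<^sup>2 * t / (real n * (\<theta> n)\<^sup>2) * H
          = 16 * C0\<^sup>2 * (t * (c_const m l / (real n * (\<theta> n)\<^sup>2)) * H)"
        using c0 by (simp add: power_mult_distrib)
      also have "\<dots> \<le> C * (t * (c_const m l / (real n * (\<theta> n)\<^sup>2)) * H)"
        using t H c0 by (intro mult_right_mono) (auto simp: C_def)
      finally have "ennreal (16 * (C0 * sqrt (c_const m l))\<^sup>2 * t / (real n * (\<theta> n)\<^sup>2) * H)
          \<le> ennreal (C * t * (c_const m l / (real n * (\<theta> n)\<^sup>2)) * H)"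
        by (intro ennreal_leI) (simp only: mult.assoc)
      also have "\<dots> = ennreal (C * t * (c_const m l / (real n * (\<theta> n)\<^sup>2))) * norm2_sq T n h"
        unfolding H(1) using Cpos t c0 H(2) by (intro ennreal_mult) auto
      finally show ?thesis .
    qed
    show ?thesis
    proof (intro conjI allI impI)
      show "\<exists>G. fluctuation_sum \<rho> t n l f h M X G" by (rule ex)
      fix G assume G: "fluctuation_sum \<rho> t n l f h M X G"
      show "AE \<omega> in M. set_integrable lborel {0..t} (\<lambda>s. G s \<omega>)" by (rule conjunct1[OF est[OF G]])
      show "(\<integral>\<^sup>+\<omega>. ennreal ((LBINT s:{0..t}. (1 / \<theta> n) * G s \<omega>)\<^sup>2) \<partial>M)
          \<le> ennreal (C * t * (c_const m l / (real n * (\<theta> n)\<^sup>2))) * norm2_sq T n h"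
        by (rule order_trans[OF conjunct2[OF est[OF G]] le])
    qed
  qed
  then show ?thesis using Cpos by (intro exI[of _ C]) blast
qed

end
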